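(* Let $G$ be an $8$-connected graph and let $u_1,u_2,u_3,u_4$ be four distinct vertices of $G$ such that $G$ contains no kite-linkage of $(u_2,u_1,u_3,u_4)$. Then $G$ contains a $(u_1,u_2,u_3,u_4)$-flower or a $(u_3,u_2,u_1,u_4)$-flower.
   Context: A kite-linkage of $(u_2,u_1,u_3,u_4)$ in $G$ is a collection of four internally disjoint paths in $G$: a $u_2,u_1$-path, a $u_1,u_3$-path, a $u_3,u_2$-path and a $u_2,u_4$-path. For distinct vertices $u_1,u_2,u_3,u_4$, a $(u_1,u_2,u_3,u_4)$-flower is a tuple $(C_1,C_2,C_3,P_1,P_2,P_3)$ such that: (i) $C_1,C_2,C_3$ are cycles of $G$ with $u_1\in V(C_1)$, $u_3\in V(C_2)$, $V(C_1)\cap V(C_2)=\{u_2\}$, and $C_3$ is vertex-disjoint from $C_1$ and $C_2$; (ii) for each $i\in\{1,2,3\}$, $P_i$ is a path from $u_i$ to some vertex $v_i\in V(C_3)$ that is internally disjoint from $V(C_1)\cup V(C_2)\cup V(C_3)$; (iii) $P_1,P_2,P_3$ are pairwise vertex-disjoint, and $v_1,v_2,v_3,u_4$ occur on $C_3$ in this cyclic order. *)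

theory Defs
  imports "Graph_Theory.Graph_Theory" "HOL-Library.Sublist"
begin

text \<open>
  Graphs are finite and simple, i.e. symmetric loop-free digraphs without parallel arcs
  (locale \<^locale>\<open>graph\<close>). Paths and cycles are given by their lists of vertices.
\<close>

definition k_connected :: "nat \<Rightarrow> ('a,'b) pre_digraph \<Rightarrow> bool" where
  "k_connected k G \<longleftrightarrow>
     k < card (verts G) \<and>
     (\<forall>S \<subseteq> verts G. card S < k \<longrightarrow> Digraph_Component.connected (G \<restriction> (verts G - S)))"

definition path_between :: "('a,'b) pre_digraph \<Rightarrow> 'a \<Rightarrow> 'a list \<Rightarrow> 'a \<Rightarrow> bool" where
  "path_between G u p v \<longleftrightarrow> vpath p G \<and> hd p = u \<and> last p = v"

definition internal_verts :: "'a list \<Rightarrow> 'a set" where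
  "internal_verts p = set (butlast (tl p))"

definition internally_disjoint :: "'a list list \<Rightarrow> bool" where
  "internally_disjoint ps \<longleftrightarrow>
     (\<forall>i < length ps. \<forall>j < length ps. i \<noteq> j \<longrightarrow> internal_verts (ps ! i) \<inter> set (ps ! j) = {})"

text \<open>
  The first vertex is not repeated at the end of the list. The length bound excludes going back
  and forth along an edge, which the library's notion of cycle admits in a symmetric digraph.
\<close>
definition graph_cycle :: "('a,'b) pre_digraph \<Rightarrow> 'a list \<Rightarrow> bool" where
  "graph_cycle G c \<longleftrightarrow> vpath c G \<and> 3 \<le> length c \<and> last c \<rightarrow>\<^bsub>G\<^esub> hd c"

text \<open>
  A cycle of an undirected graph has neither a distinguished starting point nor a distinguished
  orientation. As the vertices of a cycle are distinct, so are vertices in cyclic order on it.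
\<close>
definition in_cyclic_order :: "'a list \<Rightarrow> 'a list \<Rightarrow> bool" where
  "in_cyclic_order xs c \<longleftrightarrow> (\<exists>n. subseq xs (rotate n c) \<or> subseq xs (rotate n (rev c)))"

text \<open>A kite-linkage of \<open>(a, b, c, d)\<close>: \<open>a, b, c\<close> span the triangle, and \<open>d\<close> is pendant at \<open>a\<close>.\<close>
definition kite_linkage ::
  "('a,'b) pre_digraph \<Rightarrow> 'a \<times> 'a \<times> 'a \<times> 'a \<Rightarrow> 'a list \<times> 'a list \<times> 'a list \<times> 'a list \<Rightarrow> bool" where
  "kite_linkage G = (\<lambda>(a, b, c, d) (Q\<^sub>1, Q\<^sub>2, Q\<^sub>3, Q\<^sub>4).
     path_between G a Q\<^sub>1 b \<and> path_between G b Q\<^sub>2 c \<and>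
     path_between G c Q\<^sub>3 a \<and> path_between G a Q\<^sub>4 d \<and>
     internally_disjoint [Q\<^sub>1, Q\<^sub>2, Q\<^sub>3, Q\<^sub>4])"

definition flower ::
  "('a,'b) pre_digraph \<Rightarrow> 'a \<times> 'a \<times> 'a \<times> 'a \<Rightarrow>
   'a list \<times> 'a list \<times> 'a list \<times> 'a list \<times> 'a list \<times> 'a list \<Rightarrow> bool" where
  "flower G = (\<lambda>(u\<^sub>1, u\<^sub>2, u\<^sub>3, u\<^sub>4) (C\<^sub>1, C\<^sub>2, C\<^sub>3, P\<^sub>1, P\<^sub>2, P\<^sub>3).
     graph_cycle G C\<^sub>1 \<and> graph_cycle G C\<^sub>2 \<and> graph_cycle G C\<^sub>3 \<and>
     u\<^sub>1 \<in> set C\<^sub>1 \<and> u\<^sub>3 \<in> set C\<^sub>2 \<and> set C\<^sub>1 \<inter> set C\<^sub>2 = {u\<^sub>2} \<and>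
     set C\<^sub>3 \<inter> set C\<^sub>1 = {} \<and> set C\<^sub>3 \<inter> set C\<^sub>2 = {} \<and>
     (\<exists>v\<^sub>1 \<in> set C\<^sub>3. \<exists>v\<^sub>2 \<in> set C\<^sub>3. \<exists>v\<^sub>3 \<in> set C\<^sub>3.
        path_between G u\<^sub>1 P\<^sub>1 v\<^sub>1 \<and> path_between G u\<^sub>2 P\<^sub>2 v\<^sub>2 \<and> path_between G u\<^sub>3 P\<^sub>3 v\<^sub>3 \<and>
        (\<forall>P \<in> {P\<^sub>1, P\<^sub>2, P\<^sub>3}. internal_verts P \<inter> (set C\<^sub>1 \<union> set C\<^sub>2 \<union> set C\<^sub>3) = {}) \<and>
        set P\<^sub>1 \<inter> set P\<^sub>2 = {} \<and> set P\<^sub>1 \<inter> set P\<^sub>3 = {} \<and> set P\<^sub>2 \<inter> set P\<^sub>3 = {} \<and>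
        in_cyclic_order [v\<^sub>1, v\<^sub>2, v\<^sub>3, u\<^sub>4] C\<^sub>3))"

end

theory Submission
  imports Defs
begin

text \<open>
  Deleting the edges \<open>u1 u2\<close> and \<open>u2 u3\<close> leaves a 6-connected graph, in which every path between
  these pairs has an inner vertex. Menger's theorem with preserved ends yields cycles \<open>C1\<close> through
  \<open>u1\<close>, \<open>u2\<close> and \<open>C2\<close> through \<open>u2\<close>, \<open>u3\<close> that meet only in \<open>u2\<close>, and a path \<open>R\<close> from \<open>u1\<close> to \<open>u3\<close>
  that avoids them and \<open>u4\<close>. Let \<open>U\<close> be the component of \<open>u4\<close> in the rest. An edge from \<open>U\<close> to
  \<open>C1 \<union> C2 - {u1, u3}\<close> gives a kite-linkage, so all neighbours of \<open>U\<close> lie on \<open>R\<close>.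
  Take such a system with \<open>U\<close> as large as possible; then every such system that avoids \<open>U\<close> contains
  all neighbours of \<open>U\<close>. Write \<open>R = P1 r Q r' P3\<close>, where \<open>r\<close> and \<open>r'\<close> are the first and the last
  neighbour of \<open>U\<close>.

  A path from \<open>u2\<close> to an inner vertex \<open>q\<close> of \<open>Q\<close> gives a flower, because \<open>u4\<close> has disjoint paths
  through \<open>U\<close> to both sides of \<open>q\<close>. As \<open>{r, r', u1, u3}\<close> does not separate \<open>Q\<close> from \<open>u2\<close>, some path
  \<open>T\<close> leaves \<open>Q\<close>, and by the choice of \<open>U\<close> it ends on \<open>C1 \<union> C2\<close>. If it ends in \<open>c \<noteq> u2\<close> on \<open>C1\<close>,
  say, then one more path is added to the fan that leaves \<open>u2\<close> together with the component of
  \<open>C2 - u2\<close>. Wherever it arrives, there is a kite-linkage, a path from \<open>u2\<close> to \<open>Q\<close>, a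
  contradiction to the choice of \<open>U\<close>, or a path from \<open>Q\<close> to \<open>C2\<close> in addition to the one to \<open>C1\<close>; in
  the last case a fifth path of the fan at \<open>u2\<close> gives a kite-linkage or a path from \<open>u2\<close> to \<open>Q\<close>.
\<close>

section \<open>Menger's theorem with preserved ends\<close>

text \<open>The edges at \<open>u2\<close> are deleted because a cycle of a flower is assembled from
  two links with disjoint sets of inner vertices, and a single edge would count as both links. The
  price is paid at \<open>u2\<close>, which keeps only 8 - 2 = 6 neighbours: in general at most 5
  vertices may be removed, but 7 if \<open>u2\<close> is one of them. All sizes of fans below fit
  these two budgets. The obstacle is the cyclic order on \<open>C3\<close>, where \<open>u4\<close>
  must lie opposite to the end of the path from \<open>u2\<close>. A stretch of \<open>R\<close>
  closed by a detour through \<open>U\<close> is the natural \<open>C3\<close>, so what is missing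
  is a path from \<open>u2\<close> to a point strictly between \<open>r\<close> and
  \<open>r'\<close>. Maximality of \<open>U\<close> forbids every rerouting of \<open>R\<close> that
  bypasses \<open>r\<close> or \<open>r'\<close> and stays off \<open>U\<close>. Every case
  distinction adds a path to a system that must not lose its ends; ordinary Menger could return
  unrelated paths, hence the augmenting form. Paths are handled through sets of inner vertices, so
  each case consists of a choice of links and a disjointness check. The exchange of
  \<open>u1\<close> and \<open>u3\<close> is a symmetry of the whole setting and halves the
  cases.\<close>

definition is_path :: "('a \<Rightarrow> 'a \<Rightarrow> bool) \<Rightarrow> 'a list \<Rightarrow> bool" where
  "is_path E p \<longleftrightarrow> p \<noteq> [] \<and> distinct p \<and> successively E p"

text \<open>Paths stop at their first vertex in \<open>B\<close>, but may revisit \<open>A\<close>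
  after the start. This asymmetry lets the induction enlarge \<open>B\<close> while \<open>A\<close>
  stays fixed.\<close>

definition linkage :: "('a \<Rightarrow> 'a \<Rightarrow> bool) \<Rightarrow> 'a set \<Rightarrow> 'a set \<Rightarrow> 'a list set \<Rightarrow> bool" where
  "linkage E A B P \<longleftrightarrow> finite P \<and>
     (\<forall>p\<in>P. is_path E p \<and> hd p \<in> A \<and> last p \<in> B \<and> set (butlast p) \<inter> B = {}) \<and>
     (\<forall>p\<in>P. \<forall>q\<in>P. p \<noteq> q \<longrightarrow> set p \<inter> set q = {})"

lemma linkageD:
  assumes "linkage E A B P" "p \<in> P"
  shows "is_path E p" "hd p \<in> A" "last p \<in> B" "set (butlast p) \<inter> B = {}"
    "\<And>q. q \<in> P \<Longrightarrow> p \<noteq> q \<Longrightarrow> set p \<inter> set q = {}"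
  using assms by (auto simp: linkage_def)

lemma is_path_appendD:
  assumes "is_path E (p @ q)"
  shows "p \<noteq> [] \<Longrightarrow> is_path E p" "q \<noteq> [] \<Longrightarrow> is_path E q"
  using assms by (auto simp: is_path_def successively_append_iff)

lemma is_path_append:
  assumes "is_path E p" "q \<noteq> [] \<Longrightarrow> is_path E q" "q \<noteq> [] \<Longrightarrow> E (last p) (hd q)" "set p \<inter> set q = {}"
  shows "is_path E (p @ q)"
  using assms by (cases "q = []") (auto simp: is_path_def successively_append_iff)

lemma path_first_hit:
  assumes "is_path E p" "set p \<inter> B \<noteq> {}"
  obtains q s where "p = q @ s" "is_path E q" "hd q = hd p" "last q \<in> B" "set (butlast q) \<inter> B = {}"
proof -
  obtain ys x zs where p: "p = ys @ x # zs" "x \<in> B" "\<forall>y\<in>set ys. y \<notin> B"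
    using split_list_first_prop[of p "\<lambda>x. x \<in> B"] assms(2) by blast
  show ?thesis
  proof (rule that[of "ys @ [x]" zs])
    show "is_path E (ys @ [x])" using assms(1) p is_path_appendD[of E "ys @ [x]" zs] by simp
    show "hd (ys @ [x]) = hd p" using p by (cases ys) auto
  qed (use p in auto)
qed

lemma set_last_butlast: "p \<noteq> [] \<Longrightarrow> set p = insert (last p) (set (butlast p))"
  by (metis append_butlast_last_id list.simps(15) rotate1.simps(2) set_rotate1)

lemma linkage_last_inj:
  assumes "linkage E A B P" shows "inj_on last P" "inj_on hd P"
proof -
  have "p \<noteq> []" if "p \<in> P" for p using assms that by (auto simp: linkage_def is_path_def)
  then show "inj_on last P" "inj_on hd P" using assms
    unfolding inj_on_def linkage_def
    by (metis IntI empty_iff last_in_set, metis IntI empty_iff list.set_sel(1))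
qed

text \<open>
  Menger's theorem in the augmenting form of Boehme, Goering and Harant: the new paths keep the
  old end vertices on both sides. The path \<open>p0\<close> that is met last by a new path \<open>R\<close> is cut off
  at the meeting point \<open>x\<close>, and the two tails behind \<open>x\<close> are moved into the target set.
\<close>
lemma menger_augment:
  assumes "linkage E A B P"
    and "\<And>S. finite S \<Longrightarrow> card S \<le> card P \<Longrightarrow>
      \<exists>p. is_path E p \<and> hd p \<in> A \<and> last p \<in> B \<and> set p \<inter> S = {}"
  shows "\<exists>P'. linkage E A B P' \<and> card P' = Suc (card P) \<and> hd ` P \<subseteq> hd ` P' \<and> last ` P \<subseteq> last ` P'"
  using assms
proof (induction "\<Sum>p\<in>P. length p" arbitrary: B P rule: less_induct)
  case less
  note lk = less.prems(1) and sep = less.prems(2)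
  have finP: "finite P" using lk by (simp add: linkage_def)
  have ne: "p \<noteq> []" if "p \<in> P" for p using lk that by (auto simp: linkage_def is_path_def)
  \<comment> \<open>Avoiding the old ends guarantees that \<open>x\<close> below is not the last
    vertex of \<open>p0\<close>. Hence the tail \<open>Pb\<close> is nonempty and cutting
    \<open>p0\<close> at \<open>x\<close> lowers the total length, which is the induction
    measure.\<close>
  obtain R0 where R0: "is_path E R0" "hd R0 \<in> A" "last R0 \<in> B" "set R0 \<inter> last ` P = {}"
    using sep[of "last ` P"] finP card_image_le[OF finP] by blast
  have "last R0 \<in> set R0 \<inter> B" using R0 by (simp add: is_path_def)
  then have "set R0 \<inter> B \<noteq> {}" by blast
  from path_first_hit[OF R0(1) this] obtain R s where Rs: "R0 = R @ s" "is_path E R" "hd R = hd R0"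
    "last R \<in> B" "set (butlast R) \<inter> B = {}" by blast
  have R: "hd R \<in> A" "set R \<inter> last ` P = {}" using Rs R0 by auto
  show ?case
  proof (cases "set R \<inter> \<Union>(set ` P) = {}")
    case True
    have Rne: "R \<noteq> []" using Rs by (simp add: is_path_def)
    have "R \<notin> P" using True Rne by (metis Sup_upper disjoint_iff image_eqI list.set_sel(1) subsetD)
    moreover have "linkage E A B (insert R P)"
      using lk Rs R True unfolding linkage_def by blast
    ultimately show ?thesis using finP by (intro exI[of _ "insert R P"]) auto
  next
    case False
    then obtain R1 x R2 where x: "R = R1 @ x # R2" "x \<in> \<Union>(set ` P)" "\<forall>y\<in>set R2. y \<notin> \<Union>(set ` P)"
      using split_list_last_prop[of R "\<lambda>y. y \<in> \<Union>(set ` P)"] by blast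
    then obtain p0 where p0: "p0 \<in> P" "x \<in> set p0" by blast
    then obtain Pa Pb where Pab: "p0 = Pa @ x # Pb" by (meson split_list)
    have "x \<noteq> last p0" using R x p0 by auto
    then have Pb: "Pb \<noteq> []" using Pab by auto
    have p0p: "is_path E p0" "set (butlast p0) \<inter> B = {}" "last p0 \<in> B" "hd p0 \<in> A" using linkageD[OF lk p0(1)] by auto
    have dp0: "distinct p0" using p0p by (simp add: is_path_def)
    have xB: "x \<notin> B" "set Pa \<inter> B = {}" "set (butlast Pb) \<inter> B = {}" using p0p Pab Pb by (auto simp: butlast_append)
    have R2: "R2 \<noteq> []" using x Rs xB by auto
    have oth: "set q \<inter> set p0 = {}" if "q \<in> P" "q \<noteq> p0" for q using lk that p0 by (simp add: linkage_def)
    have R2P: "set R2 \<inter> set q = {}" if "q \<in> P" for q using x that by auto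
    define B' where "B' = B \<union> set (x # Pb) \<union> set (x # R2)"
    define c where "c = Pa @ [x]"
    define P1 where "P1 = insert c (P - {p0})"
    have cp: "is_path E c" using p0p Pab is_path_appendD[of E "Pa @ [x]" Pb] by (simp add: c_def)
    have hdc: "hd c = hd p0" by (cases Pa) (auto simp: c_def Pab)
    have lastc: "last c = x" by (simp add: c_def)
    have setc: "set c \<subseteq> set p0" by (auto simp: c_def Pab)
    have cnot: "c \<notin> P - {p0}"
    proof
      assume "c \<in> P - {p0}"
      then have "set c \<inter> set p0 = {}" using oth by auto
      then show False using setc by (auto simp: c_def)
    qed
    have card1: "card P1 = card P" using cnot finP card_Suc_Diff1[OF finP p0(1)] by (simp add: P1_def)
    have lk1: "linkage E A B' P1"
    proof -
      have "is_path E p \<and> hd p \<in> A \<and> last p \<in> B' \<and> set (butlast p) \<inter> B' = {}" if "p \<in> P1" for p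
      proof (cases "p = c")
        case True
        have "set Pa \<inter> set R2 = {}" using R2P[OF p0(1)] Pab by auto
        then show ?thesis using cp hdc p0p dp0 xB True lastc unfolding B'_def
          by (auto simp: c_def Pab)
      next
        case False
        then have pP: "p \<in> P" "p \<noteq> p0" using that by (auto simp: P1_def)
        have "set (butlast p) \<inter> set (x # Pb) = {}" "set (butlast p) \<inter> set (x # R2) = {}"
          using oth[OF pP] R2P[OF pP(1)] by (auto simp: Pab dest: in_set_butlastD)
        then show ?thesis using linkageD[OF lk pP(1)] unfolding B'_def by auto
      qed
      moreover have "set p \<inter> set q = {}" if "p \<in> P1" "q \<in> P1" "p \<noteq> q" for p q
        using that lk oth setc unfolding P1_def linkage_def by blast
      ultimately show ?thesis using finP unfolding linkage_def P1_def by blast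
    qed
    have "(\<Sum>p\<in>P1. length p) < (\<Sum>p\<in>P. length p)"
    proof -
      have "(\<Sum>p\<in>P1. length p) = length c + (\<Sum>p\<in>P - {p0}. length p)"
        using cnot finP by (simp add: P1_def)
      moreover have "(\<Sum>p\<in>P. length p) = length p0 + (\<Sum>p\<in>P - {p0}. length p)"
        using finP p0 by (simp add: sum.remove)
      moreover have "length c < length p0" using Pb by (simp add: c_def Pab)
      ultimately show ?thesis by simp
    qed
    from less.hyps[OF this lk1] sep card1 obtain P2 where
      P2: "linkage E A B' P2" "card P2 = Suc (card P)" "hd ` P1 \<subseteq> hd ` P2" "last ` P1 \<subseteq> last ` P2"
      unfolding B'_def by (metis (no_types, lifting) Un_iff)
    have hdP1: "hd ` P1 = hd ` P" using hdc p0 by (auto simp: P1_def)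
    have lastP1: "last ` P1 = insert x (last ` (P - {p0}))" by (simp add: P1_def lastc)
    have fin2: "finite P2" using P2 by (simp add: linkage_def)
    have inj2: "inj_on last P2" using linkage_last_inj[OF P2(1)] by simp
    have "card (last ` P2) = Suc (card P)" using inj2 P2 card_image by metis
    moreover have "card (last ` P1) = card P"
      using linkage_last_inj[OF lk1] card1 card_image by metis
    ultimately have "card (last ` P2 - last ` P1) = 1"
      using P2(4) card_Diff_subset[of "last ` P1" "last ` P2"] finP P1_def by simp
    \<comment> \<open>By counting, \<open>P2\<close> has exactly one end \<open>y\<close> besides
      the ends of \<open>P1\<close>, among which is \<open>x\<close>. All paths except
      \<open>Qx\<close> and \<open>Qy\<close> end in old ends in \<open>B\<close>, so only these two
      need repair.\<close>
    then obtain y where y: "last ` P2 - last ` P1 = {y}" by (meson card_1_singletonE)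
    have yin: "y \<in> last ` P2 - last ` P1" unfolding y by simp
    then obtain Qy where Qy: "Qy \<in> P2" "last Qy = y" by auto
    have "x \<in> last ` P2" using P2(4) lastP1 by blast
    then obtain Qx where Qx: "Qx \<in> P2" "last Qx = x" by blast
    have yx: "y \<noteq> x" "y \<notin> last ` P1" using yin lastP1 by auto
    have Qne: "Qx \<noteq> Qy" using Qx Qy yx by auto
    have y': "y \<in> B'" using linkageD[OF P2(1) Qy(1)] Qy by simp
    have rest: "last q \<in> last ` (P - {p0})" if "q \<in> P2 - {Qx, Qy}" for q
    proof -
      have "last q \<noteq> x" "last q \<noteq> y" using that inj2 Qx Qy by (auto simp: inj_on_def)
      moreover have "last q \<in> last ` P2" using that by auto
      moreover have "last q \<in> {y} \<or> last q \<in> last ` P1" using calculation(3) y by (metis DiffI)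
      ultimately show ?thesis using lastP1 by auto
    qed
    have restB: "last q \<in> B" "last q \<notin> set p0" "last q \<notin> set R2" if "q \<in> P2 - {Qx, Qy}" for q
    proof -
      from rest[OF that] obtain p where p: "p \<in> P" "p \<noteq> p0" "last q = last p" by blast
      show "last q \<in> B" using p linkageD[OF lk p(1)] by simp
      have "last p \<in> set p" using ne p by simp
      then show "last q \<notin> set p0" "last q \<notin> set R2" using oth[OF p(1,2)] R2P[OF p(1)] p by auto
    qed
    have P2ne: "q \<noteq> []" if "q \<in> P2" for q using linkageD[OF P2(1) that] by (simp add: is_path_def)
    have bl: "set (butlast q) \<inter> B = {}" "set (butlast q) \<inter> set (x # Pb) = {}" "set (butlast q) \<inter> set (x # R2) = {}"
      if "q \<in> P2" for q using linkageD[OF P2(1) that] unfolding B'_def by auto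
    have dj2: "set p \<inter> set q = {}" if "p \<in> P2" "q \<in> P2" "p \<noteq> q" for p q
      using P2(1) that by (simp add: linkage_def)
    have xnot: "x \<notin> set Pb" "x \<notin> set R2" using dp0 Pab Rs x by (auto simp: is_path_def)
    have R2last: "last R2 \<in> B" "set (butlast R2) \<inter> B = {}"
      using Rs(4,5) x(1) R2 by (auto simp: butlast_append)
    have Pblast: "last Pb \<in> B" "last Pb = last p0" using p0p Pab Pb by auto
    have R2path: "is_path E R2" "E x (hd R2)"
      using Rs(2) x(1) R2 is_path_appendD[of E "R1 @ [x]" R2]
      by (auto simp: is_path_def successively_append_iff successively_Cons)
    have Pbpath: "is_path E Pb" "E x (hd Pb)"
      using p0p(1) Pab Pb is_path_appendD[of E "Pa @ [x]" Pb]
      by (auto simp: is_path_def successively_append_iff successively_Cons)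
    have RP: "set R2 \<inter> set Pb = {}" using R2P[OF p0(1)] Pab by auto
    \<comment> \<open>The repair glues tails to \<open>Qx\<close> and \<open>Qy\<close>. If
      \<open>y\<close> lies on \<open>Pb\<close>, then \<open>Qy\<close> takes the rest of
      \<open>Pb\<close> and \<open>Qx\<close> takes \<open>R2\<close>; otherwise \<open>Qx\<close>
      takes \<open>Pb\<close> and \<open>Qy\<close> takes the rest of \<open>R2\<close>, or nothing
      if \<open>y\<close> is already in \<open>B\<close>. In each case the end of \<open>p0\<close>
      is an end again.\<close>
    have extend: "\<exists>P'. linkage E A B P' \<and> card P' = Suc (card P) \<and> hd ` P \<subseteq> hd ` P' \<and> last ` P \<subseteq> last ` P'"
      if tx: "is_path E tx" "E x (hd tx)" "set tx \<subseteq> set Pb \<union> set R2" "last tx \<in> B"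
           "set (butlast tx) \<inter> B = {}"
        and ty: "ty \<noteq> [] \<Longrightarrow> is_path E ty" "ty \<noteq> [] \<Longrightarrow> E y (hd ty)" "set ty \<subseteq> set Pb \<union> set R2"
          "last (Qy @ ty) \<in> B" "set (butlast (Qy @ ty)) \<inter> B = {}"
        and d: "y \<notin> set ty" "y \<notin> set tx" "set tx \<inter> set ty = {}"
        and l: "last p0 \<in> {last tx, last (Qy @ ty)}" for tx ty
    proof -
      define P3 where "P3 = insert (Qx @ tx) (insert (Qy @ ty) (P2 - {Qx, Qy}))"
      have txne: "tx \<noteq> []" using tx by (simp add: is_path_def)
      have sx: "set Qx = insert x (set (butlast Qx))" "set Qy = insert y (set (butlast Qy))"
        using set_last_butlast P2ne Qx Qy by metis+
      have dx: "set Qx \<inter> (set Pb \<union> set R2) = {}" using bl[OF Qx(1)] xnot sx by auto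
      have dyb: "set (butlast Qy) \<inter> (set Pb \<union> set R2) = {}" using bl[OF Qy(1)] by auto
      have dq: "set q \<inter> (set Pb \<union> set R2) = {}" if "q \<in> P2 - {Qx, Qy}" for q
        using bl[of q] restB[OF that] that set_last_butlast[OF P2ne[of q]] Pab by auto
      have d1: "set (Qx @ tx) \<inter> set (Qy @ ty) = {}"
        using dj2[OF Qx(1) Qy(1) Qne] dx dyb tx(3) ty(3) d sx by auto
      have d2: "set (Qx @ tx) \<inter> set q = {}" "set (Qy @ ty) \<inter> set q = {}" if "q \<in> P2 - {Qx, Qy}" for q
        using dj2[OF Qx(1), of q] dj2[OF Qy(1), of q] dq[OF that] that tx(3) ty(3) by auto
      have p1: "is_path E (Qx @ tx)"
      proof (rule is_path_append)
        show "set Qx \<inter> set tx = {}" using dx tx(3) by auto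
      qed (use linkageD(1)[OF P2(1) Qx(1)] tx Qx in auto)
      have p2: "is_path E (Qy @ ty)"
      proof (rule is_path_append)
        show "set Qy \<inter> set ty = {}" using sx dyb ty(3) d by auto
      qed (use linkageD(1)[OF P2(1) Qy(1)] ty Qy in auto)
      have b1: "set (butlast (Qx @ tx)) \<inter> B = {}" "last (Qx @ tx) \<in> B"
        using txne tx bl[OF Qx(1)] sx xB by (auto simp: butlast_append)
      have lk3: "linkage E A B P3"
      proof -
        have "is_path E p \<and> hd p \<in> A \<and> last p \<in> B \<and> set (butlast p) \<inter> B = {}" if "p \<in> P3" for p
        proof -
          consider "p = Qx @ tx" | "p = Qy @ ty" | "p \<in> P2 - {Qx, Qy}" using \<open>p \<in> P3\<close> P3_def by auto
          then show ?thesis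
          proof cases
            case 1 then show ?thesis using p1 b1 linkageD[OF P2(1) Qx(1)] P2ne[OF Qx(1)] by simp
          next
            case 2 then show ?thesis using p2 ty linkageD[OF P2(1) Qy(1)] P2ne[OF Qy(1)] by simp
          next
            case 3 then show ?thesis using linkageD[OF P2(1), of p] bl(1)[of p] restB[OF 3] by simp
          qed
        qed
        moreover have "set p \<inter> set q = {}" if pq: "p \<in> P3" "q \<in> P3" "p \<noteq> q" for p q
        proof -
          have p: "p = Qx @ tx \<or> p = Qy @ ty \<or> p \<in> P2 - {Qx, Qy}" using pq(1) by (simp add: P3_def)
          have q: "q = Qx @ tx \<or> q = Qy @ ty \<or> q \<in> P2 - {Qx, Qy}" using pq(2) by (simp add: P3_def)
          show ?thesis
          proof (cases "p \<in> P2 - {Qx, Qy} \<and> q \<in> P2 - {Qx, Qy}")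
            case True then show ?thesis using dj2[of p q] pq(3) by simp
          next
            case False
            have "set q \<inter> set (Qx @ tx) = {}" "set q \<inter> set (Qy @ ty) = {}" if "q \<in> P2 - {Qx, Qy}" for q
              using d2[OF that] by blast+
            then show ?thesis using p q False d1 d2 pq(3) by (metis Int_commute)
          qed
        qed
        moreover have "finite P3" using fin2 by (simp add: P3_def)
        ultimately show ?thesis unfolding linkage_def by simp
      qed
      have hd3: "hd ` P3 = hd ` P2"
      proof -
        have "P2 = insert Qx (insert Qy (P2 - {Qx, Qy}))" using Qx Qy by auto
        then have "hd ` P2 = insert (hd Qx) (insert (hd Qy) (hd ` (P2 - {Qx, Qy})))" by (metis image_insert)
        then show ?thesis using P2ne[OF Qx(1)] P2ne[OF Qy(1)] by (simp add: P3_def)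
      qed
      have "card (hd ` P2) = Suc (card P)" using linkage_last_inj(2)[OF P2(1)] P2(2) card_image by metis
      then have card3: "card P3 = Suc (card P)"
        using linkage_last_inj(2)[OF lk3] hd3 card_image by metis
      have "last ` P \<subseteq> last ` P3"
      proof
        fix z assume "z \<in> last ` P"
        then consider "z = last p0" | "z \<in> last ` (P - {p0})" by blast
        then show "z \<in> last ` P3"
        proof cases
          case 1
          have "last (Qx @ tx) = last tx" using txne by simp
          then have "last p0 = last (Qx @ tx) \<or> last p0 = last (Qy @ ty)" using l by auto
          moreover have "Qx @ tx \<in> P3" "Qy @ ty \<in> P3" by (simp_all add: P3_def)
          ultimately show ?thesis using 1 by (metis imageI)
        next
          case 2
          then have z1: "z \<in> last ` P1" using lastP1 by auto
          then have "z \<in> last ` P2" using P2(4) by auto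
          then obtain q where q: "q \<in> P2" "last q = z" by auto
          have "z \<noteq> y" using z1 yx by auto
          moreover have "z \<noteq> x"
          proof -
            from 2 obtain p where "p \<in> P" "p \<noteq> p0" "z = last p" by blast
            then show ?thesis using oth[of p] ne[of p] p0 by (metis disjoint_iff last_in_set)
          qed
          ultimately have "q \<in> P3" using q Qx Qy by (auto simp: P3_def)
          then show ?thesis using q by auto
        qed
      qed
      moreover have "hd ` P \<subseteq> hd ` P3" using P2(3) unfolding hd3 hdP1 .
      ultimately show ?thesis using lk3 card3 by (intro exI[of _ P3]) simp
    qed
    show ?thesis
    proof (cases "y \<in> set Pb")
      case True
      then obtain Pb1 Pb2 where Pb12: "Pb = Pb1 @ y # Pb2" by (meson split_list)
      have dPb: "distinct Pb" using dp0 Pab by simp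
      have sy: "set Qy = insert y (set (butlast Qy))" using set_last_butlast P2ne Qy by metis
      show ?thesis
      proof (rule extend[of R2 Pb2])
        show "is_path E Pb2" if "Pb2 \<noteq> []"
          using Pbpath(1) that is_path_appendD(2)[of E "Pb1 @ [y]" Pb2] by (simp add: Pb12)
        show "E y (hd Pb2)" if "Pb2 \<noteq> []"
          using Pbpath(1) that by (auto simp: Pb12 is_path_def successively_append_iff successively_Cons)
        show "last (Qy @ Pb2) \<in> B" using Pblast Pb12 Qy P2ne by (cases "Pb2 = []") auto
        show "set (butlast (Qy @ Pb2)) \<inter> B = {}"
          using xB(3) bl(1)[OF Qy(1)] sy Pb12 by (cases "Pb2 = []") (auto simp: butlast_append)
        show "last p0 \<in> {last R2, last (Qy @ Pb2)}" using Pblast Pb12 Qy P2ne by (cases "Pb2 = []") auto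
        show "y \<notin> set R2" using RP True by auto
      qed (use R2path R2last RP Pb12 dPb in auto)
    next
      case False
      show ?thesis
      proof (cases "y \<in> set R2")
        case True
        then obtain Ra Rb where Rab: "R2 = Ra @ y # Rb" by (meson split_list)
        have dR: "distinct R2" using R2path by (simp add: is_path_def)
        have sy: "set Qy = insert y (set (butlast Qy))" using set_last_butlast P2ne Qy by metis
        show ?thesis
        proof (rule extend[of Pb Rb])
          show "is_path E Rb" if "Rb \<noteq> []"
            using R2path(1) that is_path_appendD(2)[of E "Ra @ [y]" Rb] by (simp add: Rab)
          show "E y (hd Rb)" if "Rb \<noteq> []"
            using R2path(1) that by (auto simp: Rab is_path_def successively_append_iff successively_Cons)
          show "last (Qy @ Rb) \<in> B" using R2last Rab Qy P2ne by (cases "Rb = []") auto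
          show "set (butlast (Qy @ Rb)) \<inter> B = {}"
            using R2last(2) bl(1)[OF Qy(1)] sy Rab by (cases "Rb = []") (auto simp: butlast_append)
        qed (use Pbpath Pblast RP Rab dR False xB in auto)
      next
        case y2: False
        then have "y \<in> B" using y' False yx by (auto simp: B'_def)
        then show ?thesis
          using bl(1)[OF Qy(1)] Qy Pbpath Pblast xB False by (intro extend[of Pb "[]"]) auto
      qed
    qed
  qed
qed

lemma menger_extend:
  assumes "linkage E A B P" "card P \<le> n"
    and "\<And>S. finite S \<Longrightarrow> card S < n \<Longrightarrow> \<exists>p. is_path E p \<and> hd p \<in> A \<and> last p \<in> B \<and> set p \<inter> S = {}"
  shows "\<exists>P'. linkage E A B P' \<and> card P' = n \<and> hd ` P \<subseteq> hd ` P' \<and> last ` P \<subseteq> last ` P'"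
  using assms
proof (induction "n - card P" arbitrary: P)
  case 0
  then show ?case by (intro exI[of _ P]) auto
next
  case (Suc k)
  have "\<exists>P'. linkage E A B P' \<and> card P' = Suc (card P) \<and> hd ` P \<subseteq> hd ` P' \<and> last ` P \<subseteq> last ` P'"
    using Suc by (intro menger_augment) auto
  then obtain P1 where P1: "linkage E A B P1" "card P1 = Suc (card P)" "hd ` P \<subseteq> hd ` P1" "last ` P \<subseteq> last ` P1"
    by blast
  have "k = n - card P1" "card P1 \<le> n" using Suc P1 by auto
  from Suc(1)[OF this(1) P1(1) this(2) Suc.prems(3)] obtain P2 where
    P2: "linkage E A B P2" "card P2 = n" "hd ` P1 \<subseteq> hd ` P2" "last ` P1 \<subseteq> last ` P2" by blast
  show ?case using P2(1,2) subset_trans[OF P1(3) P2(3)] subset_trans[OF P1(4) P2(4)] by (intro exI[of _ P2]) simp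
qed

text \<open>Disjoint paths have distinct ends, so a linkage can be indexed by its ends; keeping the
  old ends then becomes the inclusion of \<open>T\<close> in \<open>T'\<close>.\<close>

lemma menger_fan:
  assumes ends: "finite T" "card T \<le> n"
    and init: "\<And>b. b \<in> T \<Longrightarrow> is_path E (g b) \<and> hd (g b) \<in> A \<and> last (g b) = b \<and> b \<in> B \<and> set (butlast (g b)) \<inter> B = {}"
    and dj: "\<And>b b'. b \<in> T \<Longrightarrow> b' \<in> T \<Longrightarrow> b \<noteq> b' \<Longrightarrow> set (g b) \<inter> set (g b') = {}"
    and sep: "\<And>S. finite S \<Longrightarrow> card S < n \<Longrightarrow> \<exists>p. is_path E p \<and> hd p \<in> A \<and> last p \<in> B \<and> set p \<inter> S = {}"
  obtains T' h where "T \<subseteq> T'" "T' \<subseteq> B" "card T' = n"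
    "\<And>b. b \<in> T' \<Longrightarrow> is_path E (h b) \<and> hd (h b) \<in> A \<and> last (h b) = b \<and> set (butlast (h b)) \<inter> B = {}"
    "\<And>b b'. b \<in> T' \<Longrightarrow> b' \<in> T' \<Longrightarrow> b \<noteq> b' \<Longrightarrow> set (h b) \<inter> set (h b') = {}"
    "(\<lambda>b. hd (g b)) ` T \<subseteq> (\<lambda>b. hd (h b)) ` T'"
proof -
  have inj: "inj_on g T" using init by (metis inj_onI)
  have "linkage E A B (g ` T)"
    unfolding linkage_def using ends init dj by (auto 0 0) (metis IntI empty_iff)
  moreover have "card (g ` T) \<le> n" using inj ends by (simp add: card_image)
  ultimately obtain P where P: "linkage E A B P" "card P = n" "hd ` g ` T \<subseteq> hd ` P" "last ` g ` T \<subseteq> last ` P"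
    using menger_extend[OF _ _ sep] by blast
  define h where "h = inv_into P last"
  have inj: "inj_on last P" using linkage_last_inj[OF P(1)] by simp
  have hP: "h b \<in> P" "last (h b) = b" if "b \<in> last ` P" for b
    using that by (auto simp: h_def inv_into_into f_inv_into_f)
  have hb: "h (last p) = p" if "p \<in> P" for p using that inj by (simp add: h_def)
  show ?thesis
  proof (rule that[of "last ` P" h])
    have "last ` g ` T = T" using init by force
    then show "T \<subseteq> last ` P" using P(4) by simp
    show "last ` P \<subseteq> B" using P(1) by (auto simp: linkage_def)
    show "card (last ` P) = n" using inj P(2) by (simp add: card_image)
    show "is_path E (h b) \<and> hd (h b) \<in> A \<and> last (h b) = b \<and> set (butlast (h b)) \<inter> B = {}" if "b \<in> last ` P" for b
      using hP[OF that] linkageD[OF P(1)] by auto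
    show "set (h b) \<inter> set (h b') = {}" if "b \<in> last ` P" "b' \<in> last ` P" "b \<noteq> b'" for b b'
      using hP[OF that(1)] hP[OF that(2)] that linkageD(5)[OF P(1)] by metis
    show "(\<lambda>b. hd (g b)) ` T \<subseteq> (\<lambda>b. hd (h b)) ` last ` P"
      using P(3) hb by (auto simp: image_image)
  qed
qed

section \<open>Paths with inner vertices in a given set\<close>

locale sgraph =
  fixes adj :: "'a \<Rightarrow> 'a \<Rightarrow> bool"
  assumes adj_sym: "adj x y \<Longrightarrow> adj y x"
begin

text \<open>Reachability in the subgraph induced by \<open>Z\<close>. The conjunct on
  \<open>a\<close> is needed because the reflexive closure relates every vertex to itself, also
  outside \<open>Z\<close>.\<close>

definition conn :: "'a set \<Rightarrow> 'a \<Rightarrow> 'a \<Rightarrow> bool" where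
  "conn Z a b \<longleftrightarrow> a \<in> Z \<and> (\<lambda>x y. adj x y \<and> x \<in> Z \<and> y \<in> Z)\<^sup>*\<^sup>* a b"

text \<open>\<open>Z\<close> merely bounds the inner vertices and may contain the ends. This makes
  links monotone in \<open>Z\<close> and lets them be glued by uniting sets, without any care for
  repeated vertices.\<close>

definition link :: "'a \<Rightarrow> 'a set \<Rightarrow> 'a \<Rightarrow> bool" where
  "link a Z b \<longleftrightarrow> conn (insert a (insert b Z)) a b"

text \<open>
  In contrast to \<open>link\<close>, the set is exactly the set of inner vertices of a path, so that it can be
  split at each of its elements.
\<close>
definition seg :: "'a \<Rightarrow> 'a set \<Rightarrow> 'a \<Rightarrow> bool" where
  "seg a Z b \<longleftrightarrow> (\<exists>p. is_path adj p \<and> hd p = a \<and> last p = b \<and> a \<noteq> b \<and> Z = set p - {a, b})"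

lemma conn_mem: "conn Z a b \<Longrightarrow> a \<in> Z \<and> b \<in> Z"
proof -
  assume c: "conn Z a b"
  then have "(\<lambda>x y. adj x y \<and> x \<in> Z \<and> y \<in> Z)\<^sup>*\<^sup>* a b" "a \<in> Z" by (auto simp: conn_def)
  then show ?thesis by (induction rule: rtranclp_induct) auto
qed

lemma conn_refl: "a \<in> Z \<Longrightarrow> conn Z a a" by (simp add: conn_def)

lemma conn_step: "adj a b \<Longrightarrow> a \<in> Z \<Longrightarrow> b \<in> Z \<Longrightarrow> conn Z a b"
  by (auto simp: conn_def)

lemma conn_trans: "conn Z a b \<Longrightarrow> conn Z b c \<Longrightarrow> conn Z a c"
  by (auto simp: conn_def)

lemma conn_sym: assumes "conn Z a b" shows "conn Z b a"
proof -
  have b: "b \<in> Z" using assms conn_mem by blast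
  have "symp (\<lambda>x y. adj x y \<and> x \<in> Z \<and> y \<in> Z)" by (auto intro: sympI adj_sym)
  then have "symp (\<lambda>x y. adj x y \<and> x \<in> Z \<and> y \<in> Z)\<^sup>*\<^sup>*" by (rule symp_rtranclp)
  then show ?thesis using assms b unfolding conn_def by (auto dest: sympD)
qed

lemma conn_mono: assumes "conn Z a b" "Z \<subseteq> Z'" shows "conn Z' a b"
proof -
  have "(\<lambda>x y. adj x y \<and> x \<in> Z' \<and> y \<in> Z')\<^sup>*\<^sup>* a b"
    using assms rtranclp_mono[of "\<lambda>x y. adj x y \<and> x \<in> Z \<and> y \<in> Z" "\<lambda>x y. adj x y \<and> x \<in> Z' \<and> y \<in> Z'"]
    unfolding conn_def by blast
  then show ?thesis using assms by (auto simp: conn_def)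
qed

lemma is_path_rev: "is_path adj p \<Longrightarrow> is_path adj (rev p)"
proof -
  have "successively adj p \<Longrightarrow> successively (\<lambda>x y. adj y x) p"
    by (induction p rule: induct_list012) (auto intro: adj_sym)
  then show "is_path adj p \<Longrightarrow> is_path adj (rev p)" by (auto simp: is_path_def)
qed

lemma is_path_conn: "is_path adj p \<Longrightarrow> set p \<subseteq> Z \<Longrightarrow> conn Z (hd p) (last p)"
proof (induction p)
  case (Cons x p)
  show ?case
  proof (cases p)
    case Nil then show ?thesis using Cons by (simp add: conn_refl)
  next
    case (Cons y q)
    then have "adj x y" "is_path adj p" using Cons.prems by (auto simp: is_path_def)
    then have "conn Z (hd p) (last p)" using Cons.IH Cons.prems(2) by simp
    moreover have "conn Z x y" using \<open>adj x y\<close> Cons.prems(2) Cons by (intro conn_step) auto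
    ultimately have "conn Z x (last p)" using Cons conn_trans[of Z x y "last p"] by simp
    then show ?thesis using Cons by simp
  qed
qed (simp add: is_path_def)

lemma conn_path:
  assumes "conn Z a b"
  obtains p where "is_path adj p" "hd p = a" "last p = b" "set p \<subseteq> Z"
proof -
  from assms have "(\<lambda>x y. adj x y \<and> x \<in> Z \<and> y \<in> Z)\<^sup>*\<^sup>* a b" "a \<in> Z" by (auto simp: conn_def)
  then have "\<exists>p. is_path adj p \<and> hd p = a \<and> last p = b \<and> set p \<subseteq> Z"
  proof (induction rule: rtranclp_induct)
    case base
    then show ?case by (intro exI[of _ "[a]"]) (simp add: is_path_def)
  next
    case (step y z)
    then obtain p where p: "is_path adj p" "hd p = a" "last p = y" "set p \<subseteq> Z" by blast
    show ?case
    proof (cases "z \<in> set p")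
      case True
      then obtain q r where "p = q @ z # r" by (meson split_list)
      then show ?thesis using p is_path_appendD(1)[of adj "q @ [z]" r]
        by (intro exI[of _ "q @ [z]"]) (cases q; auto)
    next
      case False
      have "is_path adj [z]" by (simp add: is_path_def)
      then show ?thesis using p step False is_path_append[OF p(1), of "[z]"]
        by (intro exI[of _ "p @ [z]"]) (auto simp: is_path_def)
    qed
  qed
  then show ?thesis using that by blast
qed

lemma link_sym: "link a Z b \<Longrightarrow> link b Z a"
  unfolding link_def by (metis conn_sym insert_commute)

lemma link_mono: "link a Z b \<Longrightarrow> Z \<subseteq> Z' \<Longrightarrow> link a Z' b"
  unfolding link_def by (erule conn_mono) auto

lemma link_refl: "link a Z a" by (simp add: link_def conn_refl)

lemma link_adj: "adj a b \<Longrightarrow> link a Z b" by (simp add: link_def conn_step)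

lemma link_comp: "link a Z b \<Longrightarrow> link b Z' c \<Longrightarrow> link a (Z \<union> {b} \<union> Z') c"
  unfolding link_def by (rule conn_trans[of _ a b]; erule conn_mono; auto)

text \<open>Counterpart of \<open>link_comp\<close> for a joint that already belongs to one of the
  two sets. Adding it once more as a singleton would spoil the bookkeeping of disjoint sets.\<close>

lemma link_via: "link a Z b \<Longrightarrow> link b Z' c \<Longrightarrow> b \<in> Z \<union> Z' \<Longrightarrow> link a (Z \<union> Z') c"
  unfolding link_def by (rule conn_trans[of _ a b]; erule conn_mono; auto)

lemma conn_link: "conn Z a b \<Longrightarrow> link a Z b"
  unfolding link_def by (erule conn_mono) auto

lemma link_conn: "link a Z b \<Longrightarrow> insert a (insert b Z) \<subseteq> Z' \<Longrightarrow> conn Z' a b"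
  unfolding link_def by (erule conn_mono)

lemma seg_link: "seg a Z b \<Longrightarrow> link a Z b"
  unfolding seg_def link_def
proof (elim exE conjE)
  fix p assume p: "is_path adj p" "hd p = a" "last p = b" "Z = set p - {a, b}"
  have "conn (insert a (insert b Z)) (hd p) (last p)" using p by (intro is_path_conn) auto
  then show "conn (insert a (insert b Z)) a b" using p by simp
qed

lemma seg_sym: "seg a Z b \<Longrightarrow> seg b Z a"
  unfolding seg_def
proof (elim exE conjE)
  fix p assume p: "is_path adj p" "hd p = a" "last p = b" "a \<noteq> b" "Z = set p - {a, b}"
  then have "p \<noteq> []" by (simp add: is_path_def)
  then show "\<exists>p. is_path adj p \<and> hd p = b \<and> last p = a \<and> b \<noteq> a \<and> Z = set p - {b, a}"
    using p by (intro exI[of _ "rev p"]) (auto simp: is_path_rev hd_rev last_rev)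
qed

lemma seg_ends: "seg a Z b \<Longrightarrow> a \<notin> Z \<and> b \<notin> Z \<and> a \<noteq> b"
  by (auto simp: seg_def)

lemma link_seg:
  assumes "link a Z b" "a \<noteq> b"
  obtains Z' where "seg a Z' b" "Z' \<subseteq> Z"
proof -
  from assms(1) obtain p where p: "is_path adj p" "hd p = a" "last p = b" "set p \<subseteq> insert a (insert b Z)"
    unfolding link_def using conn_path by metis
  then have "seg a (set p - {a, b}) b" using assms(2) unfolding seg_def by (intro exI[of _ p]) simp
  then show ?thesis using that p by auto
qed

lemma seg_split_list:
  assumes p: "is_path adj (p1 @ e # p2)" "hd (p1 @ e # p2) = a" "last (p1 @ e # p2) = b" "p1 \<noteq> []" "p2 \<noteq> []"
  shows "seg a (set p1 - {a}) e" "seg e (set p2 - {b}) b"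
    "set (p1 @ e # p2) - {a, b} = (set p1 - {a}) \<union> {e} \<union> (set p2 - {b})"
    "(set p1 - {a}) \<inter> (set p2 - {b}) = {}" "e \<notin> set p1" "e \<notin> set p2"
proof -
  have d: "distinct (p1 @ e # p2)" using p by (simp add: is_path_def)
  have a: "a \<in> set p1" "hd p1 = a" and b: "b \<in> set p2" "last p2 = b" using p by auto
  have "is_path adj (p1 @ [e])" "is_path adj (e # p2)"
    using p(1) is_path_appendD(1)[of adj "p1 @ [e]" p2] is_path_appendD(2)[of adj p1 "e # p2"] by auto
  note pp = this
  show "seg a (set p1 - {a}) e" unfolding seg_def using pp(1) d a p(4)
    by (intro exI[of _ "p1 @ [e]"]) auto
  show "seg e (set p2 - {b}) b" unfolding seg_def using pp(2) d b p(5)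
    by (intro exI[of _ "e # p2"]) auto
  show "set (p1 @ e # p2) - {a, b} = (set p1 - {a}) \<union> {e} \<union> (set p2 - {b})" using d a b by auto
qed (use p in \<open>auto simp: is_path_def\<close>)

lemma seg_first:
  assumes "seg a Z b" "Z \<inter> S \<noteq> {}"
  obtains e Z1 Z2 where "e \<in> S" "seg a Z1 e" "seg e Z2 b" "Z = Z1 \<union> {e} \<union> Z2" "Z1 \<inter> Z2 = {}"
    "e \<notin> Z1" "e \<notin> Z2" "Z1 \<inter> S = {}"
proof -
  from assms(1) obtain p where p: "is_path adj p" "hd p = a" "last p = b" "a \<noteq> b" "Z = set p - {a, b}"
    by (auto simp: seg_def)
  obtain p1 e p2 where e: "p = p1 @ e # p2" "e \<in> Z \<inter> S" "\<forall>y\<in>set p1. y \<notin> Z \<inter> S"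
    using split_list_first_prop[of p "\<lambda>x. x \<in> Z \<inter> S"] assms(2) p(5) by blast
  have ne: "p1 \<noteq> []" "p2 \<noteq> []" using p e by auto
  note s = seg_split_list[OF p(1-3)[unfolded e(1)] ne]
  have "(set p1 - {a}) \<inter> S = {}" using e s(3) p(5) by auto
  then show ?thesis using that[of e "set p1 - {a}" "set p2 - {b}"] s e p by auto
qed

lemma seg_split:
  assumes "seg a Z b" "e \<in> Z"
  obtains Z1 Z2 where "seg a Z1 e" "seg e Z2 b" "Z = Z1 \<union> {e} \<union> Z2" "Z1 \<inter> Z2 = {}" "e \<notin> Z1" "e \<notin> Z2"
proof -
  have "Z \<inter> {e} \<noteq> {}" using assms(2) by blast
  then show ?thesis using seg_first[OF assms(1), of "{e}"] that by blast
qed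

lemma seg_elem:
  assumes "seg a Z b" "e \<in> Z" shows "link a Z e" "link e Z b" "link e Z a" "link b Z e"
proof -
  obtain Z1 Z2 where s: "seg a Z1 e" "seg e Z2 b" "Z = Z1 \<union> {e} \<union> Z2" using seg_split[OF assms] by metis
  show "link a Z e" "link e Z b" using seg_link[OF s(1)] seg_link[OF s(2)] s(3) by (auto elim!: link_mono)
  then show "link e Z a" "link b Z e" by (auto intro: link_sym)
qed

text \<open>Cutting a path at a vertex of \<open>K\<close> before its end, or at a vertex of
  \<open>H\<close> after its start, gives a shorter path of the same kind; a shortest one meets
  \<open>H\<close> and \<open>K\<close> only in its ends.\<close>

lemma path_bridge:
  assumes "is_path adj p" "hd p \<in> H" "last p \<in> K" "H \<inter> K = {}"
  shows "\<exists>q. is_path adj q \<and> hd q \<in> H \<and> last q \<in> K \<and> set q \<subseteq> set p \<and> set q \<inter> H \<subseteq> {hd q} \<and> set q \<inter> K \<subseteq> {last q}"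
  using assms
proof (induction "length p" arbitrary: p rule: less_induct)
  case less
  have ne: "p \<noteq> []" using less.prems by (simp add: is_path_def)
  consider (K) y where "y \<in> set p" "y \<in> K" "y \<noteq> last p" | (H) y where "y \<in> set p" "y \<in> H" "y \<noteq> hd p"
    | (no) "set p \<inter> H \<subseteq> {hd p}" "set p \<inter> K \<subseteq> {last p}"
    by auto
  then show ?case
  proof cases
    case K
    then obtain q r where q: "p = q @ y # r" by (meson split_list)
    have "r \<noteq> []" using K q by auto
    then have "\<exists>s. is_path adj s \<and> hd s \<in> H \<and> last s \<in> K \<and> set s \<subseteq> set (q @ [y]) \<and> set s \<inter> H \<subseteq> {hd s} \<and> set s \<inter> K \<subseteq> {last s}"
      using less.prems K q is_path_appendD(1)[of adj "q @ [y]" r]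
      by (intro less.hyps) (cases q; auto)+
    then show ?thesis using q by auto
  next
    case H
    then obtain q r where q: "p = q @ y # r" by (meson split_list)
    have "q \<noteq> []" using H q by auto
    then have "\<exists>s. is_path adj s \<and> hd s \<in> H \<and> last s \<in> K \<and> set s \<subseteq> set (y # r) \<and> set s \<inter> H \<subseteq> {hd s} \<and> set s \<inter> K \<subseteq> {last s}"
      using less.prems H q is_path_appendD(2)[of adj q "y # r"] by (intro less.hyps) auto
    then show ?thesis using q by auto
  next
    case no then show ?thesis using less.prems by (intro exI[of _ p]) simp
  qed
qed

lemma bridge:
  assumes "conn Z a b" "a \<in> H" "b \<in> K" "H \<inter> K = {}"
  shows "\<exists>x T y. x \<in> H \<and> x \<in> Z \<and> y \<in> K \<and> y \<in> Z \<and> seg x T y \<and> T \<subseteq> Z \<and> T \<inter> (H \<union> K) = {}"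
proof -
  obtain p where p: "is_path adj p" "hd p = a" "last p = b" "set p \<subseteq> Z" using conn_path[OF assms(1)] by metis
  obtain q where q: "is_path adj q" "hd q \<in> H" "last q \<in> K" "set q \<subseteq> set p" "set q \<inter> H \<subseteq> {hd q}" "set q \<inter> K \<subseteq> {last q}"
    using path_bridge[of p H K] p assms by auto
  have ne: "q \<noteq> []" using q by (simp add: is_path_def)
  have "seg (hd q) (set q - {hd q, last q}) (last q)" using q assms(4) unfolding seg_def
    by (intro exI[of _ q]) auto
  moreover have "hd q \<in> Z" "last q \<in> Z" using q(4) p(4) ne hd_in_set last_in_set by blast+
  moreover have "set q - {hd q, last q} \<subseteq> Z" using q(4) p(4) by auto
  moreover have "(set q - {hd q, last q}) \<inter> (H \<union> K) = {}" using q(5,6) by auto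
  ultimately show ?thesis using q(2,3) by (intro exI conjI)
qed

text \<open>Paths of a fan share their centre \<open>s\<close>, whereas Menger's theorem asks for
  disjoint paths. So \<open>s\<close> is stripped off here and put back by \<open>path_link\<close>
  and \<open>path_seg\<close>.\<close>

lemma link_tl:
  assumes "link s Z b" "s \<noteq> b"
  obtains p where "is_path adj p" "adj s (hd p)" "last p = b" "set p \<subseteq> insert b (Z - {s})"
    "set (butlast p) \<subseteq> Z - {s, b}"
proof -
  from assms(1) obtain q where q: "is_path adj q" "hd q = s" "last q = b" "set q \<subseteq> insert s (insert b Z)"
    unfolding link_def using conn_path by metis
  obtain p where p: "q = s # p" using q by (cases q) (auto simp: is_path_def)
  have ne: "p \<noteq> []" using p q assms by auto
  have path: "is_path adj p" "adj s (hd p)" "s \<notin> set p"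
    using q(1) ne by (auto simp: p is_path_def successively_Cons)
  have "distinct p" using path by (simp add: is_path_def)
  then have "last p \<notin> set (butlast p)" using ne
    by (metis append_butlast_last_id distinct_butlast not_distinct_conv_prefix snoc_eq_iff_butlast)
  then show ?thesis using that[of p] path p q ne by (auto dest: in_set_butlastD)
qed

lemma path_link:
  assumes "is_path adj p" "adj s (hd p)"
  shows "link s (set (butlast p)) (last p)"
proof -
  have ne: "p \<noteq> []" using assms by (simp add: is_path_def)
  have "conn (set p) (hd p) (last p)" using assms is_path_conn by blast
  moreover have "set p = insert (last p) (set (butlast p))" using ne by (rule set_last_butlast)
  ultimately have c: "conn (insert (last p) (set (butlast p))) (hd p) (last p)" by simp
  have "conn (insert s (insert (last p) (set (butlast p)))) s (hd p)"
    using assms conn_mem[OF c] by (intro conn_step) auto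
  then show ?thesis unfolding link_def by (rule conn_trans) (rule conn_mono[OF c], auto)
qed

lemma path_seg:
  assumes "is_path adj p" "adj s (hd p)" "s \<notin> set p"
  shows "seg s (set (butlast p)) (last p)"
proof -
  have ne: "p \<noteq> []" using assms by (simp add: is_path_def)
  have "is_path adj (s # p)" using assms by (auto simp: is_path_def successively_Cons)
  moreover have "distinct p" using assms by (simp add: is_path_def)
  then have "last p \<notin> set (butlast p)" using ne
    by (metis append_butlast_last_id distinct_butlast not_distinct_conv_prefix snoc_eq_iff_butlast)
  then have "set (butlast p) = set (s # p) - {s, last p}"
    using assms(3) set_last_butlast[OF ne] by auto
  moreover have "s \<noteq> last p" using ne assms(3) by auto
  ultimately show ?thesis unfolding seg_def using ne by (intro exI[of _ "s # p"]) simp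
qed

text \<open>Mostly applied to bridges: the vertex before the end shows whether the end can lie in
  \<open>U\<close>, whose neighbours are known.\<close>

lemma seg_last_adj:
  assumes "seg a T b" shows "\<exists>x\<in>insert a T. adj x b"
proof -
  obtain p where p: "is_path adj p" "hd p = a" "last p = b" "a \<noteq> b" "T = set p - {a, b}"
    using assms by (auto simp: seg_def)
  obtain q where q: "p = q @ [b]" using p by (metis append_butlast_last_id is_path_def)
  have ne: "q \<noteq> []" using p q by auto
  have "adj (last q) b" "b \<notin> set q" using p(1) ne by (auto simp: q is_path_def successively_append_iff)
  then show ?thesis using p q ne by (intro bexI[of _ "last q"]) auto
qed

text \<open>The assumption on the first vertex matters for paths with a single vertex, which use no
  edge and hence are not confined by the restricted relation.\<close>

lemma restricted_path:
  assumes "hd p \<in> X"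
  shows "is_path (\<lambda>x y. adj x y \<and> x \<in> X \<and> y \<in> X) p \<longleftrightarrow> is_path adj p \<and> set p \<subseteq> X"
  using assms
proof (induction p)
  case (Cons x p)
  then show ?case by (cases p) (auto simp: is_path_def)
qed (simp add: is_path_def)

text \<open>Menger's theorem for the edge relation restricted to \<open>X\<close>: new paths then
  stay off everything that was left out of \<open>X\<close>.\<close>

lemma fan:
  assumes T: "finite T" "card T \<le> n" and A: "A \<subseteq> X"
    and init: "\<And>b. b \<in> T \<Longrightarrow> is_path adj (g b) \<and> set (g b) \<subseteq> X \<and> hd (g b) \<in> A \<and> last (g b) = b \<and> b \<in> B \<and> set (butlast (g b)) \<inter> B = {}"
    and dj: "\<And>b b'. b \<in> T \<Longrightarrow> b' \<in> T \<Longrightarrow> b \<noteq> b' \<Longrightarrow> set (g b) \<inter> set (g b') = {}"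
    and sep: "\<And>S. finite S \<Longrightarrow> card S < n \<Longrightarrow> \<exists>p. is_path adj p \<and> set p \<subseteq> X \<and> hd p \<in> A \<and> last p \<in> B \<and> set p \<inter> S = {}"
  obtains T' h where "T \<subseteq> T'" "T' \<subseteq> B" "card T' = n"
    "\<And>b. b \<in> T' \<Longrightarrow> is_path adj (h b) \<and> set (h b) \<subseteq> X \<and> hd (h b) \<in> A \<and> last (h b) = b \<and> set (butlast (h b)) \<inter> B = {}"
    "\<And>b b'. b \<in> T' \<Longrightarrow> b' \<in> T' \<Longrightarrow> b \<noteq> b' \<Longrightarrow> set (h b) \<inter> set (h b') = {}"
    "(\<lambda>b. hd (g b)) ` T \<subseteq> (\<lambda>b. hd (h b)) ` T'"
proof -
  let ?E = "\<lambda>x y. adj x y \<and> x \<in> X \<and> y \<in> X"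
  have eq: "is_path ?E p \<and> hd p \<in> A \<longleftrightarrow> is_path adj p \<and> set p \<subseteq> X \<and> hd p \<in> A" for p
  proof (cases "hd p \<in> A")
    case True
    then have "hd p \<in> X" using A by auto
    from restricted_path[OF this] show ?thesis by simp
  qed simp
  show ?thesis
  proof (rule menger_fan[OF T, of ?E g A B])
    show "is_path ?E (g b) \<and> hd (g b) \<in> A \<and> last (g b) = b \<and> b \<in> B \<and> set (butlast (g b)) \<inter> B = {}"
      if "b \<in> T" for b using init[OF that] eq[of "g b"] by simp
    show "\<exists>p. is_path ?E p \<and> hd p \<in> A \<and> last p \<in> B \<and> set p \<inter> S = {}" if S: "finite S" "card S < n" for S
    proof -
      obtain p where "is_path adj p" "set p \<subseteq> X" "hd p \<in> A" "last p \<in> B" "set p \<inter> S = {}"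
        using sep[OF S] by auto
      then show ?thesis using eq[of p] by (intro exI[of _ p]) simp
    qed
    fix T' h
    assume h: "T \<subseteq> T'" "T' \<subseteq> B" "card T' = n"
      "\<And>b. b \<in> T' \<Longrightarrow> is_path ?E (h b) \<and> hd (h b) \<in> A \<and> last (h b) = b \<and> set (butlast (h b)) \<inter> B = {}"
      "\<And>b b'. b \<in> T' \<Longrightarrow> b' \<in> T' \<Longrightarrow> b \<noteq> b' \<Longrightarrow> set (h b) \<inter> set (h b') = {}"
      "(\<lambda>b. hd (g b)) ` T \<subseteq> (\<lambda>b. hd (h b)) ` T'"
    have "is_path adj (h b) \<and> set (h b) \<subseteq> X \<and> hd (h b) \<in> A \<and> last (h b) = b \<and> set (butlast (h b)) \<inter> B = {}"
      if "b \<in> T'" for b using h(4)[OF that] eq[of "h b"] by simp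
    then show thesis by (rule that[OF h(1-3) _ h(5,6)])
  qed (rule dj)
qed

text \<open>A fan at \<open>s\<close> is a set of disjoint paths that start in the neighbours of
  \<open>s\<close> within \<open>X\<close>. As \<open>s\<close> itself is outside \<open>X\<close>,
  a separator gains nothing from containing it, so only links from \<open>s\<close> to
  \<open>B\<close> that avoid \<open>S\<close> within \<open>X\<close> have to be found.\<close>

lemma star_fan:
  assumes T: "finite T" "card T \<le> n" and X: "s \<notin> X" "s \<notin> B"
    and init: "\<And>b. b \<in> T \<Longrightarrow> link s (Z b) b \<and> Z b \<subseteq> X \<and> b \<in> X \<and> b \<in> B \<and> Z b \<inter> B = {}"
    and dj: "\<And>b b'. b \<in> T \<Longrightarrow> b' \<in> T \<Longrightarrow> b \<noteq> b' \<Longrightarrow> Z b \<inter> Z b' = {}"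
    and sep: "\<And>S. finite S \<Longrightarrow> card S < n \<Longrightarrow> \<exists>W y. link s W y \<and> y \<in> B \<and> y \<in> X - S \<and> W \<subseteq> X - S"
  obtains T' H where "T \<subseteq> T'" "T' \<subseteq> B" "card T' = n"
    "\<And>b. b \<in> T' \<Longrightarrow> seg s (H b) b \<and> H b \<subseteq> X \<and> H b \<inter> B = {}"
    "\<And>b b'. b \<in> T' \<Longrightarrow> b' \<in> T' \<Longrightarrow> b \<noteq> b' \<Longrightarrow> H b \<inter> H b' = {}"
proof -
  have "\<exists>p. is_path adj p \<and> adj s (hd p) \<and> last p = b \<and> set p \<subseteq> insert b (Z b) \<and> set (butlast p) \<subseteq> Z b" if "b \<in> T" for b
  proof -
    have "s \<noteq> b" "link s (Z b) b" using init[OF that] X by auto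
    then obtain p where "is_path adj p" "adj s (hd p)" "last p = b" "set p \<subseteq> insert b (Z b - {s})"
      "set (butlast p) \<subseteq> Z b - {s, b}" using link_tl by metis
    then show ?thesis by (intro exI[of _ p]) auto
  qed
  then obtain g where g: "\<And>b. b \<in> T \<Longrightarrow> is_path adj (g b) \<and> adj s (hd (g b)) \<and> last (g b) = b \<and> set (g b) \<subseteq> insert b (Z b) \<and> set (butlast (g b)) \<subseteq> Z b"
    by metis
  define A where "A = {x \<in> X. adj s x}"
  have hdin: "hd p \<in> set p" if "is_path adj p" for p using that by (simp add: is_path_def)
  show ?thesis
  proof (rule fan[OF T, of A X g B])
    show "A \<subseteq> X" by (auto simp: A_def)
    show "is_path adj (g b) \<and> set (g b) \<subseteq> X \<and> hd (g b) \<in> A \<and> last (g b) = b \<and> b \<in> B \<and> set (butlast (g b)) \<inter> B = {}" if "b \<in> T" for b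
    proof -
      have "set (g b) \<subseteq> X" "hd (g b) \<in> set (g b)" "set (butlast (g b)) \<inter> B = {}"
        using g[OF that] init[OF that] hdin[of "g b"] by auto
      then show ?thesis using g[OF that] init[OF that] unfolding A_def by auto
    qed
    show "set (g b) \<inter> set (g b') = {}" if "b \<in> T" "b' \<in> T" "b \<noteq> b'" for b b'
    proof -
      have "set (g b) \<subseteq> insert b (Z b)" "set (g b') \<subseteq> insert b' (Z b')" "b \<notin> Z b'" "b' \<notin> Z b"
        using g[OF that(1)] g[OF that(2)] init[OF that(1)] init[OF that(2)] by auto
      then show ?thesis using dj[OF that] that(3) by auto
    qed
    show "\<exists>p. is_path adj p \<and> set p \<subseteq> X \<and> hd p \<in> A \<and> last p \<in> B \<and> set p \<inter> S = {}" if S: "finite S" "card S < n" for S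
    proof -
      obtain W y where W: "link s W y" "y \<in> B" "y \<in> X - S" "W \<subseteq> X - S" using sep[OF S] by blast
      have "s \<noteq> y" using W X by auto
      then obtain p where p: "is_path adj p" "adj s (hd p)" "last p = y" "set p \<subseteq> insert y (W - {s})"
        using link_tl[OF W(1)] by metis
      have "set p \<subseteq> X" "set p \<inter> S = {}" using p W by auto
      then show ?thesis using p W hdin[OF p(1)] unfolding A_def by (intro exI[of _ p]) auto
    qed
    fix T' h
    assume h: "T \<subseteq> T'" "T' \<subseteq> B" "card T' = n"
      "\<And>b. b \<in> T' \<Longrightarrow> is_path adj (h b) \<and> set (h b) \<subseteq> X \<and> hd (h b) \<in> A \<and> last (h b) = b \<and> set (butlast (h b)) \<inter> B = {}"
      "\<And>b b'. b \<in> T' \<Longrightarrow> b' \<in> T' \<Longrightarrow> b \<noteq> b' \<Longrightarrow> set (h b) \<inter> set (h b') = {}"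
    have bl: "set (butlast p) \<subseteq> set p" for p :: "'a list" by (auto dest: in_set_butlastD)
    show thesis
    proof (rule that[OF h(1-3), of "\<lambda>b. set (butlast (h b))"])
      show "seg s (set (butlast (h b))) b \<and> set (butlast (h b)) \<subseteq> X \<and> set (butlast (h b)) \<inter> B = {}" if "b \<in> T'" for b
      proof -
        have "s \<notin> set (h b)" using h(4)[OF that] X by auto
        then show ?thesis using h(4)[OF that] path_seg[of "h b" s] bl[of "h b"] unfolding A_def by auto
      qed
      show "set (butlast (h b)) \<inter> set (butlast (h b')) = {}" if "b \<in> T'" "b' \<in> T'" "b \<noteq> b'" for b b'
        using h(5)[OF that] bl[of "h b"] bl[of "h b'"] by auto
    qed
  qed
qed

end

text \<open>
  Pairwise disjointness, where empty sets may be repeated. Both orders of each intersection are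
  listed, so that the simplifier can rewrite with either of them.
\<close>
fun dj :: "'a set list \<Rightarrow> bool" where
  "dj [] = True"
| "dj (X # Xs) = ((\<forall>Y\<in>set Xs. X \<inter> Y = {} \<and> Y \<inter> X = {}) \<and> dj Xs)"

lemma dj_mono: "dj Ys \<Longrightarrow> list_all2 (\<subseteq>) Xs Ys \<Longrightarrow> dj Xs"
proof (induction Xs arbitrary: Ys)
  case (Cons X Xs)
  then obtain Y Ys' where Ys: "Ys = Y # Ys'" "X \<subseteq> Y" "list_all2 (\<subseteq>) Xs Ys'" by (auto simp: list_all2_Cons1)
  have "X \<inter> X' = {} \<and> X' \<inter> X = {}" if X': "X' \<in> set Xs" for X'
  proof -
    obtain i where i: "i < length Xs" "X' = Xs ! i" using X' by (metis in_set_conv_nth)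
    then have "Ys' ! i \<in> set Ys'" "X' \<subseteq> Ys' ! i" using Ys(3) by (auto simp: list_all2_conv_all_nth)
    moreover from this have "Y \<inter> Ys' ! i = {}" using Cons.prems(1) Ys(1) by simp
    ultimately show ?thesis using Ys(2) by blast
  qed
  then show ?case using Cons.IH[of Ys'] Cons.prems(1) Ys by simp
qed simp

text \<open>Splits unions inside the entries of a \<open>dj\<close> list into intersections of
  atoms. Regrouping a disjoint system after a rerouting then becomes a simplification.\<close>

lemmas Int_Un = Int_Un_distrib Int_Un_distrib2

text \<open>Every vertex on a path from \<open>a\<close> inside \<open>Z\<close> is reached from
  \<open>a\<close> as well, so the path stays in the component. Needed for the component
  \<open>U\<close> of \<open>u4\<close> and for a component \<open>D\<close> around
  \<open>u3\<close>.\<close>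

lemma (in sgraph) conn_component: "conn Z a b \<Longrightarrow> conn {v. conn Z a v} a b"
proof -
  assume ab: "conn Z a b"
  then have a: "a \<in> Z" by (simp add: conn_def)
  have "(\<lambda>x y. adj x y \<and> x \<in> Z \<and> y \<in> Z)\<^sup>*\<^sup>* a b" using ab by (simp add: conn_def)
  then show ?thesis
  proof (induction rule: rtranclp_induct)
    case base then show ?case using a by (simp add: conn_refl)
  next
    case (step y z)
    have y: "conn Z a y" using conn_mem[OF step.IH] by simp
    have "conn Z a z" using conn_trans[OF y conn_step[of y z Z]] step.hyps(2) by simp
    then have "conn {v. conn Z a v} y z" using y step.hyps(2) by (intro conn_step) auto
    then show ?case using conn_trans[OF step.IH] by simp
  qed
qed

section \<open>Largest component of \<open>u4\<close>\<close>

text \<open>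
  \<open>adj\<close> lacks the edges \<open>u1 u2\<close> and \<open>u2 u3\<close>, so it is highly connected only after the deletion of \<open>u2\<close>.
  The links in the last assumption are the edges of the graph that a flower subdivides: \<open>f\<close>, \<open>q\<close>, \<open>g\<close> are
  the ends \<open>v1\<close>, \<open>v2\<close>, \<open>v3\<close> of its paths.
\<close>
locale kitefree = sgraph adj for adj :: "'a \<Rightarrow> 'a \<Rightarrow> bool" +
  fixes V :: "'a set" and u1 u2 u3 u4 :: 'a
  assumes finV: "finite V" and card_V: "8 < card V" and adjV: "adj x y \<Longrightarrow> x \<in> V" and irrefl: "\<not> adj x x"
    and dist: "distinct [u1, u2, u3, u4]" and uV: "{u1, u2, u3, u4} \<subseteq> V"
    and connected_minus: "finite S \<Longrightarrow> card S \<le> 7 \<Longrightarrow> u2 \<in> S \<Longrightarrow> x \<in> V - S \<Longrightarrow> y \<in> V - S \<Longrightarrow> conn (V - S) x y"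
    and degree_u2: "6 \<le> card {x. adj u2 x}"
    and nonadj: "\<not> adj u2 u1" "\<not> adj u2 u3"
    and no_kite: "link u2 Y1 u1 \<Longrightarrow> link u1 Y2 u3 \<Longrightarrow> link u3 Y3 u2 \<Longrightarrow> link u2 Y4 u4 \<Longrightarrow>
      u4 \<in> Y4 \<Longrightarrow> dj [Y1, Y2, Y3, Y4, {u1}, {u2}, {u3}] \<Longrightarrow> False"
    and no_flower: "link u2 A1 u1 \<Longrightarrow> link u2 A2 u1 \<Longrightarrow> link u2 B1 u3 \<Longrightarrow> link u2 B2 u3 \<Longrightarrow>
      link u1 X1 f \<Longrightarrow> link u2 X2 q \<Longrightarrow> link u3 X3 g \<Longrightarrow> link f K1 q \<Longrightarrow> link q K3 g \<Longrightarrow>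
      link u4 L1 f \<Longrightarrow> link u4 L3 g \<Longrightarrow>
      dj [A1, A2, B1, B2, X1, X2, X3, K1, K3, L1, L3, {f}, {q}, {g}, {u1}, {u2}, {u3}, {u4}] \<Longrightarrow> False"
begin

text \<open>A kite-linkage read backwards exchanges \<open>u1\<close> and \<open>u3\<close>, and so
  does a flower, because its third cycle may be traversed in either direction.\<close>

lemma swap: "kitefree adj V u3 u2 u1 u4"
proof unfold_locales
  show "\<not> adj u2 u3" "\<not> adj u2 u1" by (fact nonadj)+
  show False if "link u2 Y1 u3" "link u3 Y2 u1" "link u1 Y3 u2" "link u2 Y4 u4"
    "u4 \<in> Y4" "dj [Y1, Y2, Y3, Y4, {u3}, {u2}, {u1}]" for Y1 Y2 Y3 Y4
  proof (rule no_kite[OF link_sym[OF that(3)] link_sym[OF that(2)] link_sym[OF that(1)] that(4,5)])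
    show "dj [Y3, Y2, Y1, Y4, {u1}, {u2}, {u3}]" using that(6) by clarsimp
  qed
  show False if "link u2 A1 u3" "link u2 A2 u3" "link u2 B1 u1" "link u2 B2 u1"
      "link u3 X1 f" "link u2 X2 q" "link u1 X3 g" "link f K1 q" "link q K3 g" "link u4 L1 f" "link u4 L3 g"
      "dj [A1, A2, B1, B2, X1, X2, X3, K1, K3, L1, L3, {f}, {q}, {g}, {u3}, {u2}, {u1}, {u4}]"
    for A1 A2 B1 B2 X1 f X2 q X3 g K1 K3 L1 L3
  proof (rule no_flower[OF that(3,4,1,2,7,6,5) link_sym[OF that(9)] link_sym[OF that(8)] that(11,10)])
    show "dj [B1, B2, A1, A2, X3, X2, X1, K3, K1, L3, L1, {g}, {q}, {f}, {u1}, {u2}, {u3}, {u4}]"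
      using that(12) by clarsimp
  qed
qed (use finV card_V adjV irrefl dist uV connected_minus degree_u2 in auto)

text \<open>If \<open>u2\<close> is not deleted, delete it in addition, which is within the budget
  of 7, and attach it again by one of its 6 neighbours; 5 deleted vertices cannot contain all of
  them.\<close>

lemma connected_minus_5:
  assumes "finite S" "card S \<le> 5" "x \<in> V - S" "y \<in> V - S" shows "conn (V - S) x y"
proof (cases "u2 \<in> S")
  case True then show ?thesis using connected_minus assms by simp
next
  case False
  have c7: "card (insert u2 S) \<le> 7" using assms by (simp add: card_insert_if)
  have c: "conn (V - S) x y" if "x \<in> V - S - {u2}" "y \<in> V - S - {u2}" for x y
  proof (rule conn_mono[of "V - insert u2 S"])
    show "conn (V - insert u2 S) x y" using c7 that assms(1) by (intro connected_minus) auto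
  qed auto
  have "\<not> {x. adj u2 x} \<subseteq> S" 
  proof
    assume "{x. adj u2 x} \<subseteq> S"
    from card_mono[OF assms(1) this] show False using degree_u2 assms(2) by simp
  qed
  then obtain z where z: "adj u2 z" "z \<notin> S" by blast
  have zu: "z \<noteq> u2" using z irrefl by auto
  have "z \<in> V" using z adjV adj_sym by blast
  then have uz: "conn (V - S) u2 z" using z False uV by (intro conn_step) auto
  have "conn (V - S) w z" if "w \<in> V - S" for w
    using uz c[of w z] that z zu \<open>z \<in> V\<close> by (cases "w = u2") auto
  then have "conn (V - S) x z" "conn (V - S) z y" using assms(3,4) conn_sym by blast+
  then show ?thesis by (rule conn_trans)
qed

lemma link_V: assumes "link a Z b" "a \<noteq> b" shows "a \<in> V" "b \<in> V"
proof -
  obtain Z' where "seg a Z' b" using link_seg[OF assms] by metis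
  from seg_last_adj[OF this] seg_last_adj[OF seg_sym[OF this]] show "a \<in> V" "b \<in> V"
    using adjV adj_sym by blast+
qed

lemma seg_V: assumes "seg a Z b" shows "Z \<subseteq> V" "a \<in> V" "b \<in> V"
proof -
  show "Z \<subseteq> V"
  proof
    fix x assume x: "x \<in> Z"
    then have "a \<noteq> x" using seg_ends[OF assms] by auto
    then show "x \<in> V" using link_V[OF seg_elem(1)[OF assms x]] by simp
  qed
  show "a \<in> V" "b \<in> V" using link_V[OF seg_link[OF assms]] seg_ends[OF assms] by auto
qed

end

text \<open>Only \<open>R\<close> and \<open>U\<close> are fixed. The two cycles are rerouted again
  and again and therefore appear as hypotheses of the lemmas. \<open>U_max\<close> is what the
  extremal choice of \<open>U\<close> contributes, stated for links so that rerouted systems can be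
  inserted directly.\<close>

locale kite_hull = kitefree +
  fixes P1 :: "'a set" and r :: 'a and Q :: "'a set" and r' :: 'a and P3 U :: "'a set"
  assumes dj_hull: "dj [P1, {r}, Q, {r'}, P3, U, {u1}, {u2}, {u3}]"
    and seg_P1: "seg u1 P1 r" and seg_Q: "seg r Q r'" and seg_P3: "seg r' P3 u3"
    and u4U: "u4 \<in> U" and U_conn: "x \<in> U \<Longrightarrow> conn U u4 x"
    and U_r: "\<exists>x\<in>U. adj x r" "\<exists>x\<in>U. adj x r'"
    and U_nbr: "x \<in> U \<Longrightarrow> adj x y \<Longrightarrow> y \<in> U \<union> Q \<union> {u1, u3, r, r'}"
    and U_max: "link u2 A1 u1 \<Longrightarrow> link u2 A2 u1 \<Longrightarrow> link u2 B1 u3 \<Longrightarrow> link u2 B2 u3 \<Longrightarrow> link u1 R u3 \<Longrightarrow>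
      dj [A1, A2, B1, B2, R, U, {u1}, {u2}, {u3}] \<Longrightarrow> {r, r'} \<subseteq> A1 \<union> A2 \<union> B1 \<union> B2 \<union> R"
begin

lemma swap_hull: "kite_hull adj V u3 u2 u1 u4 P3 r' Q r P1 U"
proof -
  interpret s: kitefree adj V u3 u2 u1 u4 by (rule swap)
  show ?thesis
  proof unfold_locales
    show "dj [P3, {r'}, Q, {r}, P1, U, {u3}, {u2}, {u1}]" using dj_hull by clarsimp
    show "{r', r} \<subseteq> A1 \<union> A2 \<union> B1 \<union> B2 \<union> R" if "link u2 A1 u3" "link u2 A2 u3" "link u2 B1 u1" "link u2 B2 u1"
      "link u3 R u1" "dj [A1, A2, B1, B2, R, U, {u3}, {u2}, {u1}]" for A1 A2 B1 B2 R
    proof -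
      have "dj [B1, B2, A1, A2, R, U, {u1}, {u2}, {u3}]" using that(6) by clarsimp
      from U_max[OF that(3,4,1,2) link_sym[OF that(5)] this] show ?thesis by auto
    qed
  qed (use seg_sym[OF seg_P1] seg_sym[OF seg_Q] seg_sym[OF seg_P3] u4U U_conn U_r U_nbr in auto)
qed

lemma U_link_r: "link r U u4" "link r' U u4"
proof -
  have "link y U u4" if "x \<in> U" "adj x y" for x y
  proof -
    have "link x U u4" using conn_link[OF conn_sym[OF U_conn[OF that(1)]]] .
    with link_comp[OF link_adj[OF adj_sym[OF that(2)], of "{}"] this] show ?thesis
      using that(1) by (simp add: insert_absorb)
  qed
  then show "link r U u4" "link r' U u4" using U_r by blast+
qed

text \<open>The new path \<open>He\<close> continues along \<open>P1\<close> to \<open>r\<close> and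
  through \<open>U\<close> to \<open>u4\<close>, which gives the pendant path. This occupies the
  left part of \<open>R\<close>; the way from \<open>u1\<close> to \<open>u3\<close> therefore runs
  back along \<open>A1t\<close> to \<open>c\<close>, over \<open>T\<close> to \<open>Q\<close>, and
  on along \<open>P3\<close>.\<close>

lemma after_fan_kite:
  assumes d: "dj [Hc, {c}, A1t, Hu, He, B1, B2, T, P1, {r}, Q, {r'}, P3, U, {u1}, {u2}, {u3}]"
    and l: "link u2 Hc c" "seg c A1t u1" "link u2 Hu u1" "link u2 He e" "link u2 B1 u3" "link u2 B2 u3"
    and T: "q \<in> Q" "link c T q" and e: "e \<in> P1 \<union> {r}"
  shows False
proof -
  have er: "link e (P1 \<union> {r}) r"
    using e seg_elem(2)[OF seg_P1, of e] link_refl link_mono[of e P1 r "P1 \<union> {r}"] by auto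
  have S: "link u2 (He \<union> ((P1 \<union> {r}) \<union> U)) u4"
    by (rule link_via[OF l(4) link_via[OF er U_link_r(1)]]) (use e in auto)
  have R: "link u1 (A1t \<union> {c} \<union> (T \<union> (Q \<union> {r'} \<union> P3))) u3"
    by (rule link_comp[OF link_sym[OF seg_link[OF l(2)]] link_via[OF T(2) link_comp[OF seg_elem(2)[OF seg_Q T(1)] seg_link[OF seg_P3]]]])
      (use T in auto)
  show False
    by (rule no_kite[OF l(3) R link_sym[OF l(5)] S]) (use u4U d in \<open>clarsimp simp: Int_Un\<close>)+
qed

text \<open>
  If two disjoint paths from \<open>u4\<close> reach the same side of \<open>q\<close>, then a path through \<open>U\<close> from the
  extreme neighbour on the other side meets at most one of them first, which is rerouted.
\<close>
lemma hull_flower: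
  assumes d: "dj [A1, A2, B1, B2, P2, P1, {r}, Q, {r'}, P3, U, {u1}, {u2}, {u3}]"
    and l: "link u2 A1 u1" "link u2 A2 u1" "link u2 B1 u3" "link u2 B2 u3"
    and q: "q \<in> Q" "link u2 P2 q"
  shows False
proof -
  obtain Ql Qr where Q: "seg r Ql q" "seg q Qr r'" "Q = Ql \<union> {q} \<union> Qr" "Ql \<inter> Qr = {}" "q \<notin> Ql" "q \<notin> Qr"
    using seg_split[OF seg_Q q(1)] by metis
  have Q': "Qr \<inter> Ql = {}" using Q(4) by blast
  define PL where "PL = P1 \<union> {r} \<union> Ql"
  define PR where "PR = P3 \<union> {r'} \<union> Qr"
  have d1: "dj [A1, A2, B1, B2, P2, PL, {q}, PR, U, {u1}, {u2}, {u3}]"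
    using d Q(4-6) Q' unfolding PL_def PR_def Q(3) by (clarsimp simp: Int_Un)
  have dl: "dj [P1, {r}, Ql]" "dj [P3, {r'}, Qr]" using d unfolding Q(3) by (simp_all add: Int_Un)
  have left: "\<exists>X1 K1. link u1 X1 f \<and> link f K1 q \<and> PL = X1 \<union> {f} \<union> K1 \<and> dj [X1, {f}, K1]" if f: "f \<in> {r} \<union> Ql" for f
  proof (cases "f = r")
    case True
    show ?thesis
      using seg_link[OF seg_P1] seg_link[OF Q(1)] True dl(1) unfolding PL_def
      by (intro exI[of _ P1] exI[of _ Ql]) simp
  next
    case False
    then obtain s1 s2 where s: "seg r s1 f" "seg f s2 q" "Ql = s1 \<union> {f} \<union> s2" "s1 \<inter> s2 = {}" "f \<notin> s1" "f \<notin> s2"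
      using f seg_split[OF Q(1), of f] by blast
    have "dj [P1 \<union> {r} \<union> s1, {f}, s2]" using dl(1) s(4-6) False unfolding s(3) by (auto simp: Int_Un)
    moreover have "PL = P1 \<union> {r} \<union> s1 \<union> {f} \<union> s2" unfolding PL_def s(3) by auto
    ultimately show ?thesis using link_comp[OF seg_link[OF seg_P1] seg_link[OF s(1)]] seg_link[OF s(2)] by blast
  qed
  have right: "\<exists>X3 K3. link u3 X3 f \<and> link q K3 f \<and> PR = X3 \<union> {f} \<union> K3 \<and> dj [X3, {f}, K3]" if f: "f \<in> {r'} \<union> Qr" for f
  proof (cases "f = r'")
    case True
    show ?thesis
      using link_sym[OF seg_link[OF seg_P3]] seg_link[OF Q(2)] True dl(2) unfolding PR_def
      by (intro exI[of _ P3] exI[of _ Qr]) simp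
  next
    case False
    then obtain s1 s2 where s: "seg q s1 f" "seg f s2 r'" "Qr = s1 \<union> {f} \<union> s2" "s1 \<inter> s2 = {}" "f \<notin> s1" "f \<notin> s2"
      using f seg_split[OF Q(2), of f] by blast
    have "dj [P3 \<union> {r'} \<union> s2, {f}, s1]" using dl(2) s(4-6) False unfolding s(3) by (auto simp: Int_Un)
    moreover have "PR = P3 \<union> {r'} \<union> s2 \<union> {f} \<union> s1" unfolding PR_def s(3) by auto
    ultimately show ?thesis
      using link_comp[OF link_sym[OF seg_link[OF seg_P3]] link_sym[OF seg_link[OF s(2)]]] seg_link[OF s(1)] by blast
  qed
  \<comment> \<open>Legs from \<open>u4\<close> that end on different sides of \<open>q\<close>
    close the third cycle; what remains of \<open>R\<close> beyond \<open>f\<close> and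
    \<open>g\<close> leads to \<open>u1\<close> and \<open>u3\<close>.\<close>
  have legs: False if f: "f \<in> {r} \<union> Ql" and g: "g \<in> {r'} \<union> Qr" and L: "link u4 L1 f" "link u4 L3 g" "L1 \<subseteq> U - {u4}" "L3 \<subseteq> U - {u4}" "L1 \<inter> L3 = {}"
    for f g L1 L3
  proof -
    obtain X1 K1 where 1: "link u1 X1 f" "link f K1 q" "PL = X1 \<union> {f} \<union> K1" "dj [X1, {f}, K1]" using left[OF f] by blast
    obtain X3 K3 where 3: "link u3 X3 g" "link q K3 g" "PR = X3 \<union> {g} \<union> K3" "dj [X3, {g}, K3]" using right[OF g] by blast
    define Ur where "Ur = U - L1 - L3 - {u4}"
    have U: "U = L1 \<union> L3 \<union> {u4} \<union> Ur" using L u4U by (auto simp: Ur_def)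
    have L': "L3 \<inter> L1 = {}" "u4 \<notin> L1" "u4 \<notin> L3" using L by auto
    have "dj [A1, A2, B1, B2, P2, X1 \<union> {f} \<union> K1, {q}, X3 \<union> {g} \<union> K3, L1 \<union> L3 \<union> {u4} \<union> Ur, {u1}, {u2}, {u3}]"
      using d1 unfolding 1(3) 3(3) U .
    then show False
      using 1(4) 3(4) L(5) L'
      by (intro no_flower[OF l 1(1) q(2) 3(1) 1(2) 3(2) L(1,2)]) (clarsimp simp: Int_Un)
  qed
  define B where "B = {y \<in> {r, r'} \<union> Ql \<union> Qr. \<exists>x\<in>U. adj x y}"
  define X where "X = (U - {u4}) \<union> B"
  have rQU: "({r, r'} \<union> Q) \<inter> U = {}" "u2 \<notin> Q \<union> {r, r'} \<union> U" "{u1, u3} \<inter> U = {}" using dj_hull by auto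
  have BQ: "B \<subseteq> {r, r'} \<union> Q" unfolding B_def Q(3) by auto
  have BU: "B \<inter> U = {}" using rQU(1) BQ by auto
  have u2X: "u2 \<notin> X" "u4 \<notin> X" "u4 \<notin> B" using rQU(2) BQ BU u4U unfolding X_def by auto
  obtain T' H where TH: "{} \<subseteq> T'" "T' \<subseteq> B" "card T' = 2"
    "\<And>b. b \<in> T' \<Longrightarrow> seg u4 (H b) b \<and> H b \<subseteq> X \<and> H b \<inter> B = {}"
    "\<And>b b'. b \<in> T' \<Longrightarrow> b' \<in> T' \<Longrightarrow> b \<noteq> b' \<Longrightarrow> H b \<inter> H b' = {}"
  proof (rule star_fan[of "{}" 2 u4 X B])
    show "\<exists>W y. link u4 W y \<and> y \<in> B \<and> y \<in> X - S \<and> W \<subseteq> X - S" if S: "finite S" "card S < 2" for S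
    proof -
      \<comment> \<open>Outside \<open>B\<close>, the vertices \<open>q\<close>, \<open>u1\<close>,
        \<open>u3\<close> are the only ones by which \<open>U\<close> can be left. With them and at
        most one vertex of \<open>S\<close> deleted, a path from \<open>u4\<close> to
        \<open>u2\<close> must leave \<open>U\<close> through \<open>B\<close>.\<close>
      define K where "K = (S \<inter> X) \<union> {q, u1, u3}"
      have "card (S \<inter> X) \<le> 1" using card_mono[of S "S \<inter> X"] S by auto
      moreover have "card {q, u1, u3} \<le> 3" by (simp add: card_insert_if)
      ultimately have "card K \<le> 5" using card_Un_le[of "S \<inter> X" "{q, u1, u3}"] unfolding K_def by linarith
      moreover have "finite K" using S by (simp add: K_def)
      moreover have "u4 \<notin> K" using u2X(2) u4U q(1) rQU dist unfolding K_def by auto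
      moreover have "u2 \<notin> K" using u2X(1) q(1) rQU dist unfolding K_def by auto
      ultimately have "conn (V - K) u4 u2" using uV by (intro connected_minus_5) auto
      moreover have "u4 \<in> {u4}" "u2 \<in> - U" "{u4} \<inter> - U = {}" using rQU(2) u4U by auto
      ultimately have "\<exists>x T y. x \<in> {u4} \<and> x \<in> V - K \<and> y \<in> - U \<and> y \<in> V - K \<and> seg x T y \<and> T \<subseteq> V - K \<and> T \<inter> ({u4} \<union> - U) = {}"
        by (rule bridge)
      then obtain x T y where b: "x \<in> {u4}" "x \<in> V - K" "y \<in> - U" "y \<in> V - K" "seg x T y"
        "T \<subseteq> V - K" "T \<inter> ({u4} \<union> - U) = {}" by blast
      have x: "x = u4" using b by simp
      obtain z where z: "z \<in> insert u4 T" "adj z y" using seg_last_adj[OF b(5)] x by auto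
      have zU: "z \<in> U" using z b(7) u4U by auto
      have "y \<in> Q \<union> {u1, u3, r, r'}" using U_nbr[OF zU z(2)] b(3) by auto
      then have yB: "y \<in> B" using b(4) z(2) zU unfolding K_def B_def Q(3) by auto
      have TX: "T \<subseteq> X" using b(7) unfolding X_def by auto
      have "y \<in> X - S" using yB b(4) unfolding X_def K_def by auto
      moreover have "T \<subseteq> X - S" using TX b(6) unfolding K_def by auto
      ultimately show ?thesis using yB seg_link[OF b(5)] x by auto
    qed
  qed (use u2X in auto)
  from TH(3) obtain b1 b2 where b: "T' = {b1, b2}" "b1 \<noteq> b2" by (auto simp: card_2_iff)
  have HU: "H b1 \<subseteq> U - {u4}" "H b2 \<subseteq> U - {u4}"
    using TH(4)[of b1] TH(4)[of b2] b(1) unfolding X_def by auto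
  have H12: "H b1 \<inter> H b2 = {}" using TH(5)[of b1 b2] b by auto
  have seg: "seg u4 (H b1) b1" "seg u4 (H b2) b2" using TH(4) b by auto
  have bB: "b1 \<in> B" "b2 \<in> B" using TH(2) b by auto
  have one: "\<exists>b\<in>{b1, b2}. \<exists>L1 L3. link u4 L1 y \<and> link u4 L3 b \<and> L1 \<subseteq> U - {u4} \<and> L3 \<subseteq> U - {u4} \<and> L1 \<inter> L3 = {}"
    if y: "link y U u4" "y \<notin> U" for y
  proof -
    have "conn (insert y U) y u4" using link_conn[OF y(1)] u4U by auto
    moreover have "{y} \<inter> ({u4} \<union> H b1 \<union> H b2) = {}" using y HU u4U by auto
    ultimately have "\<exists>x T v. x \<in> {y} \<and> x \<in> insert y U \<and> v \<in> {u4} \<union> H b1 \<union> H b2 \<and> v \<in> insert y U \<and> seg x T v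
      \<and> T \<subseteq> insert y U \<and> T \<inter> ({y} \<union> ({u4} \<union> H b1 \<union> H b2)) = {}"
      by (intro bridge) auto
    then obtain x T v where v: "x \<in> {y}" "x \<in> insert y U" "v \<in> {u4} \<union> H b1 \<union> H b2" "v \<in> insert y U" "seg x T v"
      "T \<subseteq> insert y U" "T \<inter> ({y} \<union> ({u4} \<union> H b1 \<union> H b2)) = {}"
      by blast
    have T: "link y T v" "T \<subseteq> U - {u4}" "T \<inter> H b1 = {}" "T \<inter> H b2 = {}" using seg_link[OF v(5)] v by auto
    consider "v = u4" | "v \<in> H b1" | "v \<in> H b2" using v(3) by auto
    then show ?thesis
    proof cases
      case 1
      then show ?thesis using T link_sym[OF T(1)] seg_link[OF seg(1)] HU
        by (intro bexI[of _ b1] exI[of _ T] exI[of _ "H b1"]) auto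
    next
      case 2
      have "link u4 (H b1 \<union> T) y" using link_via[OF seg_elem(1)[OF seg(1) 2] link_sym[OF T(1)]] 2 by auto
      then show ?thesis using T seg_link[OF seg(2)] HU H12
        by (intro bexI[of _ b2] exI[of _ "H b1 \<union> T"] exI[of _ "H b2"]) auto
    next
      case 3
      have "link u4 (H b2 \<union> T) y" using link_via[OF seg_elem(1)[OF seg(2) 3] link_sym[OF T(1)]] 3 by auto
      then show ?thesis using T seg_link[OF seg(1)] HU H12
        by (intro bexI[of _ b1] exI[of _ "H b2 \<union> T"] exI[of _ "H b1"]) auto
    qed
  qed
  have rU: "r \<notin> U" "r' \<notin> U" using d by auto
  have side: "b \<in> {r} \<union> Ql \<or> b \<in> {r'} \<union> Qr" if "b \<in> B" for b using that unfolding B_def by auto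
  consider "b1 \<in> {r} \<union> Ql" "b2 \<in> {r'} \<union> Qr" | "b2 \<in> {r} \<union> Ql" "b1 \<in> {r'} \<union> Qr"
    | "{b1, b2} \<subseteq> {r} \<union> Ql" | "{b1, b2} \<subseteq> {r'} \<union> Qr"
    using side[OF bB(1)] side[OF bB(2)] by blast
  then show False
  proof cases
    case 1 then show False using legs[OF 1 seg_link[OF seg(1)] seg_link[OF seg(2)] HU H12] by simp
  next
    case 2 then show False using legs[OF 2 seg_link[OF seg(2)] seg_link[OF seg(1)] HU(2,1)] H12 by auto
  next
    case 3
    obtain b L1 L3 where "b \<in> {b1, b2}" "link u4 L1 r'" "link u4 L3 b" "L1 \<subseteq> U - {u4}" "L3 \<subseteq> U - {u4}" "L1 \<inter> L3 = {}"
      using one[OF U_link_r(2) rU(2)] by blast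
    then show False using legs[of b r' L3 L1] 3 by auto
  next
    case 4
    obtain b L1 L3 where "b \<in> {b1, b2}" "link u4 L1 r" "link u4 L3 b" "L1 \<subseteq> U - {u4}" "L3 \<subseteq> U - {u4}" "L1 \<inter> L3 = {}"
      using one[OF U_link_r(1) rU(1)] by blast
    then show False using legs[of r b L1 L3] 4 by auto
  qed
qed

end

section \<open>Augmenting the fan at \<open>u2\<close>\<close>

context kite_hull begin

text \<open>Three paths leave \<open>u2\<close> on the left: \<open>Hc\<close>, \<open>Hu\<close>
  and the new \<open>He\<close>. Unless \<open>e\<close> lies on \<open>P1\<close> or is
  \<open>r\<close>, the path \<open>Hu\<close> and one of the other two close a cycle through
  \<open>u1\<close>, and the third one is led to \<open>Q\<close>, directly or over
  \<open>T\<close>, as \<open>hull_flower\<close> demands.\<close>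

lemma after_fan:
  assumes d: "dj [Hc, {c}, A1t, Hu, He, B1, B2, T, P1, {r}, Q, {r'}, P3, U, {u1}, {u2}, {u3}]"
    and l: "link u2 Hc c" "seg c A1t u1" "link u2 Hu u1" "link u2 He e" "link u2 B1 u3" "link u2 B2 u3"
    and T: "\<forall>x\<in>insert c T. \<exists>q\<in>Q. link x T q"
    and e: "e \<in> A1t \<union> T \<union> Q \<union> P1 \<union> {r}"
  shows False
proof -
  obtain q where q: "q \<in> Q" "link c T q" using T by blast
  have A1: "link u2 (Hc \<union> {c} \<union> A1t) u1" by (rule link_comp[OF l(1) seg_link[OF l(2)]])
  consider "e \<in> A1t" | "e \<in> T" | "e \<in> Q" | "e \<in> P1 \<union> {r}" using e by blast
  then show False
  proof cases
    case 1
    then obtain s1 s2 where s: "seg c s1 e" "seg e s2 u1" "A1t = s1 \<union> {e} \<union> s2" "s1 \<inter> s2 = {}" "e \<notin> s1" "e \<notin> s2"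
      using seg_split[OF l(2)] by metis
    have "dj [He \<union> {e} \<union> s2, Hu, B1, B2, Hc \<union> {c} \<union> T, P1, {r}, Q, {r'}, P3, U, {u1}, {u2}, {u3}]"
      using d unfolding s(3) by (clarsimp simp: Int_Un)
    from hull_flower[OF this link_comp[OF l(4) seg_link[OF s(2)]] l(3,5,6) q(1) link_comp[OF l(1) q(2)]] show False .
  next
    case 2
    then obtain q' where q': "q' \<in> Q" "link e T q'" using T by blast
    have "dj [Hc \<union> {c} \<union> A1t, Hu, B1, B2, He \<union> T, P1, {r}, Q, {r'}, P3, U, {u1}, {u2}, {u3}]"
      using d by (clarsimp simp: Int_Un)
    from hull_flower[OF this A1 l(3,5,6) q'(1) link_via[OF l(4) q'(2)]] show False using 2 by blast
  next
    case 3
    have "dj [Hc \<union> {c} \<union> A1t, Hu, B1, B2, He, P1, {r}, Q, {r'}, P3, U, {u1}, {u2}, {u3}]"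
      using d by (clarsimp simp: Int_Un)
    from hull_flower[OF this A1 l(3,5,6) 3 l(4)] show False .
  next
    case 4 from after_fan_kite[OF d l q 4] show False .
  qed
qed

text \<open>\<open>T\<close> may be a union of two overlapping paths that connect \<open>c\<close> and \<open>d\<close> with \<open>Q\<close>.\<close>
lemma both_feet:
  assumes d: "dj [A1l, {c}, A1t, A2, B1l, {d}, B1t, B2, T, P1, {r}, Q, {r'}, P3, U, {u1}, {u2}, {u3}]"
    and l: "link u2 A1l c" "seg c A1t u1" "link u2 A2 u1" "link u2 B1l d" "seg d B1t u3" "link u2 B2 u3"
    and T: "\<forall>x\<in>insert c (insert d T). \<exists>q\<in>Q. link x T q"
  shows False
proof -
  interpret s: kite_hull adj V u3 u2 u1 u4 P3 r' Q r P1 U by (rule swap_hull)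
  define B where "B = {c} \<union> A1t \<union> {u1} \<union> {d} \<union> B1t \<union> {u3} \<union> P1 \<union> P3 \<union> T \<union> Q \<union> {r} \<union> {r'}"
  define X where "X = - insert u2 U"
  define Z where "Z = (\<lambda>b. if b = c then A1l else if b = u1 then A2 else if b = d then B1l else B2)"
  have neq: "c \<noteq> u1" "c \<noteq> d" "c \<noteq> u3" "u1 \<noteq> d" "u1 \<noteq> u3" "d \<noteq> u3" "c \<noteq> r" "d \<noteq> r" "r \<noteq> u1" "r \<noteq> u3" "c \<noteq> u2" "d \<noteq> u2" "r \<noteq> u2"
    using d by auto
  have dB: "dj [B, U, {u2}]" "dj [A1l, A2, B1l, B2, B, U, {u2}]"
    using d unfolding B_def by (clarsimp simp: Int_Un)+
  have Zb: "Z c = A1l" "Z u1 = A2" "Z d = B1l" "Z u3 = B2" using neq by (auto simp: Z_def)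
  have inB: "{c, u1, d, u3, r} \<subseteq> B" by (auto simp: B_def)
  have inV: "{c, u1, d, u3, r} \<subseteq> V" using link_V[OF l(1)] link_V[OF l(4)] seg_V[OF seg_P1] uV neq by auto
  have nbrB: "Q \<union> {u1, u3, r, r'} \<subseteq> B" by (auto simp: B_def)
  obtain T' H where TH: "{c, u1, d, u3} \<subseteq> T'" "T' \<subseteq> B" "card T' = 5"
    "\<And>b. b \<in> T' \<Longrightarrow> seg u2 (H b) b \<and> H b \<subseteq> X \<and> H b \<inter> B = {}"
    "\<And>b b'. b \<in> T' \<Longrightarrow> b' \<in> T' \<Longrightarrow> b \<noteq> b' \<Longrightarrow> H b \<inter> H b' = {}"
  proof (rule star_fan[of "{c, u1, d, u3}" 5 u2 X B Z])
    show "link u2 (Z b) b \<and> Z b \<subseteq> X \<and> b \<in> X \<and> b \<in> B \<and> Z b \<inter> B = {}" if "b \<in> {c, u1, d, u3}" for b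
    proof -
      have "link u2 (Z b) b" using that l Zb by auto
      moreover have "b \<in> B" using that inB by auto
      moreover have "b \<in> X" using \<open>b \<in> B\<close> dB(1) unfolding X_def by auto
      moreover have "Z b \<in> {A1l, A2, B1l, B2}" using that Zb by auto
      then have "Z b \<subseteq> X \<and> Z b \<inter> B = {}" using dB(2) unfolding X_def by auto
      ultimately show ?thesis by blast
    qed
    show "Z b \<inter> Z b' = {}" if "b \<in> {c, u1, d, u3}" "b' \<in> {c, u1, d, u3}" "b \<noteq> b'" for b b'
      using that Zb dB(2) by auto
    show "\<exists>W y. link u2 W y \<and> y \<in> B \<and> y \<in> X - S \<and> W \<subseteq> X - S" if S: "finite S" "card S < 5" for S
    proof -
      define K where "K = S - {u2}"
      have K: "finite K" "card K \<le> 5" using S card_mono[of S K] by (auto simp: K_def)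
      \<comment> \<open>Fewer than 5 vertices miss one of these five members of \<open>B\<close>; it
        serves as the goal of a path from \<open>u2\<close>.\<close>
      have "card {c, u1, d, u3, r} = 5" using neq by auto
      then have "\<not> {c, u1, d, u3, r} \<subseteq> S" using card_mono[OF S(1), of "{c, u1, d, u3, r}"] S(2) by auto
      then obtain b where b: "b \<in> {c, u1, d, u3, r}" "b \<notin> S" by blast
      have "b \<in> V - K" "b \<in> B" "b \<in> B \<union> U" using b inB inV by (auto simp: K_def)
      moreover have "u2 \<in> V - K" using uV by (simp add: K_def)
      ultimately have "conn (V - K) u2 b" using connected_minus_5[OF K] by blast
      moreover have "{u2} \<inter> (B \<union> U) = {}" using dB(1) by auto
      ultimately have "\<exists>x W y. x \<in> {u2} \<and> x \<in> V - K \<and> y \<in> B \<union> U \<and> y \<in> V - K \<and> seg x W y \<and> W \<subseteq> V - K \<and> W \<inter> ({u2} \<union> (B \<union> U)) = {}"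
        using \<open>b \<in> B\<close> by (intro bridge) auto
      then obtain x W y where w: "x = u2" "y \<in> B \<union> U" "y \<in> V - K" "seg x W y" "W \<subseteq> V - K" "W \<inter> ({u2} \<union> (B \<union> U)) = {}" by blast
      obtain z where z: "z \<in> insert u2 W" "adj z y" using seg_last_adj[OF w(4)] w(1) by auto
      \<comment> \<open>All neighbours of \<open>U\<close> lie in \<open>B\<close> or
        \<open>U\<close>, so a path that arrives from outside meets \<open>B\<close> no later than
        it could enter \<open>U\<close>.\<close>
      have "y \<notin> U"
      proof
        assume "y \<in> U"
        from U_nbr[OF this adj_sym[OF z(2)]] have "z \<in> B \<union> U" using nbrB by auto
        then show False using z(1) w(6) dB(1) by auto
      qed
      then have y: "y \<in> B" "y \<in> X - S" using w dB(1) seg_ends[OF w(4)] by (auto simp: X_def K_def)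
      have "W \<subseteq> X - S" using w(5,6) by (auto simp: X_def K_def)
      then show ?thesis using y seg_link[OF w(4)] w(1) by blast
    qed
  qed (use dB(1) neq in \<open>auto simp: X_def card_insert_if\<close>)
  have c4: "card {c, u1, d, u3} = 4" using neq by auto
  have "finite T'" using TH(3) by (metis card.infinite zero_neq_numeral)
  then have "card (T' - {c, u1, d, u3}) = 1" using card_Diff_subset[of "{c, u1, d, u3}" T'] TH(1,3) c4 by simp
  then obtain e where e: "T' - {c, u1, d, u3} = {e}" by (meson card_1_singletonE)
  have eT: "e \<in> T'" "e \<notin> {c, u1, d, u3}" using e by auto
  define Hc Hu Hd Hw He where Hs: "Hc = H c" "Hu = H u1" "Hd = H d" "Hw = H u3" "He = H e"
  have sg: "link u2 Hc c" "link u2 Hu u1" "link u2 Hd d" "link u2 Hw u3" "link u2 He e"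
    using TH(1,4) eT(1) unfolding Hs by (auto intro!: seg_link)
  have HB: "H b \<inter> B = {} \<and> B \<inter> H b = {} \<and> H b \<inter> U = {} \<and> U \<inter> H b = {} \<and> u2 \<notin> H b" if "b \<in> T'" for b
    using TH(4)[OF that] by (auto simp: X_def)
  have "dj [Hc, Hu, Hd, Hw, He, B, U, {u2}]"
    using HB[of c] HB[of u1] HB[of d] HB[of u3] HB[of e] TH(1,5) eT dB(1) neq unfolding Hs by auto
  then have d1: "dj [Hc, Hu, Hd, Hw, He, {c} \<union> A1t \<union> {u1} \<union> {d} \<union> B1t \<union> {u3} \<union> P1 \<union> P3 \<union> T \<union> Q \<union> {r} \<union> {r'}, U, {u2}]"
    unfolding B_def .
  have dA: "dj [Hc, {c}, A1t, Hu, He, Hd \<union> {d} \<union> B1t, Hw, T, P1, {r}, Q, {r'}, P3, U, {u1}, {u2}, {u3}]"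
    using d d1 by (clarsimp simp: Int_Un)
  have dB': "dj [Hd, {d}, B1t, Hw, He, Hc \<union> {c} \<union> A1t, Hu, T, P3, {r'}, Q, {r}, P1, U, {u3}, {u2}, {u1}]"
    using d d1 by (clarsimp simp: Int_Un)
  have T1: "\<forall>x\<in>insert c T. \<exists>q\<in>Q. link x T q" "\<forall>x\<in>insert d T. \<exists>q\<in>Q. link x T q" using T by auto
  have "e \<in> B" using TH(2) eT by auto
  \<comment> \<open>The fifth end lies on the left or on the right half of the picture;
    \<open>T\<close> and \<open>Q\<close> count for both. The right half is the left one in the
    mirrored locale.\<close>
  then have "e \<in> A1t \<union> T \<union> Q \<union> P1 \<union> {r} \<or> e \<in> B1t \<union> T \<union> Q \<union> P3 \<union> {r'}" using eT(2) unfolding B_def by blast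
  then show False
  proof
    assume "e \<in> A1t \<union> T \<union> Q \<union> P1 \<union> {r}"
    from after_fan[OF dA sg(1) l(2) sg(2,5) link_comp[OF sg(3) seg_link[OF l(5)]] sg(4) T1(1) this] show False .
  next
    assume "e \<in> B1t \<union> T \<union> Q \<union> P3 \<union> {r'}"
    from s.after_fan[OF dB' sg(3) l(5) sg(4,5) link_comp[OF sg(1) seg_link[OF l(2)]] sg(2) T1(2) this] show False .
  qed
qed

text \<open>If \<open>Z\<close> ends on an arc of \<open>C2\<close>, then \<open>T\<close> together
  with \<open>Z\<close> links both cycles to \<open>Q\<close>, which is the situation of
  \<open>both_feet\<close>. If it ends on \<open>P3\<close> or in \<open>u3\<close>, then
  \<open>R\<close> can be rerouted over \<open>Z\<close> past \<open>r'\<close> without touching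
  \<open>U\<close>, which contradicts \<open>U_max\<close>.\<close>

lemma foot_exchange:
  assumes d: "dj [A1l, {c}, A1t, A2, B1, B2, T, Z, P1, {r}, Q, {r'}, P3, U, {u1}, {u2}, {u3}]"
    and l: "link u2 A1l c" "seg c A1t u1" "link u2 A2 u1" "seg u2 B1 u3" "seg u2 B2 u3"
    and T: "\<forall>x\<in>insert c T. \<exists>q\<in>Q. link x T q"
    and Z: "y \<in> T \<union> Q" "w \<in> B1 \<union> B2 \<union> P3 \<union> {u3}" "seg y Z w"
  shows False
proof -
  have A1: "link u2 (A1l \<union> {c} \<union> A1t) u1" by (rule link_comp[OF l(1) seg_link[OF l(2)]])
  obtain q where q: "q \<in> Q" "link y T q" using T Z(1) link_refl by blast
  have B: False if b: "w \<in> B" "seg u2 B u3" "seg u2 B' u3"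
    and db: "dj [A1l, {c}, A1t, A2, B, B', T, Z, P1, {r}, Q, {r'}, P3, U, {u1}, {u2}, {u3}]" for B B'
  proof -
    obtain s1 s2 where s: "seg u2 s1 w" "seg w s2 u3" "B = s1 \<union> {w} \<union> s2" "s1 \<inter> s2 = {}" "w \<notin> s1" "w \<notin> s2"
      using seg_split[OF b(2,1)] by metis
    have s': "s2 \<inter> s1 = {}" using s(4) by blast
    have dd: "dj [A1l, {c}, A1t, A2, s1, {w}, s2, B', T \<union> Z, P1, {r}, Q, {r'}, P3, U, {u1}, {u2}, {u3}]"
      using db s(4-6) s' unfolding s(3) by (clarsimp simp: Int_Un)
    have "\<exists>q\<in>Q. link x (T \<union> Z) q" if x: "x \<in> insert c (insert w (T \<union> Z))" for x
    proof (cases "x \<in> insert c T")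
      case True
      then obtain q' where "q' \<in> Q" "link x T q'" using T by blast
      then show ?thesis using link_mono[of x T q' "T \<union> Z"] by blast
    next
      case False
      then have "x \<in> Z \<or> x = w" using x by auto
      then have xy: "link x Z y" using seg_elem(3)[OF Z(3)] link_sym[OF seg_link[OF Z(3)]] by auto
      show ?thesis
      proof (cases "y \<in> T")
        case True
        have "link x (Z \<union> T) q" using link_via[OF xy q(2)] True by auto
        then show ?thesis using q(1) by (auto simp: Un_commute)
      next
        case False
        then show ?thesis using Z(1) link_mono[OF xy, of "T \<union> Z"] by blast
      qed
    qed
    then have TZ: "\<forall>x\<in>insert c (insert w (T \<union> Z)). \<exists>q\<in>Q. link x (T \<union> Z) q" by blast
    from both_feet[OF dd l(1,2,3) seg_link[OF s(1)] s(2) seg_link[OF b(3)] TZ] show False .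
  qed
  consider "w \<in> B1" | "w \<in> B2" | "w \<in> P3 \<union> {u3}" using Z(2) by blast
  then show False
  proof cases
    case 1 show False by (rule B[OF 1 l(4,5) d])
  next
    case 2
    have "dj [A1l, {c}, A1t, A2, B2, B1, T, Z, P1, {r}, Q, {r'}, P3, U, {u1}, {u2}, {u3}]" using d by clarsimp
    then show False by (rule B[OF 2 l(5,4)])
  next
    case 3
    have "link r Q q" using seg_elem(1)[OF seg_Q q(1)] .
    then have ry: "link r (Q \<union> T) y" using link_via[OF _ link_sym[OF q(2)]] q(1) by blast
    have "link y (Z \<union> P3) u3"
    proof (cases "w = u3")
      case True then show ?thesis using link_mono[OF seg_link[OF Z(3)], of "Z \<union> P3"] by simp
    next
      case False
      then have "w \<in> P3" using 3 by simp
      then show ?thesis using link_via[OF seg_link[OF Z(3)] seg_elem(2)[OF seg_P3]] by blast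
    qed
    then have R: "link u1 (P1 \<union> {r} \<union> ((Q \<union> T) \<union> (Z \<union> P3))) u3"
      using link_comp[OF seg_link[OF seg_P1] link_via[OF ry]] Z(1) by blast
    have dd: "dj [A1l \<union> {c} \<union> A1t, A2, B1, B2, P1 \<union> {r} \<union> ((Q \<union> T) \<union> (Z \<union> P3)), U, {u1}, {u2}, {u3}]"
      using d by (clarsimp simp: Int_Un)
    have "r' \<notin> A1l \<union> {c} \<union> A1t \<union> A2 \<union> B1 \<union> B2 \<union> (P1 \<union> {r} \<union> ((Q \<union> T) \<union> (Z \<union> P3)))"
      using d by (clarsimp simp: Int_Un)
    moreover have "r' \<in> A1l \<union> {c} \<union> A1t \<union> A2 \<union> B1 \<union> B2 \<union> (P1 \<union> {r} \<union> ((Q \<union> T) \<union> (Z \<union> P3)))"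
      using U_max[OF A1 l(3) seg_link[OF l(4)] seg_link[OF l(5)] R dd] by simp
    ultimately show False by contradiction
  qed
qed

end

section \<open>A single path from \<open>Q\<close> to the cycle through \<open>u1\<close>\<close>

context kite_hull begin

text \<open>\<open>U\<close> is entered through \<open>r\<close> when coming from \<open>P1\<close>,
  and through \<open>r'\<close> when coming from \<open>Q\<close> or \<open>T\<close>.\<close>

lemma reach_u4:
  assumes "\<forall>x\<in>T. \<exists>q\<in>Q. link x T q" "e \<in> P1 \<union> {r} \<union> T \<union> Q"
  shows "link e (P1 \<union> {r} \<union> T \<union> Q \<union> {r'} \<union> U) u4"
proof -
  have Qe: "link q (Q \<union> {r'} \<union> U) u4" if "q \<in> Q" for q by (rule link_comp[OF seg_elem(2)[OF seg_Q that] U_link_r(2)])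
  consider "e \<in> P1" | "e = r" | "e \<in> T" | "e \<in> Q" using assms(2) by blast
  then show ?thesis
  proof cases
    case 1 show ?thesis by (rule link_mono[OF link_comp[OF seg_elem(2)[OF seg_P1 1] U_link_r(1)]]) auto
  next
    case 2 show ?thesis unfolding 2 by (rule link_mono[OF U_link_r(1)]) auto
  next
    case 3
    then obtain q where q: "q \<in> Q" "link e T q" using assms(1) by blast
    show ?thesis by (rule link_mono[OF link_comp[OF q(2) Qe[OF q(1)]]]) (use q in auto)
  next
    case 4 show ?thesis by (rule link_mono[OF Qe[OF 4]]) auto
  qed
qed

text \<open>This lemma and the next two serve the three ends \<open>e\<close>, \<open>c\<close>,
  \<open>u1\<close> of the fan in \<open>one_foot\<close>. The path at one end comes from the side
  of \<open>C2\<close> and becomes \<open>Y\<close>, on the way from \<open>u1\<close> to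
  \<open>u3\<close>; the other two paths leave \<open>u2\<close> and yield the side from
  \<open>u2\<close> to \<open>u1\<close> and the pendant path. Here \<open>Hu\<close> is that side,
  and the pendant path goes over \<open>c\<close>, \<open>T\<close>, \<open>Q\<close> and
  \<open>r'\<close> into \<open>U\<close>.\<close>

lemma kite_e_left:
  assumes d: "dj [Hc, {c}, A1t, Hu, T, Y, Y', P1, {r}, Q, {r'}, U, {u1}, {u2}, {u3}]"
    and l: "link u2 Hc c" "seg c A1t u1" "link u2 Hu u1"
    and T: "q \<in> Q" "link c T q" and e: "e \<in> A1t \<union> P1 \<union> {r}" and Y: "link e Y u3" "link u3 Y' u2"
  shows False
proof -
  have "link u1 (A1t \<union> P1 \<union> {r}) e"
  proof -
    consider "e \<in> A1t" | "e \<in> P1" | "e = r" using e by blast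
    then show ?thesis
    proof cases
      case 1 show ?thesis by (rule link_mono[OF seg_elem(4)[OF l(2) 1]]) auto
    next
      case 2 show ?thesis by (rule link_mono[OF seg_elem(1)[OF seg_P1 2]]) auto
    next
      case 3 show ?thesis unfolding 3 by (rule link_mono[OF seg_link[OF seg_P1]]) auto
    qed
  qed
  from link_via[OF this Y(1)] have R: "link u1 (A1t \<union> P1 \<union> {r} \<union> Y) u3" using e by auto
  have "link q (Q \<union> {r'} \<union> U) u4" by (rule link_comp[OF seg_elem(2)[OF seg_Q T(1)] U_link_r(2)])
  from link_via[OF T(2) this] have "link c (T \<union> (Q \<union> {r'} \<union> U)) u4" using T(1) by auto
  from link_comp[OF l(1) this] have S: "link u2 (Hc \<union> {c} \<union> (T \<union> (Q \<union> {r'} \<union> U))) u4" .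
  show False
  proof (rule no_kite[OF l(3) R Y(2) S])
    show "u4 \<in> Hc \<union> {c} \<union> (T \<union> (Q \<union> {r'} \<union> U))" using u4U by simp
    show "dj [Hu, A1t \<union> P1 \<union> {r} \<union> Y, Y', Hc \<union> {c} \<union> (T \<union> (Q \<union> {r'} \<union> U)), {u1}, {u2}, {u3}]"
      using d by (clarsimp simp: Int_Un)
  qed
qed

text \<open>Now \<open>c\<close> is joined to \<open>u3\<close>, so \<open>A1t\<close> belongs to
  the way from \<open>u1\<close> to \<open>u3\<close>, and \<open>He\<close> must provide the
  pendant path.\<close>

lemma kite_c_left:
  assumes d: "dj [{c}, A1t, Hu, He, T, Y, Y', P1, {r}, Q, {r'}, U, {u1}, {u2}, {u3}]"
    and l: "seg c A1t u1" "link u2 Hu u1" "link u2 He e"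
    and T: "\<forall>x\<in>T. \<exists>q\<in>Q. link x T q" and e: "e \<in> P1 \<union> {r} \<union> T \<union> Q" and Y: "link c Y u3" "link u3 Y' u2"
  shows False
proof -
  have R: "link u1 (A1t \<union> {c} \<union> Y) u3" by (rule link_comp[OF link_sym[OF seg_link[OF l(1)]] Y(1)])
  have S: "link u2 (He \<union> (P1 \<union> {r} \<union> T \<union> Q \<union> {r'} \<union> U)) u4"
    by (rule link_via[OF l(3) reach_u4[OF T e]]) (use e in auto)
  show False
  proof (rule no_kite[OF l(2) R Y(2) S])
    show "u4 \<in> He \<union> (P1 \<union> {r} \<union> T \<union> Q \<union> {r'} \<union> U)" using u4U by simp
    show "dj [Hu, A1t \<union> {c} \<union> Y, Y', He \<union> (P1 \<union> {r} \<union> T \<union> Q \<union> {r'} \<union> U), {u1}, {u2}, {u3}]"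
      using d by (clarsimp simp: Int_Un)
  qed
qed

text \<open>Now \<open>u1\<close> is joined to \<open>u3\<close> directly by \<open>Y\<close>, so
  the side from \<open>u2\<close> to \<open>u1\<close> has to run over \<open>A1t\<close>. If
  \<open>e\<close> lies there, \<open>He\<close> enters the side and \<open>Hc\<close> is pendant
  over \<open>T\<close>; otherwise the roles are exchanged.\<close>

lemma kite_u1_left:
  assumes d: "dj [Hc, {c}, A1t, He, T, Y, Y', P1, {r}, Q, {r'}, U, {u1}, {u2}, {u3}]"
    and l: "link u2 Hc c" "seg c A1t u1" "link u2 He e"
    and T: "\<forall>x\<in>insert c T. \<exists>q\<in>Q. link x T q" and e: "e \<in> A1t \<union> P1 \<union> {r} \<union> T \<union> Q"
    and Y: "link u1 Y u3" "link u3 Y' u2"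
  shows False
proof (cases "e \<in> A1t")
  case True
  obtain q where q: "q \<in> Q" "link c T q" using T by blast
  have L: "link u2 (He \<union> A1t) u1" by (rule link_via[OF l(3) seg_elem(2)[OF l(2) True]]) (use True in auto)
  have "link q (Q \<union> {r'} \<union> U) u4" by (rule link_comp[OF seg_elem(2)[OF seg_Q q(1)] U_link_r(2)])
  from link_via[OF q(2) this] have "link c (T \<union> (Q \<union> {r'} \<union> U)) u4" using q(1) by auto
  from link_comp[OF l(1) this] have S: "link u2 (Hc \<union> {c} \<union> (T \<union> (Q \<union> {r'} \<union> U))) u4" .
  show False
  proof (rule no_kite[OF L Y S])
    show "u4 \<in> Hc \<union> {c} \<union> (T \<union> (Q \<union> {r'} \<union> U))" using u4U by simp
    show "dj [He \<union> A1t, Y, Y', Hc \<union> {c} \<union> (T \<union> (Q \<union> {r'} \<union> U)), {u1}, {u2}, {u3}]"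
      using d by (clarsimp simp: Int_Un)
  qed
next
  case False
  then have e': "e \<in> P1 \<union> {r} \<union> T \<union> Q" using e by auto
  have L: "link u2 (Hc \<union> {c} \<union> A1t) u1" by (rule link_comp[OF l(1) seg_link[OF l(2)]])
  have "\<forall>x\<in>T. \<exists>q\<in>Q. link x T q" using T by blast
  from link_via[OF l(3) reach_u4[OF this e']] have S: "link u2 (He \<union> (P1 \<union> {r} \<union> T \<union> Q \<union> {r'} \<union> U)) u4" using e' by auto
  show False
  proof (rule no_kite[OF L Y S])
    show "u4 \<in> He \<union> (P1 \<union> {r} \<union> T \<union> Q \<union> {r'} \<union> U)" using u4U by simp
    show "dj [Hc \<union> {c} \<union> A1t, Y, Y', He \<union> (P1 \<union> {r} \<union> T \<union> Q \<union> {r'} \<union> U), {u1}, {u2}, {u3}]"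
      using d by (clarsimp simp: Int_Un)
  qed
qed

text \<open>
  Three disjoint paths from \<open>u2\<close> and the component \<open>D\<close> of \<open>C2 - u2\<close> end in \<open>c\<close>, \<open>u1\<close> and \<open>e\<close>. As the
  old starting vertices are kept, at most one of them starts at \<open>D\<close>.
\<close>
lemma one_foot:
  assumes d: "dj [A1l, {c}, A1t, A2, B1, B2, T, P1, {r}, Q, {r'}, P3, U, {u1}, {u2}, {u3}]"
    and l: "link u2 A1l c" "seg c A1t u1" "link u2 A2 u1" "seg u2 B1 u3" "seg u2 B2 u3"
    and T: "\<forall>x\<in>insert c T. \<exists>q\<in>Q. link x T q"
  shows False
proof -
  define B where "B = {c} \<union> A1t \<union> {u1} \<union> P1 \<union> {r} \<union> T \<union> Q"
  \<comment> \<open>\<open>W\<close> contains \<open>r'\<close> and \<open>U\<close>, so that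
    \<open>D\<close> cannot absorb them. It leaves out \<open>P3\<close>, hence \<open>D\<close>
    contains \<open>P3\<close> as well as both arcs of \<open>C2\<close>.\<close>
  define W where "W = {u2} \<union> A1l \<union> A2 \<union> B \<union> {r'} \<union> U"
  define D where "D = {v. conn (V - W) u3 v}"
  define C where "C = {u3} \<union> B1 \<union> B2 \<union> P3"
  have dC: "C \<inter> W = {}" using d unfolding C_def W_def B_def by (clarsimp simp: Int_Un)
  have dB: "dj [A1l, A2, B, {r'}, U, {u2}, {u3}]" using d unfolding B_def by (clarsimp simp: Int_Un)
  have neq: "c \<noteq> u1" "c \<noteq> r" "u1 \<noteq> r" "r' \<noteq> u3" "c \<noteq> u2" using d by auto
  have CV: "C \<subseteq> V" using seg_V[OF l(4)] seg_V[OF l(5)] seg_V[OF seg_P3] by (auto simp: C_def)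
  have CD: "C \<subseteq> D"
  proof
    fix x assume x: "x \<in> C"
    have "link u3 C x"
    proof -
      consider "x = u3" | "x \<in> B1" | "x \<in> B2" | "x \<in> P3" using x by (auto simp: C_def)
      then show ?thesis
      proof cases
        case 1 then show ?thesis by (simp add: link_refl)
      next
        case 2 show ?thesis by (rule link_mono[OF seg_elem(4)[OF l(4) 2]]) (auto simp: C_def)
      next
        case 3 show ?thesis by (rule link_mono[OF seg_elem(4)[OF l(5) 3]]) (auto simp: C_def)
      next
        case 4 show ?thesis by (rule link_mono[OF seg_elem(4)[OF seg_P3 4]]) (auto simp: C_def)
      qed
    qed
    from link_conn[OF this, of "V - W"] show "x \<in> D" using x CV dC by (auto simp: D_def C_def)
  qed
  have DW: "D \<subseteq> V - W" using conn_mem by (auto simp: D_def)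
  have u3D: "u3 \<in> D" using CD by (auto simp: C_def)
  have D_conn: "conn D u3 v" if "v \<in> D" for v using conn_component[of "V - W" u3 v] that by (simp add: D_def)
  \<comment> \<open>A neighbour of \<open>D\<close> reaches \<open>u3\<close> inside
    \<open>D\<close>; the first vertex in \<open>C\<close> on this way tells where it lands, and
    before it only vertices of \<open>D - C\<close> are used.\<close>
  have landing: "\<exists>Z w. seg y Z w \<and> Z \<subseteq> D - C \<and> w \<in> C" if y: "z \<in> D" "adj z y" "y \<notin> D" for y z
  proof -
    have "conn (insert y D) y z" using y adj_sym by (intro conn_step) auto
    moreover have "conn (insert y D) z u3" by (rule conn_mono[OF conn_sym[OF D_conn[OF y(1)]]]) auto
    ultimately have "conn (insert y D) y u3" by (rule conn_trans)
    then have "\<exists>x Z w. x \<in> {y} \<and> x \<in> insert y D \<and> w \<in> C \<and> w \<in> insert y D \<and> seg x Z w \<and> Z \<subseteq> insert y D \<and> Z \<inter> ({y} \<union> C) = {}"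
      using y(3) CD by (intro bridge) (auto simp: C_def)
    then obtain x Z w where "x = y" "w \<in> C" "seg x Z w" "Z \<subseteq> insert y D" "Z \<inter> ({y} \<union> C) = {}" by blast
    then show ?thesis by (intro exI[of _ Z] exI[of _ w]) auto
  qed
  define X where "X = - (D \<union> {u2, r'} \<union> U)"
  define A where "A = {x \<in> X. adj u2 x \<or> (\<exists>z\<in>D. adj z x)}"
  have BX: "B \<subseteq> X" "A1l \<union> A2 \<subseteq> X" using dB DW unfolding X_def W_def by auto
  obtain g1 where g1: "is_path adj g1" "adj u2 (hd g1)" "last g1 = c" "set g1 \<subseteq> insert c (A1l - {u2})" "set (butlast g1) \<subseteq> A1l - {u2, c}"
    using link_tl[OF l(1)] neq by metis
  have "u2 \<noteq> u1" using dist by auto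
  then obtain g2 where g2: "is_path adj g2" "adj u2 (hd g2)" "last g2 = u1" "set g2 \<subseteq> insert u1 (A2 - {u2})" "set (butlast g2) \<subseteq> A2 - {u2, u1}"
    using link_tl[OF l(3)] by metis
  define g where "g = (\<lambda>b. if b = c then g1 else g2)"
  have gg: "g c = g1" "g u1 = g2" using neq by (auto simp: g_def)
  have cB: "c \<in> B" "u1 \<in> B" "r \<in> B" by (auto simp: B_def)
  have hdin: "hd p \<in> set p" if "is_path adj p" for p using that by (simp add: is_path_def)
  have gX: "set g1 \<subseteq> X" "set g2 \<subseteq> X" using g1(4) g2(4) BX cB by auto
  have g12: "set g1 \<inter> set g2 = {}"
  proof -
    have "A1l \<inter> A2 = {}" "c \<notin> A2" "u1 \<notin> A1l" using d by auto
    then show ?thesis using g1(4) g2(4) neq(1) by auto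
  qed
  obtain T' h where TH: "{c, u1} \<subseteq> T'" "T' \<subseteq> B" "card T' = 3"
    "\<And>b. b \<in> T' \<Longrightarrow> is_path adj (h b) \<and> set (h b) \<subseteq> X \<and> hd (h b) \<in> A \<and> last (h b) = b \<and> set (butlast (h b)) \<inter> B = {}"
    "\<And>b b'. b \<in> T' \<Longrightarrow> b' \<in> T' \<Longrightarrow> b \<noteq> b' \<Longrightarrow> set (h b) \<inter> set (h b') = {}"
    "(\<lambda>b. hd (g b)) ` {c, u1} \<subseteq> (\<lambda>b. hd (h b)) ` T'"
  proof (rule fan[of "{c, u1}" 3 A X g B])
    show "A \<subseteq> X" by (auto simp: A_def)
    show "is_path adj (g b) \<and> set (g b) \<subseteq> X \<and> hd (g b) \<in> A \<and> last (g b) = b \<and> b \<in> B \<and> set (butlast (g b)) \<inter> B = {}" if b: "b \<in> {c, u1}" for b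
    proof -
      have "A1l \<inter> B = {}" "A2 \<inter> B = {}" using dB by auto
      then have bl: "set (butlast g1) \<inter> B = {}" "set (butlast g2) \<inter> B = {}" using g1(5) g2(5) by auto
      have "hd g1 \<in> A" "hd g2 \<in> A" using hdin[OF g1(1)] hdin[OF g2(1)] gX g1(2) g2(2) by (auto simp: A_def)
      then show ?thesis using b gg g1(1,3) g2(1,3) gX cB bl by auto
    qed
    show "set (g b) \<inter> set (g b') = {}" if "b \<in> {c, u1}" "b' \<in> {c, u1}" "b \<noteq> b'" for b b'
      using that g12 gg by auto
    show "\<exists>p. is_path adj p \<and> set p \<subseteq> X \<and> hd p \<in> A \<and> last p \<in> B \<and> set p \<inter> S = {}" if S: "finite S" "card S < 3" for S
    proof -
      \<comment> \<open>Of the possible neighbours of \<open>U\<close>, only \<open>r'\<close> and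
        \<open>u3\<close> are outside \<open>B\<close> and \<open>U\<close>. Deleting both forces a
        path from \<open>u2\<close> or \<open>D\<close> to meet \<open>B\<close> before
        \<open>U\<close>; with at most two vertices of \<open>S\<close> this stays within the budget
        of 5.\<close>
      define K where "K = (S \<inter> X) \<union> {r', u3}"
      have "card (S \<inter> X) \<le> 2" using card_mono[of S "S \<inter> X"] S by auto
      moreover have "card {r', u3} \<le> 2" by (simp add: card_insert_if)
      ultimately have "card K \<le> 5" using card_Un_le[of "S \<inter> X" "{r', u3}"] unfolding K_def by linarith
      moreover have "finite K" using S by (simp add: K_def)
      ultimately have K: "finite K" "card K \<le> 5" by simp_all
      have "card {c, u1, r} = 3" using neq by auto
      then have "\<not> {c, u1, r} \<subseteq> S" using card_mono[OF S(1), of "{c, u1, r}"] S(2) by auto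
      then obtain b where b: "b \<in> {c, u1, r}" "b \<notin> S" by blast
      have bV: "b \<in> V" using b link_V[OF l(1)] neq seg_V[OF seg_P1] uV by auto
      have bB: "b \<in> B" using b cB by auto
      have "b \<notin> K" using b(2) bB dB unfolding K_def by auto
      moreover have "u2 \<notin> K" using dB d unfolding K_def X_def by auto
      ultimately have "conn (V - K) u2 b" using connected_minus_5[OF K] bV uV by auto
      moreover have "(insert u2 D) \<inter> (B \<union> U) = {}" using DW dB unfolding W_def by auto
      ultimately have "\<exists>x Z y. x \<in> insert u2 D \<and> x \<in> V - K \<and> y \<in> B \<union> U \<and> y \<in> V - K \<and> seg x Z y \<and> Z \<subseteq> V - K \<and> Z \<inter> (insert u2 D \<union> (B \<union> U)) = {}"
        using bB by (intro bridge) auto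
      then obtain x Z y where w: "x \<in> insert u2 D" "x \<in> V - K" "y \<in> B \<union> U" "y \<in> V - K" "seg x Z y" "Z \<subseteq> V - K"
        "Z \<inter> (insert u2 D \<union> (B \<union> U)) = {}" by blast
      have "y \<notin> U"
      proof
        assume yU: "y \<in> U"
        obtain z where z: "z \<in> insert x Z" "adj z y" using seg_last_adj[OF w(5)] by auto
        have "z \<in> V - K" using z(1) w(2,6) by auto
        then have "z \<noteq> r'" "z \<noteq> u3" by (auto simp: K_def)
        then have "z \<in> B \<union> U" using U_nbr[OF yU adj_sym[OF z(2)]] by (auto simp: B_def)
        moreover have "z \<notin> B \<union> U" using z(1) w(1,7) \<open>insert u2 D \<inter> (B \<union> U) = {}\<close> by auto
        ultimately show False by simp
      qed
      then have yB: "y \<in> B" using w(3) by auto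
      have xy: "x \<noteq> y" using seg_ends[OF w(5)] by simp
      obtain p where p: "is_path adj p" "adj x (hd p)" "last p = y" "set p \<subseteq> insert y (Z - {x})"
        using link_tl[OF seg_link[OF w(5)] xy] by metis
      have ZX: "Z \<subseteq> X" using w(6,7) unfolding X_def K_def by auto
      have pX: "set p \<subseteq> X" using p(4) ZX yB BX by auto
      moreover have "hd p \<in> A" using hdin[OF p(1)] pX p(2) w(1) by (auto simp: A_def)
      moreover have "set p \<inter> S = {}"
      proof -
        have "set p \<subseteq> V - K" using p(4) w(4,6) by auto
        then show ?thesis using pX unfolding K_def by auto
      qed
      ultimately show ?thesis using p(1,3) yB by auto
    qed
  qed (use neq in auto)
  have "finite T'" using TH(3) by (metis card.infinite zero_neq_numeral)
  then have "card (T' - {c, u1}) = 1" using card_Diff_subset[of "{c, u1}" T'] TH(1,3) neq by simp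
  then obtain e where e: "T' - {c, u1} = {e}" by (meson card_1_singletonE)
  have eT: "e \<in> T'" "e \<noteq> c" "e \<noteq> u1" and T'e: "T' = {c, u1, e}" using e TH(1) by auto
  define H where "H = (\<lambda>b. set (butlast (h b)))"
  define Hc Hu He where Hs: "Hc = H c" "Hu = H u1" "He = H e"
  have setH: "set (h b) = insert b (H b)" if "b \<in> T'" for b
    using TH(4)[OF that] set_last_butlast[of "h b"] unfolding H_def is_path_def by auto
  have HB: "H b \<inter> B = {}" "H b \<subseteq> X" if "b \<in> T'" for b
    using TH(4)[OF that] setH[OF that] unfolding H_def by auto
  have HH: "H b \<inter> H b' = {}" if "b \<in> T'" "b' \<in> T'" "b \<noteq> b'" for b b'
    using TH(5)[OF that] setH that by auto
  have dH: "dj [Hc, Hu, He, B, D, U, {u2}, {r'}]"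
  proof -
    have 1: "H b \<inter> B = {} \<and> B \<inter> H b = {} \<and> H b \<inter> D = {} \<and> D \<inter> H b = {} \<and> H b \<inter> U = {} \<and> U \<inter> H b = {} \<and> u2 \<notin> H b \<and> r' \<notin> H b" if "b \<in> T'" for b
      using HB[OF that] unfolding X_def by auto
    have 2: "dj [B, D, U, {u2}, {r'}]" using DW dB unfolding W_def by auto
    show ?thesis using 1[of c] 1[of u1] 1[OF eT(1)] HH[of c u1] HH[of c e] HH[of u1 e] HH[of u1 c] HH[of e c] HH[of e u1] TH(1) eT neq 2
      unfolding Hs by auto
  qed
  have two: "link u2 (H b) b" if "b \<in> T'" "adj u2 (hd (h b))" for b
    using path_link[of "h b" u2] TH(4)[OF that(1)] that(2) unfolding H_def by auto
  have hd_link: "link b (H b) (hd (h b))" "hd (h b) \<in> insert b (H b)" if "b \<in> T'" for b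
  proof -
    have p: "is_path adj (h b)" "last (h b) = b" using TH(4)[OF that] by auto
    show "hd (h b) \<in> insert b (H b)" using hdin[OF p(1)] setH[OF that] by simp
    have "conn (set (h b)) (hd (h b)) (last (h b))" using is_path_conn[OF p(1)] by simp
    then have "conn (insert b (H b)) (hd (h b)) b" using setH[OF that] p(2) by simp
    from conn_sym[OF this] show "link b (H b) (hd (h b))"
      unfolding link_def by (rule conn_mono) auto
  qed
  have three: "\<exists>Z w. seg b Z w \<and> Z \<subseteq> H b \<union> (D - C) \<and> w \<in> C" if b: "b \<in> T'" and z: "z \<in> D" "adj z (hd (h b))" for b z
  proof -
    have "hd (h b) \<notin> D" using TH(4)[OF b] unfolding A_def X_def by auto
    from landing[OF z this] obtain Z w where Z: "seg (hd (h b)) Z w" "Z \<subseteq> D - C" "w \<in> C" by blast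
    have "link b (H b \<union> Z) w"
    proof (cases "hd (h b) \<in> H b")
      case True
      then show ?thesis using link_via[OF hd_link(1)[OF b] seg_link[OF Z(1)]] by auto
    next
      case False
      then have "hd (h b) = b" using hd_link(2)[OF b] by simp
      then show ?thesis using link_mono[OF seg_link[OF Z(1)], of "H b \<union> Z"] by auto
    qed
    moreover have "b \<noteq> w" using Z(3) CD DW b TH(2) unfolding W_def by auto
    ultimately obtain Z' where "seg b Z' w" "Z' \<subseteq> H b \<union> Z" by (rule link_seg)
    then show ?thesis using Z by (intro exI[of _ Z'] exI[of _ w]) auto
  qed
  have three': "\<exists>Y Y' E. link b Y u3 \<and> link u3 Y' u2 \<and> Y \<subseteq> H b \<union> E \<and> Y' \<subseteq> D - {u3} \<and> E \<subseteq> D - {u3} - Y'"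
    if b: "b \<in> T'" and z: "z \<in> D" "adj z (hd (h b))" for b z
  proof -
    from three[OF b z] obtain Z w where Z: "seg b Z w" "Z \<subseteq> H b \<union> (D - C)" "w \<in> C" by blast
    have sub: "B1 \<subseteq> C" "B2 \<subseteq> C" "P3 \<subseteq> C" "u3 \<in> C" "B1 \<inter> B2 = {}" "B1 \<inter> P3 = {}" "u3 \<notin> B1" "u3 \<notin> B2" "u3 \<notin> P3"
      using d by (auto simp: C_def)
    have arm: "\<exists>Y Y' E. link b Y u3 \<and> link u3 Y' u2 \<and> Y \<subseteq> H b \<union> E \<and> Y' \<subseteq> D - {u3} \<and> E \<subseteq> D - {u3} - Y'"
      if "w \<in> insert u3 F" "\<And>x. x \<in> F \<Longrightarrow> link x F u3" "F \<subseteq> C - {u3}" "link u3 Y' u2" "Y' \<subseteq> C - {u3} - F" for F Y'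
    proof -
      have "link b (Z \<union> F) u3"
      proof (cases "w = u3")
        case True then show ?thesis using link_mono[OF seg_link[OF Z(1)], of "Z \<union> F"] by simp
      next
        case False
        then have "w \<in> F" using that(1) by simp
        then show ?thesis using link_via[OF seg_link[OF Z(1)] that(2)] by blast
      qed
      moreover have "Z \<union> F \<subseteq> H b \<union> (D - {u3} - Y')" using Z(2) that(3,5) CD sub(4) by auto
      moreover have "Y' \<subseteq> D - {u3}" using that(5) CD by auto
      ultimately show ?thesis using that(4)
        by (intro exI[of _ "Z \<union> F"] exI[of _ Y'] exI[of _ "D - {u3} - Y'"]) simp
    qed
    consider "w \<in> B1" | "w \<in> B2" | "w \<in> insert u3 P3" using Z(3) by (auto simp: C_def)
    then show ?thesis
    proof cases
      case 1 show ?thesis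
        by (rule arm[of B1 B2]) (use 1 seg_elem(2)[OF l(4)] link_sym[OF seg_link[OF l(5)]] sub in auto)
    next
      case 2 show ?thesis
        by (rule arm[of B2 B1]) (use 2 seg_elem(2)[OF l(5)] link_sym[OF seg_link[OF l(4)]] sub in auto)
    next
      case 3 show ?thesis
        by (rule arm[of P3 B1]) (use 3 seg_elem(2)[OF seg_P3] link_sym[OF seg_link[OF l(4)]] sub in auto)
    qed
  qed
  have dB2: "dj [{c}, A1t, {u1}, P1, {r}, T, Q]" using d by (clarsimp simp: Int_Un)
  have dH': "dj [Hc, Hu, He, {c} \<union> A1t \<union> {u1} \<union> P1 \<union> {r} \<union> T \<union> Q, D, U, {u2}, {r'}]" using dH unfolding B_def .
  have dCC: "dj [B1, B2, P3, {u3}]" using d by (clarsimp simp: Int_Un)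
  have dK: "dj [Hc, Hu, He, Y, Y', {u3}, {c}, A1t, T, P1, {r}, Q, {r'}, U, {u1}, {u2}]" if "Y \<subseteq> D - {u3} - Y'" "Y' \<subseteq> D - {u3}" for Y Y'
  proof -
    \<comment> \<open>The remainder turns \<open>D\<close> into an explicit union, so that
      disjointness from \<open>D\<close> is inherited by its pieces through simplification.\<close>
    define Dr where "Dr = D - {u3} - Y - Y'"
    have D: "D = Y \<union> Y' \<union> {u3} \<union> Dr" using that u3D by (auto simp: Dr_def)
    have "dj [Y, Y', {u3}]" using that by auto
    then show ?thesis using dH' dB2 unfolding D by (clarsimp simp: Int_Un)
  qed
  have dZ: "dj [Hc, Hu, He, Z, B1, B2, P3, {u3}, {c}, A1t, T, P1, {r}, Q, {r'}, U, {u1}, {u2}]" if "Z \<subseteq> D - C" for Z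
  proof -
    define Dr where "Dr = D - C - Z"
    have D: "D = Z \<union> ({u3} \<union> B1 \<union> B2 \<union> P3) \<union> Dr" using that CD by (auto simp: Dr_def C_def)
    have "dj [Z, {u3} \<union> B1 \<union> B2 \<union> P3]" using that unfolding C_def by auto
    then show ?thesis using dH' dB2 dCC unfolding D by (clarsimp simp: Int_Un)
  qed
  obtain q where q: "q \<in> Q" "link c T q" using T by blast
  have TT: "\<forall>x\<in>T. \<exists>q\<in>Q. link x T q" using T by blast
  have eB: "e \<in> A1t \<union> P1 \<union> {r} \<union> T \<union> Q" using TH(2) eT unfolding B_def by auto
  have A2or3: "adj u2 (hd (h b)) \<or> (\<exists>z\<in>D. adj z (hd (h b)))" if "b \<in> T'" for b
    using TH(4)[OF that] by (auto simp: A_def)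
  have twoof: "\<exists>b\<in>T'. \<exists>b'\<in>T'. b \<noteq> b' \<and> adj u2 (hd (h b)) \<and> adj u2 (hd (h b'))"
  proof -
    obtain b where b: "b \<in> T'" "hd (h b) = hd g1" using TH(6) gg by force
    obtain b' where b': "b' \<in> T'" "hd (h b') = hd g2" using TH(6) gg by force
    have "hd g1 \<noteq> hd g2" using hdin[OF g1(1)] hdin[OF g2(1)] g12 by auto
    then show ?thesis using b b' g1(2) g2(2) by metis
  qed
  have cT: "c \<in> T'" "u1 \<in> T'" using TH(1) by auto
  consider (all) "adj u2 (hd (h c))" "adj u2 (hd (h u1))" "adj u2 (hd (h e))"
    | (e) z where "adj u2 (hd (h c))" "adj u2 (hd (h u1))" "z \<in> D" "adj z (hd (h e))"
    | (c) z where "adj u2 (hd (h e))" "adj u2 (hd (h u1))" "z \<in> D" "adj z (hd (h c))"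
    | (u) z where "adj u2 (hd (h c))" "adj u2 (hd (h e))" "z \<in> D" "adj z (hd (h u1))"
    using twoof A2or3[OF cT(1)] A2or3[OF cT(2)] A2or3[OF eT(1)] unfolding T'e by auto
  then show False
  proof cases
    case all
    have "dj [Hc, {c}, A1t, Hu, He, B1, B2, T, P1, {r}, Q, {r'}, P3, U, {u1}, {u2}, {u3}]"
      using dZ[of "{}"] by clarsimp
    note dd = this
    have lk: "link u2 Hc c" "link u2 Hu u1" "link u2 He e"
      using two[OF cT(1) all(1)] two[OF cT(2) all(2)] two[OF eT(1) all(3)] unfolding Hs by auto
    have "e \<in> A1t \<union> T \<union> Q \<union> P1 \<union> {r}" using eB by auto
    from after_fan[OF dd lk(1) l(2) lk(2,3) seg_link[OF l(4)] seg_link[OF l(5)] T this] show False .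
  next
    case e
    have lk: "link u2 Hc c" "link u2 Hu u1" using two[OF cT(1) e(1)] two[OF cT(2) e(2)] unfolding Hs by auto
    show False
    proof (cases "e \<in> T \<union> Q")
      case True
      obtain Z w where Z: "seg e Z w" "Z \<subseteq> He \<union> (D - C)" "w \<in> C" using three[OF eT(1) e(3,4)] unfolding Hs by blast
      have "dj [Hc, {c}, A1t, Hu, B1, B2, T, He \<union> (D - C), P1, {r}, Q, {r'}, P3, U, {u1}, {u2}, {u3}]"
        using dZ[OF subset_refl] by (clarsimp simp: Int_Un)
      then have "dj [Hc, {c}, A1t, Hu, B1, B2, T, Z, P1, {r}, Q, {r'}, P3, U, {u1}, {u2}, {u3}]"
        by (rule dj_mono) (use Z(2) in simp)
      moreover have "w \<in> B1 \<union> B2 \<union> P3 \<union> {u3}" using Z(3) unfolding C_def by blast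
      ultimately show False by (rule foot_exchange[OF _ lk(1) l(2) lk(2) l(4,5) T True _ Z(1)])
    next
      case False
      then have e': "e \<in> A1t \<union> P1 \<union> {r}" using eB by auto
      obtain Y Y' E where Y: "link e Y u3" "link u3 Y' u2" "Y \<subseteq> He \<union> E" "Y' \<subseteq> D - {u3}" "E \<subseteq> D - {u3} - Y'"
        using three'[OF eT(1) e(3,4)] unfolding Hs by blast
      have "dj [Hc, {c}, A1t, Hu, T, He \<union> E, Y', P1, {r}, Q, {r'}, U, {u1}, {u2}, {u3}]"
        using dK[OF Y(5,4)] by (clarsimp simp: Int_Un)
      then have "dj [Hc, {c}, A1t, Hu, T, Y, Y', P1, {r}, Q, {r'}, U, {u1}, {u2}, {u3}]"
        by (rule dj_mono) (use Y(3) in simp)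
      from kite_e_left[OF this lk(1) l(2) lk(2) q e' Y(1,2)] show False .
    qed
  next
    case c
    have lk: "link u2 He e" "link u2 Hu u1" using two[OF eT(1) c(1)] two[OF cT(2) c(2)] unfolding Hs by auto
    show False
    proof (cases "e \<in> A1t")
      case True
      \<comment> \<open>Here \<open>c\<close> and \<open>e\<close> exchange roles: \<open>He\<close>
        makes \<open>e\<close> the foot on \<open>C1\<close>, and the stretch from \<open>e\<close>
        back to \<open>c\<close> is added to \<open>T\<close>. The path from \<open>D\<close>, which
        ends in \<open>c\<close>, then ends on this larger \<open>T\<close>.\<close>
      then obtain s1 s2 where s: "seg c s1 e" "seg e s2 u1" "A1t = s1 \<union> {e} \<union> s2" "s1 \<inter> s2 = {}" "e \<notin> s1" "e \<notin> s2"
        using seg_split[OF l(2)] by metis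
      have s': "s2 \<inter> s1 = {}" using s(4) by blast
      obtain Z w where Z: "seg c Z w" "Z \<subseteq> Hc \<union> (D - C)" "w \<in> C" using three[OF cT(1) c(3,4)] unfolding Hs by blast
      have "dj [He, {e}, s2, Hu, B1, B2, s1 \<union> {c} \<union> T, Hc \<union> (D - C), P1, {r}, Q, {r'}, P3, U, {u1}, {u2}, {u3}]"
        using dZ[OF subset_refl] s(4-6) s' unfolding s(3) by (clarsimp simp: Int_Un)
      then have dd: "dj [He, {e}, s2, Hu, B1, B2, s1 \<union> {c} \<union> T, Z, P1, {r}, Q, {r'}, P3, U, {u1}, {u2}, {u3}]"
        by (rule dj_mono) (use Z(2) in simp)
      have "\<exists>q\<in>Q. link x (s1 \<union> {c} \<union> T) q" if "x \<in> insert e (s1 \<union> {c} \<union> T)" for x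
      proof (cases "x \<in> insert c T")
        case True
        then obtain q' where "q' \<in> Q" "link x T q'" using T by blast
        then show ?thesis using link_mono[of x T q' "s1 \<union> {c} \<union> T"] by blast
      next
        case False
        then have "x = e \<or> x \<in> s1" using that by auto
        then have "link x s1 c" using seg_elem(3)[OF s(1)] link_sym[OF seg_link[OF s(1)]] by auto
        from link_comp[OF this q(2)] show ?thesis using q(1) by blast
      qed
      then have TT': "\<forall>x\<in>insert e (s1 \<union> {c} \<union> T). \<exists>q\<in>Q. link x (s1 \<union> {c} \<union> T) q" by blast
      have "c \<in> s1 \<union> {c} \<union> T \<union> Q" by simp
      moreover have "w \<in> B1 \<union> B2 \<union> P3 \<union> {u3}" using Z(3) unfolding C_def by blast
      ultimately show False by (rule foot_exchange[OF dd lk(1) s(2) lk(2) l(4,5) TT' _ _ Z(1)])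
    next
      case False
      then have e': "e \<in> P1 \<union> {r} \<union> T \<union> Q" using eB by auto
      obtain Y Y' E where Y: "link c Y u3" "link u3 Y' u2" "Y \<subseteq> Hc \<union> E" "Y' \<subseteq> D - {u3}" "E \<subseteq> D - {u3} - Y'"
        using three'[OF cT(1) c(3,4)] unfolding Hs by blast
      have "dj [{c}, A1t, Hu, He, T, Hc \<union> E, Y', P1, {r}, Q, {r'}, U, {u1}, {u2}, {u3}]"
        using dK[OF Y(5,4)] by (clarsimp simp: Int_Un)
      then have "dj [{c}, A1t, Hu, He, T, Y, Y', P1, {r}, Q, {r'}, U, {u1}, {u2}, {u3}]"
        by (rule dj_mono) (use Y(3) in simp)
      from kite_c_left[OF this l(2) lk(2,1) TT e' Y(1,2)] show False .
    qed
  next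
    case u
    have lk: "link u2 Hc c" "link u2 He e" using two[OF cT(1) u(1)] two[OF eT(1) u(2)] unfolding Hs by auto
    obtain Y Y' E where Y: "link u1 Y u3" "link u3 Y' u2" "Y \<subseteq> Hu \<union> E" "Y' \<subseteq> D - {u3}" "E \<subseteq> D - {u3} - Y'"
      using three'[OF cT(2) u(3,4)] unfolding Hs by blast
    have "dj [Hc, {c}, A1t, He, T, Hu \<union> E, Y', P1, {r}, Q, {r'}, U, {u1}, {u2}, {u3}]"
      using dK[OF Y(5,4)] by (clarsimp simp: Int_Un)
    then have "dj [Hc, {c}, A1t, He, T, Y, Y', P1, {r}, Q, {r'}, U, {u1}, {u2}, {u3}]"
      by (rule dj_mono) (use Y(3) in simp)
    from kite_u1_left[OF this lk(1) l(2) lk(2) T eB Y(1,2)] show False .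
  qed
qed

end

text \<open>A path from \<open>u4\<close> to \<open>u2\<close> that avoids \<open>K\<close> leaves
  \<open>U\<close> and \<open>Q\<close> for the last time from \<open>Q\<close>, because neighbours
  of \<open>U\<close> lie in \<open>U\<close>, \<open>Q\<close> or \<open>K\<close>. Landing in
  \<open>u2\<close> gives a flower, landing on a cycle is \<open>one_foot\<close>, and landing on
  \<open>P1\<close> or \<open>P3\<close> reroutes \<open>R\<close> past \<open>r\<close> or
  \<open>r'\<close>, against \<open>U_max\<close>.\<close>

lemma (in kite_hull) no_double_cycle:
  assumes d: "dj [A1, A2, B1, B2, P1, {r}, Q, {r'}, P3, U, {u1}, {u2}, {u3}]"
    and l: "seg u2 A1 u1" "seg u2 A2 u1" "seg u2 B1 u3" "seg u2 B2 u3"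
  shows False
proof -
  interpret s: kite_hull adj V u3 u2 u1 u4 P3 r' Q r P1 U by (rule swap_hull)
  define W where "W = {u2} \<union> A1 \<union> A2 \<union> B1 \<union> B2 \<union> P1 \<union> P3"
  define K where "K = {r, r', u1, u3}"
  have dW: "dj [W, U \<union> Q, K]" using d unfolding W_def K_def by (clarsimp simp: Int_Un)
  have "card K \<le> 5" unfolding K_def by (simp add: card_insert_if)
  moreover have "u4 \<in> V - K" "u2 \<in> V - K" "u2 \<in> W" using uV u4U dW unfolding K_def W_def by auto
  ultimately have "conn (V - K) u4 u2" by (intro connected_minus_5) (auto simp: K_def)
  then have "\<exists>x T y. x \<in> U \<union> Q \<and> x \<in> V - K \<and> y \<in> W \<and> y \<in> V - K \<and> seg x T y \<and> T \<subseteq> V - K \<and> T \<inter> ((U \<union> Q) \<union> W) = {}"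
    using u4U dW \<open>u2 \<in> W\<close> by (intro bridge) auto
  then obtain x T y where b: "x \<in> U \<union> Q" "y \<in> W" "y \<in> V - K" "seg x T y" "T \<subseteq> V - K" "T \<inter> ((U \<union> Q) \<union> W) = {}" by blast
  have "x \<notin> U"
  proof
    assume x: "x \<in> U"
    obtain z where z: "z \<in> insert y T" "adj z x" using seg_last_adj[OF seg_sym[OF b(4)]] by auto
    have "z \<in> U \<union> Q \<union> K" using U_nbr[OF x adj_sym[OF z(2)]] by (auto simp: K_def)
    moreover have "z \<notin> K" using z(1) b(3,5) by auto
    moreover have "z \<notin> U \<union> Q" using z(1) b(2,6) dW by auto
    ultimately show False by simp
  qed
  then have x: "x \<in> Q" using b(1) by simp
  have "dj [T, W, U, Q, K]"
  proof -
    have "T \<inter> K = {}" using b(5) by auto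
    then show ?thesis using b(6) dW d by auto
  qed
  then have "dj [T, {u2} \<union> A1 \<union> A2 \<union> B1 \<union> B2 \<union> P1 \<union> P3, U, Q, {r} \<union> {r'} \<union> {u1} \<union> {u3}]"
    unfolding W_def K_def by simp
  then have dT: "dj [A1, A2, B1, B2, T, P1, {r}, Q, {r'}, P3, U, {u1}, {u2}, {u3}]"
    using d by (clarsimp simp: Int_Un)
  have lk: "link u2 A1 u1" "link u2 A2 u1" "link u2 B1 u3" "link u2 B2 u3" using l seg_link by auto
  have Tq: "\<forall>w\<in>insert y T. \<exists>q\<in>Q. link w T q"
  proof
    fix w assume "w \<in> insert y T"
    then have "link w T x" using seg_elem(3)[OF b(4)] link_sym[OF seg_link[OF b(4)]] by auto
    then show "\<exists>q\<in>Q. link w T q" using x by blast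
  qed
  have foot: False if A: "y \<in> A" "seg u2 A u1" "seg u2 A' u1"
    "dj [A, A', B1, B2, T, P1, {r}, Q, {r'}, P3, U, {u1}, {u2}, {u3}]" for A A'
  proof -
    obtain s1 s2 where s: "seg u2 s1 y" "seg y s2 u1" "A = s1 \<union> {y} \<union> s2" "s1 \<inter> s2 = {}" "y \<notin> s1" "y \<notin> s2"
      using seg_split[OF A(2,1)] by metis
    have "dj [s1, {y}, s2, A', B1, B2, T, P1, {r}, Q, {r'}, P3, U, {u1}, {u2}, {u3}]"
      using A(4) s(4-6) unfolding s(3) by (clarsimp simp: Int_Un Int_commute[of s2 s1])
    from one_foot[OF this seg_link[OF s(1)] s(2) seg_link[OF A(3)] l(3,4) Tq] show False .
  qed
  have foot': False if B: "y \<in> B" "seg u2 B u3" "seg u2 B' u3"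
    "dj [B, B', A1, A2, T, P3, {r'}, Q, {r}, P1, U, {u3}, {u2}, {u1}]" for B B'
  proof -
    obtain s1 s2 where s: "seg u2 s1 y" "seg y s2 u3" "B = s1 \<union> {y} \<union> s2" "s1 \<inter> s2 = {}" "y \<notin> s1" "y \<notin> s2"
      using seg_split[OF B(2,1)] by metis
    have "dj [s1, {y}, s2, B', A1, A2, T, P3, {r'}, Q, {r}, P1, U, {u3}, {u2}, {u1}]"
      using B(4) s(4-6) unfolding s(3) by (clarsimp simp: Int_Un Int_commute[of s2 s1])
    from s.one_foot[OF this seg_link[OF s(1)] s(2) seg_link[OF B(3)] l(1,2) Tq] show False .
  qed
  consider "y = u2" | "y \<in> A1" | "y \<in> A2" | "y \<in> B1" | "y \<in> B2" | "y \<in> P1" | "y \<in> P3" using b(2) unfolding W_def by blast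
  then show False
  proof cases
    case 1
    have "link u2 T x" using link_sym[OF seg_link[OF b(4)]] 1 by simp
    from hull_flower[OF dT lk x this] show False .
  next
    case 2 from foot[OF 2 l(1,2) dT] show False .
  next
    case 3 show False by (rule foot[OF 3 l(2,1)]) (use dT in clarsimp)
  next
    case 4 show False by (rule foot'[OF 4 l(3,4)]) (use dT in clarsimp)
  next
    case 5 show False by (rule foot'[OF 5 l(4,3)]) (use dT in clarsimp)
  next
    case 6
    have yx: "link y T x" using link_sym[OF seg_link[OF b(4)]] .
    have xu: "link x (Q \<union> {r'} \<union> P3) u3" by (rule link_comp[OF seg_elem(2)[OF seg_Q x] seg_link[OF seg_P3]])
    have R: "link u1 (P1 \<union> (T \<union> (Q \<union> {r'} \<union> P3))) u3"
      by (rule link_via[OF seg_elem(1)[OF seg_P1 6] link_via[OF yx xu]]) (use 6 x in auto)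
    have "dj [A1, A2, B1, B2, P1 \<union> (T \<union> (Q \<union> {r'} \<union> P3)), U, {u1}, {u2}, {u3}]" using dT by (clarsimp simp: Int_Un)
    from U_max[OF lk R this] have "r \<in> A1 \<union> A2 \<union> B1 \<union> B2 \<union> (P1 \<union> (T \<union> (Q \<union> {r'} \<union> P3)))" by simp
    moreover have "r \<notin> A1 \<union> A2 \<union> B1 \<union> B2 \<union> (P1 \<union> (T \<union> (Q \<union> {r'} \<union> P3)))" using dT by clarsimp
    ultimately show False by contradiction
  next
    case 7
    have xu: "link x (T \<union> P3) u3" by (rule link_via[OF seg_link[OF b(4)] seg_elem(2)[OF seg_P3 7]]) (use 7 in auto)
    have R: "link u1 (P1 \<union> {r} \<union> (Q \<union> (T \<union> P3))) u3"
      by (rule link_comp[OF seg_link[OF seg_P1] link_via[OF seg_elem(1)[OF seg_Q x] xu]]) (use x in auto)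
    have "dj [A1, A2, B1, B2, P1 \<union> {r} \<union> (Q \<union> (T \<union> P3)), U, {u1}, {u2}, {u3}]" using dT by (clarsimp simp: Int_Un)
    from U_max[OF lk R this] have "r' \<in> A1 \<union> A2 \<union> B1 \<union> B2 \<union> (P1 \<union> {r} \<union> (Q \<union> (T \<union> P3)))" by simp
    moreover have "r' \<notin> A1 \<union> A2 \<union> B1 \<union> B2 \<union> (P1 \<union> {r} \<union> (Q \<union> (T \<union> P3)))" using dT by clarsimp
    ultimately show False by contradiction
  qed
qed

section \<open>Extremal choice of two cycles and a path\<close>

context kitefree begin

text \<open>The singleton of \<open>u4\<close> in the list matters: a system through
  \<open>u4\<close> would have an empty \<open>u4_component\<close>.\<close>

definition cycles_path :: "'a set \<times> 'a set \<times> 'a set \<times> 'a set \<times> 'a set \<Rightarrow> bool" where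
  "cycles_path = (\<lambda>(A1, A2, B1, B2, R). seg u2 A1 u1 \<and> seg u2 A2 u1 \<and> seg u2 B1 u3 \<and> seg u2 B2 u3 \<and> seg u1 R u3 \<and>
     dj [A1, A2, B1, B2, R, {u1}, {u2}, {u3}, {u4}])"

definition u4_component :: "'a set \<times> 'a set \<times> 'a set \<times> 'a set \<times> 'a set \<Rightarrow> 'a set" where
  "u4_component = (\<lambda>(A1, A2, B1, B2, R). {v. conn (V - (A1 \<union> A2 \<union> B1 \<union> B2 \<union> R \<union> {u1, u2, u3})) u4 v})"

lemma cycles_path_links:
  assumes "link u2 A1 u1" "link u2 A2 u1" "link u2 B1 u3" "link u2 B2 u3" "link u1 R u3"
    and d: "dj [A1, A2, B1, B2, R, {u1}, {u2}, {u3}, {u4}]"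
  shows "\<exists>A1' A2' B1' B2' R'. cycles_path (A1', A2', B1', B2', R') \<and> A1' \<subseteq> A1 \<and> A2' \<subseteq> A2 \<and> B1' \<subseteq> B1 \<and> B2' \<subseteq> B2 \<and> R' \<subseteq> R"
proof -
  have neq: "u2 \<noteq> u1" "u2 \<noteq> u3" "u1 \<noteq> u3" using dist by auto
  obtain A1' where 1: "seg u2 A1' u1" "A1' \<subseteq> A1" using link_seg[OF assms(1) neq(1)] by metis
  obtain A2' where 2: "seg u2 A2' u1" "A2' \<subseteq> A2" using link_seg[OF assms(2) neq(1)] by metis
  obtain B1' where 3: "seg u2 B1' u3" "B1' \<subseteq> B1" using link_seg[OF assms(3) neq(2)] by metis
  obtain B2' where 4: "seg u2 B2' u3" "B2' \<subseteq> B2" using link_seg[OF assms(4) neq(2)] by metis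
  obtain R' where 5: "seg u1 R' u3" "R' \<subseteq> R" using link_seg[OF assms(5) neq(3)] by metis
  have "dj [A1', A2', B1', B2', R', {u1}, {u2}, {u3}, {u4}]"
    by (rule dj_mono[OF d]) (use 1 2 3 4 5 in simp)
  then show ?thesis using 1 2 3 4 5 unfolding cycles_path_def by blast
qed

text \<open>The size of the component of \<open>u4\<close> is bounded by \<open>card V\<close>, so
  some system attains the largest value; for it all assumptions of \<open>kite_hull\<close>
  hold.\<close>

lemma no_cycles_path: "\<not> cycles_path D"
proof
  assume D: "cycles_path D"
  have "card (u4_component E) \<le> card V" for E
  proof (rule card_mono[OF finV])
    obtain A1 A2 B1 B2 R where "E = (A1, A2, B1, B2, R)" by (cases E) auto
    then show "u4_component E \<subseteq> V" by (auto simp: u4_component_def dest: conn_mem)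
  qed
  then have "\<forall>y. cycles_path y \<longrightarrow> card (u4_component y) < Suc (card V)" by (simp add: le_imp_less_Suc)
  from ex_has_greatest_nat[OF D this] obtain E where E: "cycles_path E"
    and max: "\<And>F. cycles_path F \<Longrightarrow> card (u4_component F) \<le> card (u4_component E)" by metis
  obtain A1 A2 B1 B2 R where Eq: "E = (A1, A2, B1, B2, R)" by (cases E) auto
  have l: "seg u2 A1 u1" "seg u2 A2 u1" "seg u2 B1 u3" "seg u2 B2 u3" "seg u1 R u3"
    and d: "dj [A1, A2, B1, B2, R, {u1}, {u2}, {u3}, {u4}]" using E unfolding Eq cycles_path_def by auto
  define W where "W = A1 \<union> A2 \<union> B1 \<union> B2 \<union> R \<union> {u1, u2, u3}"
  define U where "U = u4_component E"
  have U: "U = {v. conn (V - W) u4 v}" unfolding U_def Eq u4_component_def W_def by simp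
  have u4W: "u4 \<in> V - W" using uV d unfolding W_def by auto
  have UW: "U \<subseteq> V - W" using conn_mem unfolding U by blast
  have u4U: "u4 \<in> U" using u4W by (simp add: U conn_refl)
  have U_conn: "conn U u4 x" if "x \<in> U" for x using conn_component[of "V - W" u4 x] that by (simp add: U)
  have U_step: "y \<in> U" if "x \<in> U" "adj x y" "y \<notin> W" for x y
  proof -
    have "y \<in> V" using that(2) adj_sym adjV by blast
    then have "conn (V - W) x y" using that UW by (intro conn_step) auto
    then show ?thesis using that(1) conn_trans unfolding U by blast
  qed
  have dU: "dj [A1, A2, B1, B2, R, U, {u1}, {u2}, {u3}]"
  proof -
    have "dj [A1 \<union> A2 \<union> B1 \<union> B2 \<union> R \<union> {u1, u2, u3}, U]" using UW unfolding W_def by auto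
    then show ?thesis using d by (clarsimp simp: Int_Un)
  qed
  have lk: "link u2 A1 u1" "link u2 A2 u1" "link u2 B1 u3" "link u2 B2 u3" "link u1 R u3" using l seg_link by auto
  have toU: "link y U u4" if "x \<in> U" "adj x y" for x y
  proof -
    have "link x U u4" using conn_link[OF conn_sym[OF U_conn[OF that(1)]]] .
    with link_comp[OF link_adj[OF adj_sym[OF that(2)], of "{}"] this] show ?thesis
      using that(1) by (simp add: insert_absorb)
  qed
  \<comment> \<open>The arc hit by the edge is extended through \<open>U\<close> to the pendant
    path. The other arc of the same cycle, \<open>R\<close> and one arc of the other cycle are
    untouched and form the triangle.\<close>
  have nbr: "y \<in> U \<union> R \<union> {u1, u3}" if xy: "x \<in> U" "adj x y" for x y
  proof (rule ccontr)
    assume "y \<notin> U \<union> R \<union> {u1, u3}"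
    then consider "y = u2" | "y \<in> A1" | "y \<in> A2" | "y \<in> B1" | "y \<in> B2" using U_step[OF xy] unfolding W_def by blast
    then show False
    proof cases
      case 1
      show False by (rule no_kite[OF lk(1,5) link_sym[OF lk(3)] toU[OF xy, unfolded 1] u4U]) (use dU in clarsimp)
    next
      case 2
      have "link u2 (A1 \<union> U) u4" by (rule link_via[OF seg_elem(1)[OF l(1) 2] toU[OF xy]]) (use 2 in simp)
      then show False by (rule no_kite[OF lk(2,5) link_sym[OF lk(3)]]) (use dU u4U in \<open>clarsimp simp: Int_Un\<close>)+
    next
      case 3
      have "link u2 (A2 \<union> U) u4" by (rule link_via[OF seg_elem(1)[OF l(2) 3] toU[OF xy]]) (use 3 in simp)
      then show False by (rule no_kite[OF lk(1,5) link_sym[OF lk(3)]]) (use dU u4U in \<open>clarsimp simp: Int_Un\<close>)+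
    next
      case 4
      have "link u2 (B1 \<union> U) u4" by (rule link_via[OF seg_elem(1)[OF l(3) 4] toU[OF xy]]) (use 4 in simp)
      then show False by (rule no_kite[OF lk(1,5) link_sym[OF lk(4)]]) (use dU u4U in \<open>clarsimp simp: Int_Un\<close>)+
    next
      case 5
      have "link u2 (B2 \<union> U) u4" by (rule link_via[OF seg_elem(1)[OF l(4) 5] toU[OF xy]]) (use 5 in simp)
      then show False by (rule no_kite[OF lk(1,5) link_sym[OF lk(3)]]) (use dU u4U in \<open>clarsimp simp: Int_Un\<close>)+
    qed
  qed
  define S where "S = {y. \<exists>x\<in>U. adj x y}"
  \<comment> \<open>With \<open>s\<close> arbitrary, this yields two different neighbours of
    \<open>U\<close> on \<open>R\<close>, and so \<open>r\<close> and \<open>r'\<close> are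
    distinct. Subtracting \<open>U\<close> and \<open>u2\<close> from \<open>K\<close> keeps both
    ends of the path alive for every \<open>s\<close>.\<close>
  have S2: "\<exists>y\<in>R \<inter> S. y \<noteq> s" for s
  proof -
    define K where "K = {u1, u3, s} - U - {u2}"
    have "card {u1, u3, s} \<le> 3" by (simp add: card_insert_if)
    moreover have "card K \<le> card {u1, u3, s}" by (rule card_mono) (auto simp: K_def)
    ultimately have "card K \<le> 5" by linarith
    then have "conn (V - K) u4 u2" using uV u4U by (intro connected_minus_5) (auto simp: K_def)
    then have "\<exists>x T y. x \<in> U \<and> x \<in> V - K \<and> y \<in> - U \<and> y \<in> V - K \<and> seg x T y \<and> T \<subseteq> V - K \<and> T \<inter> (U \<union> - U) = {}"
      using u4U dU by (intro bridge) auto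
    then obtain x T y where b: "x \<in> U" "y \<in> - U" "y \<in> V - K" "seg x T y" "T = {}" by blast
    have xy: "adj x y" using seg_last_adj[OF b(4)] b(5) by simp
    have "y \<in> R \<union> {u1, u3}" using nbr[OF b(1) xy] b(2) by simp
    moreover have "y \<noteq> u2" using \<open>y \<in> R \<union> {u1, u3}\<close> d by auto
    ultimately have "y \<in> R" "y \<noteq> s" using b(2,3) by (auto simp: K_def)
    then show ?thesis using xy b(1) unfolding S_def by blast
  qed
  then have "R \<inter> S \<noteq> {}" by blast
  from seg_first[OF l(5) this] obtain r P1 Z where r: "r \<in> S" "seg u1 P1 r" "seg r Z u3" "R = P1 \<union> {r} \<union> Z" "P1 \<inter> Z = {}"
    "r \<notin> P1" "r \<notin> Z" "P1 \<inter> S = {}" by metis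
  have "Z \<inter> S \<noteq> {}" using S2[of r] r(4,8) by blast
  from seg_first[OF seg_sym[OF r(3)] this] obtain r' P3 Q where r': "r' \<in> S" "seg u3 P3 r'" "seg r' Q r" "Z = P3 \<union> {r'} \<union> Q" "P3 \<inter> Q = {}"
    "r' \<notin> P3" "r' \<notin> Q" "P3 \<inter> S = {}" by metis
  have Req: "R = P1 \<union> {r} \<union> (P3 \<union> {r'} \<union> Q)" using r(4) r'(4) by simp
  have dR: "dj [P1, {r}, P3, {r'}, Q]" using r(5-7) r'(4-7) by auto
  have dfull: "dj [A1, A2, B1, B2, P1, {r}, Q, {r'}, P3, U, {u1}, {u2}, {u3}]"
    using dU dR unfolding Req by (clarsimp simp: Int_Un)
  interpret h: kite_hull adj V u1 u2 u3 u4 P1 r Q r' P3 U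
  proof unfold_locales
    show "dj [P1, {r}, Q, {r'}, P3, U, {u1}, {u2}, {u3}]" using dfull by simp
    show "seg u1 P1 r" "seg r Q r'" "seg r' P3 u3" using r(2) r'(2,3) seg_sym by auto
    show "u4 \<in> U" by (rule u4U)
    show "conn U u4 x" if "x \<in> U" for x by (rule U_conn[OF that])
    show "\<exists>x\<in>U. adj x r" "\<exists>x\<in>U. adj x r'" using r(1) r'(1) by (auto simp: S_def)
    show "y \<in> U \<union> Q \<union> {u1, u3, r, r'}" if "x \<in> U" "adj x y" for x y
    proof -
      have "y \<in> S" using that by (auto simp: S_def)
      then show ?thesis using nbr[OF that] r(8) r'(8) unfolding Req by auto
    qed
    show "{r, r'} \<subseteq> A1' \<union> A2' \<union> B1' \<union> B2' \<union> R'"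
      if m: "link u2 A1' u1" "link u2 A2' u1" "link u2 B1' u3" "link u2 B2' u3" "link u1 R' u3"
        "dj [A1', A2', B1', B2', R', U, {u1}, {u2}, {u3}]" for A1' A2' B1' B2' R'
    proof -
      have "u4 \<notin> A1' \<union> A2' \<union> B1' \<union> B2' \<union> R'" using m(6) u4U by auto
      then have "dj [A1', A2', B1', B2', R', {u1}, {u2}, {u3}, {u4}]" using m(6) dist by auto
      from cycles_path_links[OF m(1-5) this] obtain a1 a2 b1 b2 p where
        F: "cycles_path (a1, a2, b1, b2, p)" "a1 \<subseteq> A1'" "a2 \<subseteq> A2'" "b1 \<subseteq> B1'" "b2 \<subseteq> B2'" "p \<subseteq> R'" by blast
      define W' where "W' = a1 \<union> a2 \<union> b1 \<union> b2 \<union> p \<union> {u1, u2, u3}"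
      define U' where "U' = u4_component (a1, a2, b1, b2, p)"
      have U': "U' = {v. conn (V - W') u4 v}" unfolding U'_def u4_component_def W'_def by simp
      have "U \<inter> (A1' \<union> A2' \<union> B1' \<union> B2' \<union> R' \<union> {u1, u2, u3}) = {}" using m(6) by (simp add: Int_Un)
      then have UW': "U \<inter> W' = {}" using F(2-6) unfolding W'_def by blast
      have UV': "U \<subseteq> V - W'" using UW UW' by auto
      have UU': "U \<subseteq> U'"
      proof
        fix x assume "x \<in> U"
        from conn_mono[OF U_conn[OF this] UV'] show "x \<in> U'" by (simp add: U')
      qed
      have "U' \<subseteq> V" unfolding U' by (auto dest: conn_mem)
      then have "finite U'" using finV finite_subset by blast
      moreover have "card U' \<le> card U" using max[OF F(1)] unfolding U_def U'_def .
      \<comment> \<open>The component for the new system contains \<open>U\<close> and is not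
        larger, so it equals \<open>U\<close>. A neighbour of \<open>U\<close> outside
        \<open>U\<close> that the new system avoided would enlarge it.\<close>
      ultimately have eq: "U' = U" using UU' card_seteq[of U' U] by simp
      have "y \<in> W'" if y: "y \<in> S" "y \<notin> U" for y
      proof (rule ccontr)
        assume yW: "y \<notin> W'"
        obtain x where x: "x \<in> U" "adj x y" using y(1) by (auto simp: S_def)
        have "y \<in> V" using x(2) adj_sym adjV by blast
        then have "conn (V - W') x y" using x yW UV' by (intro conn_step) auto
        moreover have "conn (V - W') u4 x" using x(1) UU' unfolding U' by auto
        ultimately have "y \<in> U'" using conn_trans unfolding U' by blast
        then show False using eq y(2) by simp
      qed
      then have "{r, r'} \<subseteq> W'" using r(1) r'(1) dfull by auto
      moreover have "r \<notin> {u1, u2, u3}" "r' \<notin> {u1, u2, u3}" using dfull by auto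
      ultimately show ?thesis using F(2-6) unfolding W'_def by blast
    qed
  qed
  from h.no_double_cycle[OF dfull l(1-4)] show False .
qed

text \<open>From here on, any two cycles with a suitable path between them are a contradiction, even
  if they are given only as links.\<close>

lemma no_cycles_path_links:
  assumes "link u2 A1 u1" "link u2 A2 u1" "link u2 B1 u3" "link u2 B2 u3" "link u1 R u3"
    and d: "dj [A1, A2, B1, B2, R, {u1}, {u2}, {u3}, {u4}]"
  shows False
  using cycles_path_links[OF assms] no_cycles_path by blast

end

section \<open>Two cycles and a path\<close>

lemma (in sgraph) seg_two_points:
  assumes "seg a Z b" "x \<in> Z" "y \<in> Z" "x \<noteq> y"
  obtains p q Z1 Z2 Z3 where "{p, q} = {x, y}" "seg a Z1 p" "seg p Z2 q" "seg q Z3 b"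
    "Z = Z1 \<union> {p} \<union> Z2 \<union> {q} \<union> Z3" "dj [Z1, {p}, Z2, {q}, Z3]"
proof -
  obtain S1 S2 where s: "seg a S1 x" "seg x S2 b" "Z = S1 \<union> {x} \<union> S2" "S1 \<inter> S2 = {}" "x \<notin> S1" "x \<notin> S2"
    using seg_split[OF assms(1,2)] by metis
  consider "y \<in> S1" | "y \<in> S2" using assms(3,4) s(3) by blast
  then show ?thesis
  proof cases
    case 1
    obtain T1 T2 where t: "seg a T1 y" "seg y T2 x" "S1 = T1 \<union> {y} \<union> T2" "T1 \<inter> T2 = {}" "y \<notin> T1" "y \<notin> T2"
      using seg_split[OF s(1) 1] by metis
    show ?thesis using s(3-6) t(3-6) assms(4) by (intro that[of y x, OF _ t(1,2) s(2)]) auto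
  next
    case 2
    obtain T1 T2 where t: "seg x T1 y" "seg y T2 b" "S2 = T1 \<union> {y} \<union> T2" "T1 \<inter> T2 = {}" "y \<notin> T1" "y \<notin> T2"
      using seg_split[OF s(2) 2] by metis
    show ?thesis using s(3-6) t(3-6) assms(4) by (intro that[of x y, OF _ s(1) t(1,2)]) auto
  qed
qed

context kitefree begin

text \<open>
  If the third path of the fan at \<open>u1\<close> ends on \<open>B1\<close>, then it replaces \<open>S1\<close> as an arc of \<open>C1\<close>, and the arc
  \<open>B1\<close> of \<open>C2\<close> is replaced by \<open>X'\<close> and \<open>S3\<close>.
\<close>
lemma third_fan:
  assumes d: "dj [S3, {c'}, S2, {c}, S1, A2, B1, B2, X, X', {u1}, {u2}, {u3}, {u4}]"
    and l: "seg u2 S3 c'" "seg c' S2 c" "seg c S1 u1" "seg u2 A2 u1" "seg u2 B1 u3" "seg u2 B2 u3" "seg u3 X c" "seg u3 X' c'"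
  shows False
proof -
  define L where "L = S2 \<union> {c'} \<union> S3"
  define B where "B = {c} \<union> L \<union> {u2} \<union> X \<union> X' \<union> {u3} \<union> B1 \<union> B2"
  define Z where "Z = (\<lambda>b. if b = c then S1 else A2)"
  have neq: "c \<noteq> u2" "c \<noteq> u3" "u2 \<noteq> u3" "c \<noteq> u1" "c \<noteq> u4" "u1 \<noteq> u2" using d by auto
  have dB: "dj [S1, A2, B, {u1}, {u4}]" using d unfolding B_def L_def by (clarsimp simp: Int_Un)
  have dL: "dj [L, {c}, B1, B2, X, X', {u1}, {u2}, {u3}, {u4}]" using d unfolding L_def by (clarsimp simp: Int_Un)
  have cV: "c \<in> V" using seg_V[OF l(3)] by simp
  obtain T' H where TH: "{c, u2} \<subseteq> T'" "T' \<subseteq> B" "card T' = 3"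
    "\<And>b. b \<in> T' \<Longrightarrow> seg u1 (H b) b \<and> H b \<subseteq> - {u1, u4} \<and> H b \<inter> B = {}"
    "\<And>b b'. b \<in> T' \<Longrightarrow> b' \<in> T' \<Longrightarrow> b \<noteq> b' \<Longrightarrow> H b \<inter> H b' = {}"
  proof (rule star_fan[of "{c, u2}" 3 u1 "- {u1, u4}" B Z])
    show "link u1 (Z b) b \<and> Z b \<subseteq> - {u1, u4} \<and> b \<in> - {u1, u4} \<and> b \<in> B \<and> Z b \<inter> B = {}" if "b \<in> {c, u2}" for b
    proof -
      have "link u1 (Z b) b" using that link_sym[OF seg_link[OF l(3)]] link_sym[OF seg_link[OF l(4)]] neq by (auto simp: Z_def)
      moreover have "Z b \<in> {S1, A2}" by (simp add: Z_def)
      then have "Z b \<subseteq> - {u1, u4} \<and> Z b \<inter> B = {}" using dB by auto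
      moreover have bB: "b \<in> B" using that by (auto simp: B_def)
      moreover have "b \<in> - {u1, u4}" using bB dB by auto
      ultimately show ?thesis by blast
    qed
    show "Z b \<inter> Z b' = {}" if "b \<in> {c, u2}" "b' \<in> {c, u2}" "b \<noteq> b'" for b b'
      using that dB neq by (auto simp: Z_def)
    show "\<exists>W y. link u1 W y \<and> y \<in> B \<and> y \<in> - {u1, u4} - S \<and> W \<subseteq> - {u1, u4} - S" if S: "finite S" "card S < 3" for S
    proof -
      define K where "K = (S - {u1}) \<union> {u4}"
      have "card (S - {u1}) \<le> 2" using card_mono[of S "S - {u1}"] S by auto
      then have "card K \<le> 5" using card_Un_le[of "S - {u1}" "{u4}"] unfolding K_def by simp
      moreover have "finite K" using S by (simp add: K_def)
      ultimately have K: "finite K" "card K \<le> 5" by auto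
      have "card {c, u2, u3} = 3" using neq by auto
      then have "\<not> {c, u2, u3} \<subseteq> S" using card_mono[OF S(1), of "{c, u2, u3}"] S(2) by auto
      then obtain b where b: "b \<in> {c, u2, u3}" "b \<notin> S" by blast
      have bb: "b \<in> V" "b \<noteq> u4" "b \<noteq> u1" "b \<in> B" using b cV uV d neq by (auto simp: B_def)
      have "u1 \<in> V - K" using uV dist by (auto simp: K_def)
      moreover have "b \<in> V - K" using b bb by (auto simp: K_def)
      ultimately have "conn (V - K) u1 b" using connected_minus_5[OF K] by simp
      then have "link u1 (V - K - {u1}) b" unfolding link_def by (rule conn_mono) auto
      then show ?thesis using b bb by (intro exI[of _ "V - K - {u1}"] exI[of _ b]) (auto simp: K_def)
    qed
  qed (use dB neq in auto)
  have "finite T'" using TH(3) by (metis card.infinite zero_neq_numeral)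
  then have "card (T' - {c, u2}) = 1" using card_Diff_subset[of "{c, u2}" T'] TH(1,3) neq by simp
  then obtain e where e: "T' - {c, u2} = {e}" by (meson card_1_singletonE)
  have eT: "e \<in> T'" "e \<noteq> c" "e \<noteq> u2" using e by auto
  define Hc H2 He where Hs: "Hc = H c" "H2 = H u2" "He = H e"
  have lk: "link u1 Hc c" "link u1 H2 u2" "link u1 He e" using TH(1,4) eT(1) unfolding Hs by (auto intro!: seg_link)
  have dH: "dj [Hc, H2, He, B, {u1}, {u4}]"
  proof -
    have 1: "H b \<inter> B = {} \<and> B \<inter> H b = {} \<and> u1 \<notin> H b \<and> u4 \<notin> H b" if "b \<in> T'" for b using TH(4)[OF that] by auto
    show ?thesis using 1[of c] 1[of u2] 1[OF eT(1)] TH(1,5) eT dB neq unfolding Hs by auto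
  qed
  then have "dj [Hc, H2, He, {c} \<union> L \<union> {u2} \<union> X \<union> X' \<union> {u3} \<union> B1 \<union> B2, {u1}, {u4}]" unfolding B_def .
  then have dA: "dj [Hc, H2, He, {c}, L, X, X', B1, B2, {u1}, {u2}, {u3}, {u4}]"
    using dL by (clarsimp simp: Int_Un)
  have B12: "link u2 B1 u3" "link u2 B2 u3" using seg_link l(5,6) by auto
  have A2': "link u2 H2 u1" by (rule link_sym[OF lk(2)])
  have cu2: "link c L u2" unfolding L_def using link_comp[OF link_sym[OF seg_link[OF l(2)]] link_sym[OF seg_link[OF l(1)]]] .
  have A1': "link u2 (Hc \<union> {c} \<union> L) u1" by (rule link_sym[OF link_comp[OF lk(1) cu2]])
  have RX: "link u1 (Hc \<union> {c} \<union> X) u3" by (rule link_comp[OF lk(1) link_sym[OF seg_link[OF l(7)]]])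
  have dA': "dj [Hc, H2, He, {c}, S3 \<union> {c'}, X, X', B1, B2, {u1}, {u2}, {u3}, {u4}]"
    by (rule dj_mono[OF dA]) (simp add: L_def subset_iff)
  have arc: False if F: "e \<in> F" "seg u2 F u3" "link u2 F' u3"
    "dj [He \<union> F, H2, S3 \<union> {c'} \<union> X', F', Hc \<union> {c} \<union> X, {u1}, {u2}, {u3}, {u4}]" for F F'
  proof -
    have n: "link u2 (He \<union> F) u1" by (rule link_sym, rule link_via[OF lk(3) seg_elem(3)[OF F(2,1)]]) (use F(1) in simp)
    have m: "link u2 (S3 \<union> {c'} \<union> X') u3" by (rule link_comp[OF seg_link[OF l(1)] link_sym[OF seg_link[OF l(8)]]])
    from no_cycles_path_links[OF n A2' m F(3) RX F(4)] show False .
  qed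
  have "e \<in> B" using TH(2) eT by auto
  then consider "e \<in> X" | "e \<in> X'" | "e = u3" | "e \<in> L" | "e \<in> B1" | "e \<in> B2" using eT unfolding B_def by blast
  then show False
  proof cases
    case 1
    have "link u1 (He \<union> X) u3" by (rule link_via[OF lk(3) seg_elem(3)[OF l(7) 1]]) (use 1 in simp)
    from no_cycles_path_links[OF A1' A2' B12 this] show False using dA by (clarsimp simp: Int_Un)
  next
    case 2
    have "link u1 (He \<union> X') u3" by (rule link_via[OF lk(3) seg_elem(3)[OF l(8) 2]]) (use 2 in simp)
    from no_cycles_path_links[OF A1' A2' B12 this] show False using dA by (clarsimp simp: Int_Un)
  next
    case 3
    have "link u1 He u3" using lk(3) 3 by simp
    from no_cycles_path_links[OF A1' A2' B12 this] show False using dA by (clarsimp simp: Int_Un)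
  next
    \<comment> \<open>\<open>He\<close> and the rest of \<open>L\<close> towards \<open>u2\<close>
      form a new arc of \<open>C1\<close>. This releases \<open>c\<close>, so that \<open>Hc\<close>
      and \<open>X\<close> make up the path from \<open>u1\<close> to \<open>u3\<close>.\<close>
    case 4
    have "link e L u2"
    proof -
      consider "e \<in> S2" | "e = c'" | "e \<in> S3" using 4 unfolding L_def by blast
      then show ?thesis
      proof cases
        case 1 show ?thesis unfolding L_def by (rule link_comp[OF seg_elem(3)[OF l(2) 1] link_sym[OF seg_link[OF l(1)]]])
      next
        case 2 show ?thesis unfolding L_def 2 by (rule link_mono[OF link_sym[OF seg_link[OF l(1)]]]) auto
      next
        case 3 show ?thesis unfolding L_def by (rule link_mono[OF seg_elem(3)[OF l(1) 3]]) auto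
      qed
    qed
    then have "link u1 (He \<union> L) u2" by (rule link_via[OF lk(3)]) (use 4 in simp)
    from no_cycles_path_links[OF link_sym[OF this] A2' B12 RX] show False using dA by (clarsimp simp: Int_Un)
  next
    case 5 show False by (rule arc[OF 5 l(5) B12(2)]) (use d dA' in \<open>clarsimp simp: Int_Un\<close>)
  next
    case 6 show False by (rule arc[OF 6 l(6) B12(1)]) (use d dA' in \<open>clarsimp simp: Int_Un\<close>)
  qed
qed

text \<open>More than 8 vertices leave some \<open>w\<close> besides \<open>v\<close> and the at
  most 7 vertices of \<open>S\<close>; the first edge of a path from \<open>v\<close> to
  \<open>w\<close> outside \<open>S\<close> is the desired one.\<close>

lemma neighbour_avoiding:
  assumes "finite S" "card S \<le> 7" "u2 \<in> S" "v \<in> V - S"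
  obtains x where "x \<in> V - S" "adj v x"
proof -
  have "card (insert v S) \<le> 8" using assms by (simp add: card_insert_if)
  then have "\<not> V \<subseteq> insert v S" using card_mono[of "insert v S" V] assms(1) card_V by auto
  then obtain w where w: "w \<in> V - S" "w \<noteq> v" by blast
  have "link v (V - S) w" using connected_minus[OF assms w(1)] by (rule conn_link)
  then obtain p where p: "is_path adj p" "adj v (hd p)" "set p \<subseteq> insert w (V - S - {v})" using link_tl w(2) by metis
  have "hd p \<in> set p" using p(1) by (simp add: is_path_def)
  then show ?thesis using that p w(1) by blast
qed

lemma seg_nonempty:
  assumes "seg a Z b" "\<not> adj a b" obtains x where "x \<in> Z" "adj x b"
  using seg_last_adj[OF assms(1)] assms(2) by auto

text \<open>Two neighbours of \<open>u1\<close> and two of \<open>u3\<close>, all distinct, are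
  targets of a fan of size 4 at \<open>u2\<close>. There are no other targets, so every one of them
  is reached, and the edges to \<open>u1\<close> and \<open>u3\<close> complete the arcs.\<close>

lemma two_cycles:
  obtains A1 A2 B1 B2 where "link u2 A1 u1" "link u2 A2 u1" "link u2 B1 u3" "link u2 B2 u3"
    "dj [A1, A2, B1, B2, {u1}, {u2}, {u3}, {u4}]"
proof -
  have neq: "u1 \<noteq> u2" "u1 \<noteq> u3" "u1 \<noteq> u4" "u2 \<noteq> u3" "u2 \<noteq> u4" "u3 \<noteq> u4" using dist by auto
  have ex: "\<exists>x\<in>V - set xs. adj v x" if "length xs \<le> 7" "u2 \<in> set xs" "v \<in> V - set xs" for xs v
    using neighbour_avoiding[of "set xs" v] that card_length[of xs] by (metis List.finite_set le_trans)
  obtain x1 where x1: "x1 \<in> V - {u2, u3, u4}" "adj u1 x1"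
    using ex[of "[u2, u3, u4]" u1] uV neq by auto
  have x1u: "x1 \<noteq> u1" using x1(2) irrefl by auto
  obtain x2 where x2: "x2 \<in> V - {u2, u3, u4, x1}" "adj u1 x2"
    using ex[of "[u2, u3, u4, x1]" u1] uV neq x1u by auto
  obtain y1 where y1: "y1 \<in> V - {u2, u1, u4, x1, x2}" "adj u3 y1"
    using ex[of "[u2, u1, u4, x1, x2]" u3] uV neq x1 x2 by auto
  have y1u: "y1 \<noteq> u3" using y1(2) irrefl by auto
  obtain y2 where y2: "y2 \<in> V - {u2, u1, u4, x1, x2, y1}" "adj u3 y2"
    using ex[of "[u2, u1, u4, x1, x2, y1]" u3] uV neq x1 x2 y1u by auto
  define X where "X = V - {u1, u2, u3, u4}"
  define B where "B = {x1, x2, y1, y2}"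
  have ne: "x1 \<noteq> u1" "x2 \<noteq> u1" "y1 \<noteq> u3" "y2 \<noteq> u3" using x1 x2 y1 y2 irrefl by auto
  have BX: "B \<subseteq> X" using x1 x2 y1 y2 ne by (auto simp: B_def X_def)
  have cB: "card B = 4" using x2 y1 y2 by (auto simp: B_def)
  have fB: "finite B" by (simp add: B_def)
  obtain T' H where TH: "{} \<subseteq> T'" "T' \<subseteq> B" "card T' = 4"
    "\<And>b. b \<in> T' \<Longrightarrow> seg u2 (H b) b \<and> H b \<subseteq> X \<and> H b \<inter> B = {}"
    "\<And>b b'. b \<in> T' \<Longrightarrow> b' \<in> T' \<Longrightarrow> b \<noteq> b' \<Longrightarrow> H b \<inter> H b' = {}"
  proof (rule star_fan[of "{}" 4 u2 X B])
    show "\<exists>W y. link u2 W y \<and> y \<in> B \<and> y \<in> X - S \<and> W \<subseteq> X - S" if S: "finite S" "card S < 4" for S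
    proof -
      \<comment> \<open>At most 3 vertices of \<open>S\<close> and the four terminals make 7, which
        is allowed because \<open>u2\<close> is among them. The first step from \<open>u2\<close>
        goes to one of its 6 neighbours outside \<open>S\<close> and \<open>u4\<close>; it is
        neither \<open>u1\<close> nor \<open>u3\<close> by \<open>nonadj\<close>.\<close>
      define K where "K = S \<union> {u1, u2, u3, u4}"
      have "card {u1, u2, u3, u4} \<le> 4" by (simp add: card_insert_if)
      then have K: "finite K" "card K \<le> 7" "u2 \<in> K" using card_Un_le[of S "{u1, u2, u3, u4}"] S by (auto simp: K_def)
      have "\<not> B \<subseteq> S" using card_mono[OF S(1), of B] S(2) cB by auto
      then obtain y where y: "y \<in> B" "y \<notin> S" by blast
      have "card (insert u4 S) \<le> 4" using S by (simp add: card_insert_if)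
      then have "\<not> {x. adj u2 x} \<subseteq> insert u4 S" using card_mono[of "insert u4 S" "{x. adj u2 x}"] S(1) degree_u2 by auto
      then obtain a where a: "adj u2 a" "a \<notin> S" "a \<noteq> u4" by blast
      have "a \<noteq> u1" "a \<noteq> u3" "a \<noteq> u2" using a(1) nonadj irrefl by auto
      then have aK: "a \<in> V - K" using a adjV adj_sym by (auto simp: K_def)
      moreover have yK: "y \<in> V - K" using y BX by (auto simp: K_def X_def)
      ultimately have "link a (V - K) y" using connected_minus[OF K] conn_link by blast
      then have "link u2 ({} \<union> {a} \<union> (V - K)) y" by (rule link_comp[OF link_adj[OF a(1)]])
      then have "link u2 (V - K) y" using aK by (simp add: insert_absorb)
      then show ?thesis using y(1) yK by (intro exI[of _ "V - K"] exI[of _ y]) (auto simp: K_def X_def)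
    qed
  qed (use BX in \<open>auto simp: X_def\<close>)
  have T': "T' = B" using TH(2,3) cB fB card_subset_eq by metis
  have sg: "link u2 (H b) b" if "b \<in> B" for b using TH(4)[of b] that T' seg_link by auto
  have HX: "H b \<subseteq> X" "H b \<inter> B = {}" if "b \<in> B" for b using TH(4)[of b] that T' by auto
  have inB: "x1 \<in> B" "x2 \<in> B" "y1 \<in> B" "y2 \<in> B" by (auto simp: B_def)
  define C where "C = (\<lambda>b. H b \<union> {b} \<union> {})"
  have arm: "link u2 (C b) v" if "b \<in> B" "adj v b" for b v
    unfolding C_def by (rule link_comp[OF sg[OF that(1)] link_adj[OF adj_sym[OF that(2)]]])
  have CC: "C b \<inter> C b' = {}" if "b \<in> B" "b' \<in> B" "b \<noteq> b'" for b b'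
    using TH(5)[of b b'] that T' HX[OF that(1)] HX[OF that(2)] unfolding C_def by auto
  have CX: "C b \<subseteq> X" if "b \<in> B" for b using HX(1)[OF that] that BX by (auto simp: C_def)
  have bneq: "x1 \<noteq> x2" "x1 \<noteq> y1" "x1 \<noteq> y2" "x2 \<noteq> y1" "x2 \<noteq> y2" "y1 \<noteq> y2" using x2 y1 y2 by auto
  show ?thesis
  proof (rule that[OF arm[OF inB(1) x1(2)] arm[OF inB(2) x2(2)] arm[OF inB(3) y1(2)] arm[OF inB(4) y2(2)]])
    have n: "u1 \<notin> C b \<and> u2 \<notin> C b \<and> u3 \<notin> C b \<and> u4 \<notin> C b" if "b \<in> B" for b using CX[OF that] by (auto simp: X_def)
    show "dj [C x1, C x2, C y1, C y2, {u1}, {u2}, {u3}, {u4}]"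
      using n[OF inB(1)] n[OF inB(2)] n[OF inB(3)] n[OF inB(4)] neq bneq inB CC by auto
  qed
qed

text \<open>Only the path between the two cycles is missing, and a fan at \<open>u3\<close> provides
  it. Both arcs of \<open>C2\<close> end in \<open>u2\<close>, so disjoint paths cannot keep them;
  the fan keeps their last inner vertices \<open>b1\<close> and \<open>b2\<close> instead, and the
  edges to \<open>u2\<close> are added afterwards. Its size is 5 because three further paths end on
  \<open>C1\<close>: one in \<open>u1\<close> is the missing path, and otherwise two of them end on
  the same arc, as \<open>third_fan\<close> requires.\<close>

lemma inconsistent: False
proof -
  obtain A1' A2' B1' B2' where l': "link u2 A1' u1" "link u2 A2' u1" "link u2 B1' u3" "link u2 B2' u3"
    and d': "dj [A1', A2', B1', B2', {u1}, {u2}, {u3}, {u4}]" using two_cycles by metis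
  have neq: "u1 \<noteq> u2" "u1 \<noteq> u3" "u1 \<noteq> u4" "u2 \<noteq> u3" "u2 \<noteq> u4" "u3 \<noteq> u4" "u2 \<noteq> u1" "u3 \<noteq> u2" using dist by auto
  obtain A1 where A1: "seg u2 A1 u1" "A1 \<subseteq> A1'" using link_seg[OF l'(1) neq(7)] by metis
  obtain A2 where A2: "seg u2 A2 u1" "A2 \<subseteq> A2'" using link_seg[OF l'(2) neq(7)] by metis
  obtain B1 where B1: "seg u3 B1 u2" "B1 \<subseteq> B1'" using link_seg[OF link_sym[OF l'(3)] neq(8)] by metis
  obtain B2 where B2: "seg u3 B2 u2" "B2 \<subseteq> B2'" using link_seg[OF link_sym[OF l'(4)] neq(8)] by metis
  have d: "dj [A1, A2, B1, B2, {u1}, {u2}, {u3}, {u4}]"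
    by (rule dj_mono[OF d']) (use A1 A2 B1 B2 in simp)
  have "\<not> adj u3 u2" using nonadj adj_sym by blast
  then obtain b1 b2 where b: "b1 \<in> B1" "adj b1 u2" "b2 \<in> B2" "adj b2 u2" using seg_nonempty B1(1) B2(1) by metis
  obtain a1 a2 where a: "a1 \<in> A1" "a2 \<in> A2" using seg_nonempty A1(1) A2(1) nonadj by metis
  obtain Z1 Y1 where Z1: "seg u3 Z1 b1" "B1 = Z1 \<union> {b1} \<union> Y1" "b1 \<notin> Z1" using seg_split[OF B1(1) b(1)] by metis
  obtain Z2 Y2 where Z2: "seg u3 Z2 b2" "B2 = Z2 \<union> {b2} \<union> Y2" "b2 \<notin> Z2" using seg_split[OF B2(1) b(3)] by metis
  have dZ: "dj [A1, A2, Z1, {b1}, Z2, {b2}, {u1}, {u2}, {u3}, {u4}]"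
    using d Z1(3) Z2(3) unfolding Z1(2) Z2(2) by (clarsimp simp: Int_Un)
  define X where "X = V - {u2, u3, u4}"
  define B where "B = {u1} \<union> A1 \<union> A2 \<union> {b1} \<union> {b2}"
  define Z where "Z = (\<lambda>b. if b = b1 then Z1 else Z2)"
  have dB: "dj [Z1, Z2, B, {u2}, {u3}, {u4}]" using dZ unfolding B_def by (clarsimp simp: Int_Un)
  have BX: "B \<subseteq> X" using dB seg_V[OF A1(1)] seg_V[OF A2(1)] b(2,4) adjV unfolding B_def X_def by auto
  have ZX: "Z1 \<subseteq> X" "Z2 \<subseteq> X" using dB seg_V(1)[OF Z1(1)] seg_V(1)[OF Z2(1)] unfolding X_def by auto
  have b12: "b1 \<noteq> b2" using dZ by auto
  have "u1 \<noteq> b1" "u1 \<noteq> b2" "a1 \<notin> {u1, b1, b2}" "a2 \<notin> {u1, b1, b2, a1}" using dZ a by auto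
  then have five: "card {u1, b1, b2, a1, a2} = 5" using b12 by auto
  obtain T' H where TH: "{b1, b2} \<subseteq> T'" "T' \<subseteq> B" "card T' = 5"
    "\<And>b. b \<in> T' \<Longrightarrow> seg u3 (H b) b \<and> H b \<subseteq> X \<and> H b \<inter> B = {}"
    "\<And>b b'. b \<in> T' \<Longrightarrow> b' \<in> T' \<Longrightarrow> b \<noteq> b' \<Longrightarrow> H b \<inter> H b' = {}"
  proof (rule star_fan[of "{b1, b2}" 5 u3 X B Z])
    show "link u3 (Z b) b \<and> Z b \<subseteq> X \<and> b \<in> X \<and> b \<in> B \<and> Z b \<inter> B = {}" if "b \<in> {b1, b2}" for b
    proof -
      have "link u3 (Z b) b" using that seg_link[OF Z1(1)] seg_link[OF Z2(1)] b12 by (auto simp: Z_def)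
      moreover have "Z b \<in> {Z1, Z2}" by (simp add: Z_def)
      then have "Z b \<subseteq> X \<and> Z b \<inter> B = {}" using dB ZX by auto
      moreover have "b \<in> B" using that by (auto simp: B_def)
      ultimately show ?thesis using BX by blast
    qed
    show "Z b \<inter> Z b' = {}" if "b \<in> {b1, b2}" "b' \<in> {b1, b2}" "b \<noteq> b'" for b b'
      using that dB b12 by (auto simp: Z_def)
    show "\<exists>W y. link u3 W y \<and> y \<in> B \<and> y \<in> X - S \<and> W \<subseteq> X - S" if S: "finite S" "card S < 5" for S
    proof -
      \<comment> \<open>At most 4 vertices of \<open>S\<close>, then \<open>u2\<close> and
        \<open>u4\<close>, and finally \<open>u3\<close> itself make 7 deleted vertices including
        \<open>u2\<close>. The neighbour \<open>a\<close> outside \<open>S'\<close> is chosen before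
        \<open>u3\<close> is deleted.\<close>
      define S' where "S' = (S - {u3}) \<union> {u2, u4}"
      have "card (S - {u3}) \<le> 4" using card_mono[of S "S - {u3}"] S by auto
      moreover have "card {u2, u4} \<le> 2" by (simp add: card_insert_if)
      ultimately have cS: "card S' \<le> 6" using card_Un_le[of "S - {u3}" "{u2, u4}"] unfolding S'_def by linarith
      have fS: "finite S'" "u2 \<in> S'" "u3 \<in> V - S'" using S uV neq by (auto simp: S'_def)
      obtain a where a': "a \<in> V - S'" "adj u3 a" using neighbour_avoiding[OF fS(1) _ fS(2,3)] cS by auto
      define K where "K = insert u3 S'"
      have K: "finite K" "card K \<le> 7" "u2 \<in> K" using fS cS by (auto simp: K_def card_insert_if)
      have "\<not> {u1, b1, b2, a1, a2} \<subseteq> S" using card_mono[OF S(1), of "{u1, b1, b2, a1, a2}"] S(2) five by auto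
      then obtain y where y: "y \<in> {u1, b1, b2, a1, a2}" "y \<notin> S" by blast
      have yB: "y \<in> B" using y(1) a by (auto simp: B_def)
      have yK: "y \<in> V - K" using yB BX y(2) by (auto simp: K_def S'_def X_def)
      have aK: "a \<in> V - K" using a' irrefl by (auto simp: K_def)
      have "link a (V - K) y" using connected_minus[OF K aK yK] conn_link by blast
      then have "link u3 ({} \<union> {a} \<union> (V - K)) y" by (rule link_comp[OF link_adj[OF a'(2)]])
      then have "link u3 (V - K) y" using aK by (simp add: insert_absorb)
      moreover have "V - K \<subseteq> X - S" unfolding K_def S'_def X_def by auto
      ultimately show ?thesis using yB yK by blast
    qed
  qed (use BX b12 in \<open>auto simp: X_def\<close>)
  have fT: "finite T'" using TH(3) by (metis card.infinite zero_neq_numeral)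
  have sg: "seg u3 (H b) b" if "b \<in> T'" for b using TH(4)[OF that] by simp
  have HB: "H b \<inter> B = {} \<and> B \<inter> H b = {} \<and> u2 \<notin> H b \<and> u3 \<notin> H b \<and> u4 \<notin> H b" if "b \<in> T'" for b
    using TH(4)[OF that] by (auto simp: X_def)
  have bT: "b1 \<in> T'" "b2 \<in> T'" using TH(1) by auto
  define G1 G2 where G: "G1 = H b1" "G2 = H b2"
  have lB: "link u2 ({} \<union> {b1} \<union> G1) u3" "link u2 ({} \<union> {b2} \<union> G2) u3" unfolding G
    by (rule link_comp[OF link_adj[OF adj_sym[OF b(2)]] link_sym[OF seg_link[OF sg[OF bT(1)]]]],
        rule link_comp[OF link_adj[OF adj_sym[OF b(4)]] link_sym[OF seg_link[OF sg[OF bT(2)]]]])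
  have dG: "dj [G1, G2, Hx, B, {u2}, {u3}, {u4}]" if "Hx = H x" "x \<in> T'" "x \<noteq> b1" "x \<noteq> b2" for x Hx
    using HB[OF bT(1)] HB[OF bT(2)] HB[OF that(2)] TH(5) bT that b12 dB unfolding G by auto
  have dG': "dj [G1, G2, Hx, {u1}, A1, A2, {b1}, {b2}, {u2}, {u3}, {u4}]" if "Hx = H x" "x \<in> T'" "x \<noteq> b1" "x \<noteq> b2" for x Hx
    using dG[OF that] dZ unfolding B_def by (clarsimp simp: Int_Un)
  show False
  proof (cases "u1 \<in> T'")
    case True
    have "u1 \<noteq> b1" "u1 \<noteq> b2" using dZ by auto
    from dG'[OF refl True this] have "dj [A1, A2, {} \<union> {b1} \<union> G1, {} \<union> {b2} \<union> G2, H u1, {u1}, {u2}, {u3}, {u4}]"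
      by (clarsimp simp: Int_Un)
    from no_cycles_path_links[OF seg_link[OF A1(1)] seg_link[OF A2(1)] lB link_sym[OF seg_link[OF sg[OF True]]] this] show False .
  next
    case False
    have fin: False if A: "seg u2 A u1" "seg u2 A' u1" "dj [G1, G2, H x, {u1}, A, A', {b1}, {b2}, {u2}, {u3}, {u4}]"
        "dj [G1, G2, H y, {u1}, A, A', {b1}, {b2}, {u2}, {u3}, {u4}]"
      and xy: "x \<in> T'" "y \<in> T'" "x \<in> A" "y \<in> A" "x \<noteq> y" for A A' x y
    proof -
      obtain p q S1 S2 S3 where s: "{p, q} = {x, y}" "seg u2 S1 p" "seg p S2 q" "seg q S3 u1"
        "A = S1 \<union> {p} \<union> S2 \<union> {q} \<union> S3" "dj [S1, {p}, S2, {q}, S3]"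
        using seg_two_points[OF A(1) xy(3-5)] by metis
      define Hp Hq where H: "Hp = H p" "Hq = H q"
      have pq: "p \<in> T'" "q \<in> T'" "p \<noteq> q" using s(1,6) xy by (auto simp: doubleton_eq_iff)
      have "dj [G1, G2, Hp, {u1}, A, A', {b1}, {b2}, {u2}, {u3}, {u4}]" "dj [G1, G2, Hq, {u1}, A, A', {b1}, {b2}, {u2}, {u3}, {u4}]"
        using s(1) A(3,4) unfolding H by (auto simp only: doubleton_eq_iff)
      moreover have "Hp \<inter> Hq = {}" "Hq \<inter> Hp = {}" using TH(5)[OF pq] unfolding H by auto
      ultimately have dd: "dj [S1, {p}, S2, {q}, S3, A', {} \<union> {b1} \<union> G1, {} \<union> {b2} \<union> G2, Hq, Hp, {u1}, {u2}, {u3}, {u4}]"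
        using s(6) unfolding s(5) by (clarsimp simp: Int_Un)
      obtain F1 where F1: "seg u2 F1 u3" "F1 \<subseteq> {} \<union> {b1} \<union> G1" using link_seg[OF lB(1) neq(4)] by metis
      obtain F2 where F2: "seg u2 F2 u3" "F2 \<subseteq> {} \<union> {b2} \<union> G2" using link_seg[OF lB(2) neq(4)] by metis
      have "dj [S1, {p}, S2, {q}, S3, A', F1, F2, Hq, Hp, {u1}, {u2}, {u3}, {u4}]"
        by (rule dj_mono[OF dd]) (use F1(2) F2(2) in simp)
      from third_fan[OF this s(2,3,4) A(2) F1(1) F2(1)] show False using sg[OF pq(1)] sg[OF pq(2)] unfolding H by simp
    qed
    have sub: "T' - {b1, b2} \<subseteq> A1 \<union> A2" using TH(2) False unfolding B_def by auto
    have c3: "card (T' - {b1, b2}) = 3" using card_Diff_subset[of "{b1, b2}" T'] TH(1,3) b12 by simp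
    \<comment> \<open>Pigeonhole: three ends on two arcs.\<close>
    have "\<exists>A\<in>{A1, A2}. \<exists>x\<in>A \<inter> T'. \<exists>y\<in>A \<inter> T'. x \<noteq> y"
    proof (rule ccontr)
      assume no: "\<not> ?thesis"
      have one: "card (A \<inter> T') \<le> 1" if "A \<in> {A1, A2}" for A
        using no that fT card_le_Suc0_iff_eq[of "A \<inter> T'"] by auto
      have "T' - {b1, b2} \<subseteq> (A1 \<inter> T') \<union> (A2 \<inter> T')" using sub by auto
      then have "card (T' - {b1, b2}) \<le> card ((A1 \<inter> T') \<union> (A2 \<inter> T'))" using fT by (intro card_mono) auto
      also have "\<dots> \<le> card (A1 \<inter> T') + card (A2 \<inter> T')" by (rule card_Un_le)
      finally show False using one[of A1] one[of A2] c3 by simp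
    qed
    then obtain A x y where xy: "A \<in> {A1, A2}" "x \<in> A \<inter> T'" "y \<in> A \<inter> T'" "x \<noteq> y" by blast
    have nb: "x \<noteq> b1" "x \<noteq> b2" "y \<noteq> b1" "y \<noteq> b2" using xy dZ by auto
    have xT: "x \<in> T'" "y \<in> T'" using xy by auto
    have dx: "dj [G1, G2, H x, {u1}, A1, A2, {b1}, {b2}, {u2}, {u3}, {u4}]" by (rule dG'[OF refl xT(1) nb(1,2)])
    have dy: "dj [G1, G2, H y, {u1}, A1, A2, {b1}, {b2}, {u2}, {u3}, {u4}]" by (rule dG'[OF refl xT(2) nb(3,4)])
    show False
    proof (cases "A = A1")
      case True
      then show False using fin[OF A1(1) A2(1) dx dy xT] xy by simp
    next
      case F: False
      have dx': "dj [G1, G2, H x, {u1}, A2, A1, {b1}, {b2}, {u2}, {u3}, {u4}]" using dx by clarsimp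
      have dy': "dj [G1, G2, H y, {u1}, A2, A1, {b1}, {b2}, {u2}, {u3}, {u4}]" using dy by clarsimp
      show False using fin[OF A2(1) A1(1) dx' dy' xT] xy F by simp
    qed
  qed
qed

end

section \<open>Kite-linkages and flowers from links\<close>

lemma dj_disjoint: "dj (X # Y # Zs) \<Longrightarrow> X \<inter> Y = {}"
  by simp

lemma path_interior:
  assumes "is_path E p" "hd p \<noteq> last p"
  shows "p = hd p # butlast (tl p) @ [last p]" "internal_verts p = set p - {hd p, last p}"
proof -
  obtain x q where p: "p = x # q" using assms(1) by (cases p) (auto simp: is_path_def)
  have "q \<noteq> []" using p assms(2) by auto
  then show *: "p = hd p # butlast (tl p) @ [last p]" using p by simp
  have "distinct (hd p # butlast (tl p) @ [last p])" using assms(1) * by (simp add: is_path_def)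
  moreover have "set p = insert (hd p) (insert (last p) (set (butlast (tl p))))" by (subst *) auto
  ultimately show "internal_verts p = set p - {hd p, last p}" unfolding internal_verts_def by auto
qed

text \<open>Different ends force at least one edge, and vertices incident with an edge belong to
  \<open>G\<close>; for a single vertex nothing would ensure this.\<close>

lemma vpathI:
  assumes "is_path E p" "hd p \<noteq> last p" "\<And>x y. E x y \<Longrightarrow> (x, y) \<in> arcs_ends G" "wf_digraph G"
  shows "vpath p G"
proof -
  have "successively E q \<Longrightarrow> set (vwalk_arcs q) \<subseteq> arcs_ends G" for q
    using assms(3) by (induction q rule: vwalk_arcs.induct) auto
  then have a: "set (vwalk_arcs p) \<subseteq> arcs_ends G" using assms(1) by (simp add: is_path_def)
  have v: "x \<in> verts G \<and> y \<in> verts G" if "(x, y) \<in> arcs_ends G" for x y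
    using that wf_digraph.adj_in_verts[OF assms(4)] by auto
  have "set (vwalk_arcs q) \<subseteq> arcs_ends G \<Longrightarrow> 2 \<le> length q \<Longrightarrow> set q \<subseteq> verts G" for q
  proof (induction q rule: vwalk_arcs.induct)
    case (3 x y xs)
    then show ?case using v by (cases xs) auto
  qed auto
  moreover have "2 \<le> length p" using assms(1,2) by (cases p rule: vwalk_arcs.cases) (auto simp: is_path_def)
  ultimately show ?thesis using a assms(1) by (auto simp: vpath_def is_path_def)
qed

lemma (in sgraph) is_path_concat:
  assumes "is_path adj p" "is_path adj q" "last p = hd q" "hd q \<noteq> last q" "set p \<inter> set q = {hd q}"
  shows "is_path adj (p @ tl q)" "set (p @ tl q) = set p \<union> set q" "hd (p @ tl q) = hd p" "last (p @ tl q) = last q"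
proof -
  obtain x r where q: "q = x # r" using assms(2) by (cases q) (auto simp: is_path_def)
  have r: "r \<noteq> []" using q assms(4) by auto
  have p: "p \<noteq> []" using assms(1) by (simp add: is_path_def)
  have "is_path adj r" "adj x (hd r)" "x \<notin> set r" using assms(2) r by (auto simp: q is_path_def successively_Cons)
  note xr = this
  have "set p \<inter> set r \<subseteq> {x}" using assms(5) q by auto
  then have "set p \<inter> set r = {}" using xr(3) by auto
  then show "is_path adj (p @ tl q)" using assms(1,3) xr r by (intro is_path_append) (auto simp: q)
  show "set (p @ tl q) = set p \<union> set q" using assms(3,5) q p by auto
  show "hd (p @ tl q) = hd p" "last (p @ tl q) = last q" using p r q by auto
qed

text \<open>The second path is run backwards without its ends. It has an inner vertex because its
  vertex set is not just the two ends, which gives the length 3 that \<open>graph_cycle\<close>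
  demands.\<close>

lemma (in sgraph) cycle_of_two_paths:
  assumes p: "is_path adj p" "hd p = a" "last p = b" and q: "is_path adj q" "hd q = a" "last q = b" and "a \<noteq> b"
    and "set p \<inter> set q = {a, b}" "set q \<noteq> {a, b}"
    and G: "\<And>x y. adj x y \<Longrightarrow> (x, y) \<in> arcs_ends G" "wf_digraph G"
  shows "graph_cycle G (p @ rev (butlast (tl q)))" "set (p @ rev (butlast (tl q))) = set p \<union> set q"
proof -
  define r where "r = butlast (tl q)"
  have qr: "q = a # r @ [b]" using path_interior(1)[OF q(1)] q assms(7) by (simp add: r_def)
  have r: "r \<noteq> []" using assms(9) by (auto simp: qr)
  have "successively adj (a # r @ [b])" "distinct (a # r @ [b])" using q(1) by (auto simp: qr is_path_def)
  then have pr: "is_path adj r" "adj a (hd r)" "adj (last r) b" "a \<notin> set r" "b \<notin> set r"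
    using r by (auto simp: is_path_def successively_Cons successively_append_iff)
  have pne: "p \<noteq> []" using p by (simp add: is_path_def)
  have "is_path adj (p @ rev r)"
  proof (rule is_path_append[OF p(1)])
    show "adj (last p) (hd (rev r))" using pr(3) adj_sym p(3) r by (simp add: hd_rev)
    show "set p \<inter> set (rev r) = {}" using assms(8) pr(4,5) by (auto simp: qr)
  qed (use is_path_rev[OF pr(1)] in simp)
  moreover have "hd (p @ rev r) = a" "last (p @ rev r) = hd r" using pne p(2) r by (auto simp: last_rev)
  moreover have "hd r \<noteq> a" using pr(4) r by auto
  ultimately have "vpath (p @ rev r) G" using vpathI[of adj "p @ rev r" G] G by auto
  moreover have "2 \<le> length p" using p assms(7) by (cases p rule: vwalk_arcs.cases) (auto simp: is_path_def)
  then have "3 \<le> length (p @ rev r)" using r by (cases r) auto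
  moreover have "last (p @ rev r) \<rightarrow>\<^bsub>G\<^esub> hd (p @ rev r)"
    using pr(2) adj_sym G(1) \<open>hd (p @ rev r) = a\<close> \<open>last (p @ rev r) = hd r\<close> by simp
  ultimately show "graph_cycle G (p @ rev (butlast (tl q)))" unfolding graph_cycle_def r_def by blast
  have "{a, b} \<subseteq> set p" using p pne by auto
  then show "set (p @ rev (butlast (tl q))) = set p \<union> set q" unfolding r_def[symmetric] by (auto simp: qr)
qed

lemma (in sgraph) link_path:
  assumes "link a Z b" "a \<noteq> b" "\<And>x y. adj x y \<Longrightarrow> (x, y) \<in> arcs_ends G" "wf_digraph G"
  obtains p where "is_path adj p" "hd p = a" "last p = b" "set p \<subseteq> Z \<union> {a, b}" "{a, b} \<subseteq> set p"
    "path_between G a p b" "internal_verts p \<subseteq> Z - {a, b}"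
proof -
  obtain p where p: "is_path adj p" "hd p = a" "last p = b" "set p \<subseteq> insert a (insert b Z)"
    using assms(1) conn_path unfolding link_def by metis
  have "p \<noteq> []" using p by (simp add: is_path_def)
  then have "{a, b} \<subseteq> set p" using p by auto
  moreover have "vpath p G" using vpathI[OF p(1)] p assms by auto
  moreover have "internal_verts p \<subseteq> Z - {a, b}" using path_interior(2)[OF p(1)] p assms(2) by auto
  ultimately show ?thesis using that[of p] p unfolding path_between_def by auto
qed

text \<open>Inner vertices of each path must avoid the ends of the others as well. For
  \<open>d\<close> this follows from \<open>d \<in> Y4\<close>, as \<open>Y4\<close> is disjoint
  from the other three sets.\<close>

lemma kite_linkage_of_links:
  assumes "sgraph adj" "\<And>x y. adj x y \<Longrightarrow> (x, y) \<in> arcs_ends G" "wf_digraph G" "distinct [a, b, c, d]"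
    and l: "sgraph.link adj a Y1 b" "sgraph.link adj b Y2 c" "sgraph.link adj c Y3 a" "sgraph.link adj a Y4 d"
    and dj: "d \<in> Y4" "dj [Y1, Y2, Y3, Y4, {b}, {a}, {c}]"
  shows "\<exists>Q. kite_linkage G (a, b, c, d) Q"
proof -
  interpret sgraph adj by fact
  have ne: "a \<noteq> b" "b \<noteq> c" "c \<noteq> a" "a \<noteq> d" "b \<noteq> d" "c \<noteq> d" using assms(4) by auto
  obtain p1 where p1: "set p1 \<subseteq> Y1 \<union> {a, b}" "path_between G a p1 b" "internal_verts p1 \<subseteq> Y1 - {a, b}"
    using link_path[OF l(1) ne(1) assms(2,3)] by metis
  obtain p2 where p2: "set p2 \<subseteq> Y2 \<union> {b, c}" "path_between G b p2 c" "internal_verts p2 \<subseteq> Y2 - {b, c}"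
    using link_path[OF l(2) ne(2) assms(2,3)] by metis
  obtain p3 where p3: "set p3 \<subseteq> Y3 \<union> {c, a}" "path_between G c p3 a" "internal_verts p3 \<subseteq> Y3 - {c, a}"
    using link_path[OF l(3) ne(3) assms(2,3)] by metis
  obtain p4 where p4: "set p4 \<subseteq> Y4 \<union> {a, d}" "path_between G a p4 d" "internal_verts p4 \<subseteq> Y4 - {a, d}"
    using link_path[OF l(4) ne(4) assms(2,3)] by metis
  have y: "a \<notin> Y1 \<union> Y2 \<union> Y3 \<union> Y4" "b \<notin> Y1 \<union> Y2 \<union> Y3 \<union> Y4" "c \<notin> Y1 \<union> Y2 \<union> Y3 \<union> Y4"
    "Y1 \<inter> Y2 = {}" "Y1 \<inter> Y3 = {}" "Y1 \<inter> Y4 = {}" "Y2 \<inter> Y3 = {}" "Y2 \<inter> Y4 = {}" "Y3 \<inter> Y4 = {}"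
    "Y2 \<inter> Y1 = {}" "Y3 \<inter> Y1 = {}" "Y4 \<inter> Y1 = {}" "Y3 \<inter> Y2 = {}" "Y4 \<inter> Y2 = {}" "Y4 \<inter> Y3 = {}" using dj(2) by auto
  have n: "d \<notin> Y1" "d \<notin> Y2" "d \<notin> Y3" using dj(1) y by auto
  have sub: "I \<inter> S = {}" if "I \<subseteq> Y - {v, w}" "S \<subseteq> Y' \<union> {v', w'}" "(Y - {v, w}) \<inter> (Y' \<union> {v', w'}) = {}" for I S Y Y' :: "'a set" and v w v' w'
    using that by blast
  have 1: "internal_verts p1 \<inter> set p2 = {}" "internal_verts p1 \<inter> set p3 = {}" "internal_verts p1 \<inter> set p4 = {}"
    using sub[OF p1(3) p2(1)] sub[OF p1(3) p3(1)] sub[OF p1(3) p4(1)] y n by auto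
  have 2: "internal_verts p2 \<inter> set p1 = {}" "internal_verts p2 \<inter> set p3 = {}" "internal_verts p2 \<inter> set p4 = {}"
    using sub[OF p2(3) p1(1)] sub[OF p2(3) p3(1)] sub[OF p2(3) p4(1)] y n by auto
  have 3: "internal_verts p3 \<inter> set p1 = {}" "internal_verts p3 \<inter> set p2 = {}" "internal_verts p3 \<inter> set p4 = {}"
    using sub[OF p3(3) p1(1)] sub[OF p3(3) p2(1)] sub[OF p3(3) p4(1)] y n by auto
  have y4: "(Y4 - {a, d}) \<inter> (Y1 \<union> {a, b}) = {}" "(Y4 - {a, d}) \<inter> (Y2 \<union> {b, c}) = {}" "(Y4 - {a, d}) \<inter> (Y3 \<union> {c, a}) = {}"
    using y(2,12) y(2,3,14) y(3,15) by auto
  have 4: "internal_verts p4 \<inter> set p1 = {}" "internal_verts p4 \<inter> set p2 = {}" "internal_verts p4 \<inter> set p3 = {}"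
    using sub[OF p4(3) p1(1) y4(1)] sub[OF p4(3) p2(1) y4(2)] sub[OF p4(3) p3(1) y4(3)] by auto
  have "internally_disjoint [p1, p2, p3, p4]"
    unfolding internally_disjoint_def using 1 2 3 4 by (auto simp: less_Suc_eq nth_Cons')
  then have "kite_linkage G (a, b, c, d) (p1, p2, p3, p4)"
    using p1(2) p2(2) p3(2) p4(2) unfolding kite_linkage_def by simp
  then show ?thesis by blast
qed

text \<open>Two links each make up \<open>C1\<close> and \<open>C2\<close>. The third cycle runs
  from \<open>f\<close> over \<open>q\<close> to \<open>g\<close> by \<open>K1\<close> and
  \<open>K3\<close>, and back over \<open>u4\<close> by \<open>L3\<close> and \<open>L1\<close>; the
  \<open>X\<close> links are the three connecting paths.\<close>

lemma flower_of_links: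
  assumes "sgraph adj" "\<And>x y. adj x y \<Longrightarrow> (x, y) \<in> arcs_ends G" "wf_digraph G"
    and nonadj: "\<not> adj u2 u1" "\<not> adj u2 u3"
    and l: "sgraph.link adj u2 A1 u1" "sgraph.link adj u2 A2 u1" "sgraph.link adj u2 B1 u3" "sgraph.link adj u2 B2 u3"
      "sgraph.link adj u1 X1 f" "sgraph.link adj u2 X2 q" "sgraph.link adj u3 X3 g" "sgraph.link adj f K1 q"
      "sgraph.link adj q K3 g" "sgraph.link adj u4 L1 f" "sgraph.link adj u4 L3 g"
    and d: "dj [A1, A2, B1, B2, X1, X2, X3, K1, K3, L1, L3, {f}, {q}, {g}, {u1}, {u2}, {u3}, {u4}]"
  shows "\<exists>F. flower G (u1, u2, u3, u4) F"
proof -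
  interpret sgraph adj by fact
  have ne: "u2 \<noteq> u1" "u2 \<noteq> u3" "u1 \<noteq> f" "u2 \<noteq> q" "u3 \<noteq> g" "f \<noteq> q" "q \<noteq> g" "u4 \<noteq> f" "u4 \<noteq> g" "f \<noteq> g" "u1 \<noteq> u3" "q \<noteq> u4" using d by auto
  note lp = link_path[OF _ _ assms(2,3)]
  obtain a1 where a1: "is_path adj a1" "hd a1 = u2" "last a1 = u1" "set a1 \<subseteq> A1 \<union> {u2, u1}" "{u2, u1} \<subseteq> set a1"
    using lp[OF l(1) ne(1)] by metis
  obtain a2 where a2: "is_path adj a2" "hd a2 = u2" "last a2 = u1" "set a2 \<subseteq> A2 \<union> {u2, u1}" "{u2, u1} \<subseteq> set a2"
    using lp[OF l(2) ne(1)] by metis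
  obtain b1 where b1: "is_path adj b1" "hd b1 = u2" "last b1 = u3" "set b1 \<subseteq> B1 \<union> {u2, u3}" "{u2, u3} \<subseteq> set b1"
    using lp[OF l(3) ne(2)] by metis
  obtain b2 where b2: "is_path adj b2" "hd b2 = u2" "last b2 = u3" "set b2 \<subseteq> B2 \<union> {u2, u3}" "{u2, u3} \<subseteq> set b2"
    using lp[OF l(4) ne(2)] by metis
  obtain p1 where p1: "set p1 \<subseteq> X1 \<union> {u1, f}" "path_between G u1 p1 f" "internal_verts p1 \<subseteq> X1 - {u1, f}"
    using lp[OF l(5) ne(3)] by metis
  obtain p2 where p2: "set p2 \<subseteq> X2 \<union> {u2, q}" "path_between G u2 p2 q" "internal_verts p2 \<subseteq> X2 - {u2, q}"
    using lp[OF l(6) ne(4)] by metis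
  obtain p3 where p3: "set p3 \<subseteq> X3 \<union> {u3, g}" "path_between G u3 p3 g" "internal_verts p3 \<subseteq> X3 - {u3, g}"
    using lp[OF l(7) ne(5)] by metis
  obtain k1 where k1: "is_path adj k1" "hd k1 = f" "last k1 = q" "set k1 \<subseteq> K1 \<union> {f, q}" "{f, q} \<subseteq> set k1"
    using lp[OF l(8) ne(6)] by metis
  obtain k3 where k3: "is_path adj k3" "hd k3 = q" "last k3 = g" "set k3 \<subseteq> K3 \<union> {q, g}" "{q, g} \<subseteq> set k3"
    using lp[OF l(9) ne(7)] by metis
  obtain l1 where l1: "is_path adj l1" "hd l1 = f" "last l1 = u4" "set l1 \<subseteq> L1 \<union> {f, u4}" "{f, u4} \<subseteq> set l1"
    using lp[OF link_sym[OF l(10)] ne(8)[symmetric]] by metis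
  obtain l3 where l3: "is_path adj l3" "hd l3 = u4" "last l3 = g" "set l3 \<subseteq> L3 \<union> {u4, g}" "{u4, g} \<subseteq> set l3"
    using lp[OF l(11) ne(9)] by metis
  \<comment> \<open>A path without inner vertices would be one of the two missing edges at
    \<open>u2\<close>.\<close>
  have two: "set p \<noteq> {u2, v}" if "is_path adj p" "hd p = u2" "last p = v" "u2 \<noteq> v" "\<not> adj u2 v" for p v
  proof
    assume s: "set p = {u2, v}"
    have "p = u2 # butlast (tl p) @ [v]" using path_interior(1)[OF that(1)] that by simp
    moreover have "internal_verts p = {}" using path_interior(2)[OF that(1)] that s by simp
    then have "butlast (tl p) = []" by (simp add: internal_verts_def)
    ultimately have "p = [u2, v]" by simp
    then show False using that(1,5) by (auto simp: is_path_def)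
  qed
  define C1 C2 where C12: "C1 = a1 @ rev (butlast (tl a2))" "C2 = b1 @ rev (butlast (tl b2))"
  have AB: "A1 \<inter> A2 = {}" "B1 \<inter> B2 = {}" "K1 \<inter> K3 = {}" "L1 \<inter> L3 = {}" "{u1, u2} \<inter> (A1 \<union> A2) = {}" "{u2, u3} \<inter> (B1 \<union> B2) = {}"
    "{f, q, g} \<inter> (K1 \<union> K3) = {}" "{f, u4, g} \<inter> (L1 \<union> L3) = {}" "(K1 \<union> K3 \<union> {q}) \<inter> (L1 \<union> L3 \<union> {u4}) = {}" using d by (clarsimp simp: Int_Un)+
  have meet: "S \<inter> S' = D" if "S \<subseteq> Y \<union> D" "S' \<subseteq> Y' \<union> D" "D \<subseteq> S" "D \<subseteq> S'" "Y \<inter> Y' = {}" for S S' Y Y' D :: "'a set"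
    using that by blast
  have a12: "set a1 \<inter> set a2 = {u2, u1}" by (rule meet[OF a1(4) a2(4) a1(5) a2(5) AB(1)])
  have b12: "set b1 \<inter> set b2 = {u2, u3}" by (rule meet[OF b1(4) b2(4) b1(5) b2(5) AB(2)])
  have C1: "graph_cycle G C1" "set C1 = set a1 \<union> set a2" unfolding C12
    using cycle_of_two_paths[OF a1(1-3) a2(1-3) ne(1) a12 two[OF a2(1-3) ne(1) nonadj(1)] assms(2,3)] by auto
  have C2: "graph_cycle G C2" "set C2 = set b1 \<union> set b2" unfolding C12
    using cycle_of_two_paths[OF b1(1-3) b2(1-3) ne(2) b12 two[OF b2(1-3) ne(2) nonadj(2)] assms(2,3)] by auto
  have kk: "set k1 \<inter> set k3 = {hd k3}" unfolding k3(2)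
    by (rule meet[of _ "K1 \<union> {f}" _ _ "K3 \<union> {g}"]) (use k1(4,5) k3(4,5) AB(3,7) ne(6,7,10) in auto)
  define k where "k = k1 @ tl k3"
  have k: "is_path adj k" "set k = set k1 \<union> set k3" "hd k = f" "last k = g"
    using is_path_concat[OF k1(1) k3(1) _ _ kk] k1 k3 ne(7) unfolding k_def by auto
  have ll: "set l1 \<inter> set l3 = {hd l3}" unfolding l3(2)
    by (rule meet[of _ "L1 \<union> {f}" _ _ "L3 \<union> {g}"]) (use l1(4,5) l3(4,5) AB(4,8) ne(10) in auto)
  define m where "m = l1 @ tl l3"
  have m: "is_path adj m" "set m = set l1 \<union> set l3" "hd m = f" "last m = g"
    using is_path_concat[OF l1(1) l3(1) _ _ ll] l1 l3 ne(9) unfolding m_def by auto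
  have km: "set k \<inter> set m = {f, g}" unfolding k(2) m(2)
  proof (rule meet[OF _ _ _ _ AB(9)])
    show "set k1 \<union> set k3 \<subseteq> K1 \<union> K3 \<union> {q} \<union> {f, g}" using k1(4) k3(4) by auto
    show "set l1 \<union> set l3 \<subseteq> L1 \<union> L3 \<union> {u4} \<union> {f, g}" using l1(4) l3(4) by auto
  qed (use k1(5) k3(5) l1(5) l3(5) in auto)
  have u4m: "u4 \<in> set m" using l1(5) m(2) by auto
  then have "set m \<noteq> {f, g}" using ne(8,9) by auto
  define C3 where "C3 = k @ rev (butlast (tl m))"
  have C3: "graph_cycle G C3" "set C3 = set k \<union> set m" unfolding C3_def
    using cycle_of_two_paths[OF k(1,3,4) m(1,3,4) ne(10) km \<open>set m \<noteq> {f, g}\<close> assms(2,3)] by auto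
  have s1: "set C1 \<subseteq> A1 \<union> A2 \<union> {u1} \<union> {u2}" using a1(4) a2(4) unfolding C1(2) by auto
  have s2: "set C2 \<subseteq> B1 \<union> B2 \<union> {u3} \<union> {u2}" using b1(4) b2(4) unfolding C2(2) by auto
  have s3: "set C3 \<subseteq> K1 \<union> K3 \<union> L1 \<union> L3 \<union> {f} \<union> {q} \<union> {g} \<union> {u4}" using k1(4) k3(4) l1(4) l3(4) unfolding C3(2) k(2) m(2) by auto
  have in3: "f \<in> set C3" "q \<in> set C3" "g \<in> set C3" using k1(5) k3(5) unfolding C3(2) k(2) by auto
  have "dj [A1 \<union> A2 \<union> {u1}, B1 \<union> B2 \<union> {u3}, {u2}, K1 \<union> K3 \<union> L1 \<union> L3 \<union> {f} \<union> {q} \<union> {g} \<union> {u4}]"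
    using d by (clarsimp simp: Int_Un)
  note dC = this
  have i1: "set C1 \<inter> set C2 = {u2}"
  proof -
    have "(A1 \<union> A2 \<union> {u1}) \<inter> (B1 \<union> B2 \<union> {u3}) = {}" by (rule dj_disjoint[OF dC])
    then have "set C1 \<inter> set C2 \<subseteq> {u2}" using s1 s2 by blast
    moreover have "u2 \<in> set C1" "u2 \<in> set C2" using a1(5) b1(5) C1(2) C2(2) by auto
    ultimately show ?thesis by auto
  qed
  have i2: "set C3 \<inter> set C1 = {}" "set C3 \<inter> set C2 = {}"
  proof -
    have z: "(K1 \<union> K3 \<union> L1 \<union> L3 \<union> {f} \<union> {q} \<union> {g} \<union> {u4}) \<inter> (A1 \<union> A2 \<union> {u1} \<union> {u2}) = {}"
      "(K1 \<union> K3 \<union> L1 \<union> L3 \<union> {f} \<union> {q} \<union> {g} \<union> {u4}) \<inter> (B1 \<union> B2 \<union> {u3} \<union> {u2}) = {}"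
      using d by (clarsimp simp: Int_Un)+
    have small: "S \<inter> S' = {}" if "S \<subseteq> M" "S' \<subseteq> M'" "M \<inter> M' = {}" for S S' M M' :: "'a set" using that by auto
    show "set C3 \<inter> set C1 = {}" by (rule small[OF s3 s1 z(1)])
    show "set C3 \<inter> set C2 = {}" by (rule small[OF s3 s2 z(2)])
  qed
  have XX: "dj [X1, A1 \<union> A2 \<union> {u1} \<union> {u2}]" "dj [X1, B1 \<union> B2 \<union> {u3} \<union> {u2}]" "dj [X1, K1 \<union> K3 \<union> L1 \<union> L3 \<union> {f} \<union> {q} \<union> {g} \<union> {u4}]"
    "dj [X2, A1 \<union> A2 \<union> {u1} \<union> {u2}]" "dj [X2, B1 \<union> B2 \<union> {u3} \<union> {u2}]" "dj [X2, K1 \<union> K3 \<union> L1 \<union> L3 \<union> {f} \<union> {q} \<union> {g} \<union> {u4}]"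
    "dj [X3, A1 \<union> A2 \<union> {u1} \<union> {u2}]" "dj [X3, B1 \<union> B2 \<union> {u3} \<union> {u2}]" "dj [X3, K1 \<union> K3 \<union> L1 \<union> L3 \<union> {f} \<union> {q} \<union> {g} \<union> {u4}]"
    using d by (clarsimp simp: Int_Un)+
  have i3: "Y \<inter> (set C1 \<union> set C2 \<union> set C3) = {}"
    if "Y \<inter> (A1 \<union> A2 \<union> {u1} \<union> {u2}) = {}" "Y \<inter> (B1 \<union> B2 \<union> {u3} \<union> {u2}) = {}"
      "Y \<inter> (K1 \<union> K3 \<union> L1 \<union> L3 \<union> {f} \<union> {q} \<union> {g} \<union> {u4}) = {}" for Y
  proof -
    have "Y \<inter> (set C1 \<union> set C2 \<union> set C3) \<subseteq> Y \<inter> (A1 \<union> A2 \<union> {u1} \<union> {u2} \<union> (B1 \<union> B2 \<union> {u3} \<union> {u2}) \<union> (K1 \<union> K3 \<union> L1 \<union> L3 \<union> {f} \<union> {q} \<union> {g} \<union> {u4}))"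
      by (intro Int_mono Un_mono subset_refl s1 s2 s3)
    also have "\<dots> = {}" unfolding Int_Un_distrib[of Y "_ \<union> (B1 \<union> B2 \<union> {u3} \<union> {u2})"] Int_Un_distrib[of Y "A1 \<union> A2 \<union> {u1} \<union> {u2}"] that by simp
    finally show ?thesis by simp
  qed
  note i3 = i3[OF XX(1-3)[THEN dj_disjoint]] i3[OF XX(4-6)[THEN dj_disjoint]] i3[OF XX(7-9)[THEN dj_disjoint]]
  have i4: "\<forall>P\<in>{p1, p2, p3}. internal_verts P \<inter> (set C1 \<union> set C2 \<union> set C3) = {}"
    
  proof -
    have "I \<inter> M = {}" if "I \<subseteq> Y - {v, w}" "Y \<inter> M = {}" for I M Y :: "'a set" and v w using that by auto
    from this[OF p1(3) i3(1)] this[OF p2(3) i3(2)] this[OF p3(3) i3(3)] show ?thesis by simp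
  qed
  have "dj [X1 \<union> {u1} \<union> {f}, X2 \<union> {u2} \<union> {q}, X3 \<union> {u3} \<union> {g}]" using d by (clarsimp simp: Int_Un)
  then have "dj [X1 \<union> {u1, f}, X2 \<union> {u2, q}, X3 \<union> {u3, g}]" by (simp add: insert_commute)
  then have "dj [set p1, set p2, set p3]" by (rule dj_mono) (use p1(1) p2(1) p3(1) in simp)
  then have i5: "set p1 \<inter> set p2 = {}" "set p1 \<inter> set p3 = {}" "set p2 \<inter> set p3 = {}" by auto
  \<comment> \<open>The list \<open>C3\<close> starts in \<open>f\<close> and passes
    \<open>q\<close> and \<open>g\<close> before it returns through \<open>u4\<close>, so no
    rotation or reversal is necessary.\<close>
  have "subseq [f, q, g, u4] C3"
  proof -
    have k1': "k1 = [f] @ tl k1" "k3 = [q] @ tl k3" using k1(1,2) k3(1,2) by (auto simp: is_path_def)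
    have qk: "q \<in> set (tl k1)" using k1' k1(5) ne(6) by (metis Un_iff insert_iff empty_iff insert_subset list.set(1) list.set(2) set_append)
    have gk: "g \<in> set (tl k3)" using k1' k3(5) ne(7) by (metis Un_iff insert_iff empty_iff insert_subset list.set(1) list.set(2) set_append)
    have "m = f # butlast (tl m) @ [g]" using path_interior(1)[OF m(1)] m ne(10) by simp
    then have "u4 \<in> set (butlast (tl m))" using u4m ne(8,9) by (metis in_set_conv_decomp insert_iff list.simps(15) rotate1.simps(2) set_rotate1)
    then have "subseq [u4] (rev (butlast (tl m)))" by (simp add: subseq_singleton_left)
    moreover have "subseq [q] (tl k1)" "subseq [g] (tl k3)" using qk gk by (simp_all add: subseq_singleton_left)
    ultimately have "subseq ([f] @ [q] @ [g] @ [u4]) ([f] @ tl k1 @ tl k3 @ rev (butlast (tl m)))"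
      by (intro list_emb_append_mono) auto
    moreover have "C3 = [f] @ tl k1 @ tl k3 @ rev (butlast (tl m))" unfolding C3_def k_def by (subst k1'(1)) simp
    ultimately show ?thesis by simp
  qed
  then have "in_cyclic_order [f, q, g, u4] C3" unfolding in_cyclic_order_def by (intro exI[of _ 0]) simp
  moreover have "u1 \<in> set C1" "u3 \<in> set C2" using a1(5) b1(5) C1(2) C2(2) by auto
  ultimately have "flower G (u1, u2, u3, u4) (C1, C2, C3, p1, p2, p3)"
    unfolding flower_def prod.case using C1(1) C2(1) C3(1) i1 i2 i4 i5 in3 p1(2) p2(2) p3(2) by blast
  then show ?thesis by blast
qed

section \<open>From graphs of the library to \<open>kitefree\<close>\<close>

theorem theorem4p3:
  fixes G :: "('a,'b) pre_digraph" and u\<^sub>1 u\<^sub>2 u\<^sub>3 u\<^sub>4 :: 'a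
  assumes "graph G"
    and "k_connected 8 G"
    and "{u\<^sub>1, u\<^sub>2, u\<^sub>3, u\<^sub>4} \<subseteq> verts G"
    and "distinct [u\<^sub>1, u\<^sub>2, u\<^sub>3, u\<^sub>4]"
    and "\<not> (\<exists>Q. kite_linkage G (u\<^sub>2, u\<^sub>1, u\<^sub>3, u\<^sub>4) Q)"
  shows "(\<exists>F. flower G (u\<^sub>1, u\<^sub>2, u\<^sub>3, u\<^sub>4) F) \<or> (\<exists>F. flower G (u\<^sub>3, u\<^sub>2, u\<^sub>1, u\<^sub>4) F)"
proof (rule ccontr)
  assume "\<not> ?thesis"
  then have no: "\<not> (\<exists>F. flower G (u\<^sub>1, u\<^sub>2, u\<^sub>3, u\<^sub>4) F)" by simp
  interpret G: graph G by fact
  define adj where "adj x y \<longleftrightarrow> (x, y) \<in> arcs_ends G \<and> {x, y} \<noteq> {u\<^sub>1, u\<^sub>2} \<and> {x, y} \<noteq> {u\<^sub>2, u\<^sub>3}" for x y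
  have sym: "(y, x) \<in> arcs_ends G" if "(x, y) \<in> arcs_ends G" for x y
    using arcs_ends_symmetric[OF G.sym_arcs that] .
  interpret sgraph adj by unfold_locales (auto simp: adj_def insert_commute sym)
  have G_adj: "(x, y) \<in> arcs_ends G" if "adj x y" for x y using that by (simp add: adj_def)
  have verts: "x \<in> verts G" "y \<in> verts G" if "(x, y) \<in> arcs_ends G" for x y
    using that G.adj_in_verts by auto
  have irrefl: "(x, x) \<notin> arcs_ends G" for x using G.adj_not_same by auto
  have big: "8 < card (verts G)" using assms(2) by (simp add: k_connected_def)
  have kc: "(x, y) \<in> rtrancl_on (verts G - S) ((arcs_ends (G \<restriction> (verts G - S)))\<^sup>s)"
    if "finite S" "card S < 8" "x \<in> verts G - S" "y \<in> verts G - S" for S x y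
  proof -
    have "card (S \<inter> verts G) < 8" using card_mono[of S "S \<inter> verts G"] that(1,2) by auto
    then have "Digraph_Component.connected (G \<restriction> (verts G - S \<inter> verts G))"
      using assms(2) by (auto simp: k_connected_def)
    moreover have "verts G - S \<inter> verts G = verts G - S" by auto
    ultimately show ?thesis using that(3,4) unfolding connected_conv by simp
  qed
  have dom: "(x, y) \<in> arcs_ends G \<and> x \<in> X \<and> y \<in> X" if "(x, y) \<in> (arcs_ends (G \<restriction> X))\<^sup>s" for x y X
    using that sym by (auto simp: symcl_def arcs_ends_conv)
  \<comment> \<open>Otherwise the neighbourhood of \<open>u\<^sub>2\<close> is a separator with
    fewer than 8 vertices: there are more than 8 vertices, so some \<open>w\<close> remains beyond
    it.\<close>
  have deg: "8 \<le> card {x. (u\<^sub>2, x) \<in> arcs_ends G}"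
  proof (rule ccontr)
    define N where "N = {x. (u\<^sub>2, x) \<in> arcs_ends G}"
    assume "\<not> ?thesis"
    then have c: "card N < 8" by (simp add: N_def)
    have N: "finite N" using finite_subset[OF _ G.finite_verts, of N] verts by (auto simp: N_def)
    have "card (insert u\<^sub>2 N) \<le> 8" using c N by (simp add: card_insert_if)
    then have "\<not> verts G \<subseteq> insert u\<^sub>2 N" using card_mono[of "insert u\<^sub>2 N" "verts G"] N big by auto
    then obtain w where w: "w \<in> verts G - N" "w \<noteq> u\<^sub>2" by blast
    have u: "u\<^sub>2 \<in> verts G - N" using assms(3) irrefl by (auto simp: N_def)
    have "(u\<^sub>2, w) \<in> rtrancl_on (verts G - N) ((arcs_ends (G \<restriction> (verts G - N)))\<^sup>s)" by (rule kc[OF N c u w(1)])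
    then have "w = u\<^sub>2"
    proof (induction rule: rtrancl_on_induct)
      case (step y z)
      then show ?case using dom[of y z "verts G - N"] by (auto simp: N_def)
    qed simp
    then show False using w(2) by simp
  qed
  interpret k: kitefree adj "verts G" u\<^sub>1 u\<^sub>2 u\<^sub>3 u\<^sub>4
  proof unfold_locales
    show "finite (verts G)" by (rule G.finite_verts)
    show "8 < card (verts G)" by (rule big)
    show "x \<in> verts G" if "adj x y" for x y using verts(1)[OF G_adj[OF that]] .
    show "\<not> adj x x" for x using irrefl by (simp add: adj_def)
    show "distinct [u\<^sub>1, u\<^sub>2, u\<^sub>3, u\<^sub>4]" "{u\<^sub>1, u\<^sub>2, u\<^sub>3, u\<^sub>4} \<subseteq> verts G" by (fact assms)+
    show "\<not> adj u\<^sub>2 u\<^sub>1" "\<not> adj u\<^sub>2 u\<^sub>3" by (auto simp: adj_def)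
    show "conn (verts G - S) x y" if S: "finite S" "card S \<le> 7" "u\<^sub>2 \<in> S" "x \<in> verts G - S" "y \<in> verts G - S" for S x y
    proof -
      have "(x, y) \<in> rtrancl_on (verts G - S) ((arcs_ends (G \<restriction> (verts G - S)))\<^sup>s)" using S by (intro kc) auto
      then show ?thesis
      proof (induction rule: rtrancl_on_induct)
        case base show ?case using S(4) by (rule conn_refl)
      next
        case (step y z)
        from dom[OF step.hyps(2)] have yz: "(y, z) \<in> arcs_ends G" "y \<in> verts G - S" "z \<in> verts G - S" by auto
        \<comment> \<open>Both deleted edges contain \<open>u\<^sub>2\<close>, which is in
          \<open>S\<close>, so all edges between the remaining vertices survive in
          \<open>adj\<close>.\<close>
        then have "adj y z" using S(3) unfolding adj_def by auto
        then have "conn (verts G - S) y z" using yz by (intro conn_step)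
        with step.IH show ?case by (rule conn_trans)
      qed
    qed
    show "6 \<le> card {x. adj u\<^sub>2 x}"
    proof -
      define N where "N = {x. (u\<^sub>2, x) \<in> arcs_ends G}"
      have N: "finite N" using finite_subset[OF _ G.finite_verts, of N] verts by (auto simp: N_def)
      have "N - {u\<^sub>1, u\<^sub>3} \<subseteq> {x. adj u\<^sub>2 x}" by (auto simp: adj_def N_def doubleton_eq_iff)
      moreover have "{x. adj u\<^sub>2 x} \<subseteq> N" by (auto simp: adj_def N_def)
      then have "finite {x. adj u\<^sub>2 x}" using N finite_subset by blast
      ultimately have "card (N - {u\<^sub>1, u\<^sub>3}) \<le> card {x. adj u\<^sub>2 x}" by (intro card_mono)
      moreover have "card N - card {u\<^sub>1, u\<^sub>3} \<le> card (N - {u\<^sub>1, u\<^sub>3})" by (rule diff_card_le_card_Diff) simp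
      moreover have "card {u\<^sub>1, u\<^sub>3} \<le> 2" by (simp add: card_insert_if)
      ultimately show ?thesis using deg unfolding N_def by linarith
    qed
    show False if "link u\<^sub>2 Y1 u\<^sub>1" "link u\<^sub>1 Y2 u\<^sub>3" "link u\<^sub>3 Y3 u\<^sub>2" "link u\<^sub>2 Y4 u\<^sub>4" "u\<^sub>4 \<in> Y4"
      "dj [Y1, Y2, Y3, Y4, {u\<^sub>1}, {u\<^sub>2}, {u\<^sub>3}]" for Y1 Y2 Y3 Y4
    proof -
      have "distinct [u\<^sub>2, u\<^sub>1, u\<^sub>3, u\<^sub>4]" using assms(4) by auto
      from kite_linkage_of_links[OF sgraph_axioms G_adj G.wf_digraph_axioms this that] show False using assms(5) by simp
    qed
    show False if "link u\<^sub>2 A1 u\<^sub>1" "link u\<^sub>2 A2 u\<^sub>1" "link u\<^sub>2 B1 u\<^sub>3" "link u\<^sub>2 B2 u\<^sub>3" "link u\<^sub>1 X1 f" "link u\<^sub>2 X2 q" "link u\<^sub>3 X3 g"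
      "link f K1 q" "link q K3 g" "link u\<^sub>4 L1 f" "link u\<^sub>4 L3 g"
      "dj [A1, A2, B1, B2, X1, X2, X3, K1, K3, L1, L3, {f}, {q}, {g}, {u\<^sub>1}, {u\<^sub>2}, {u\<^sub>3}, {u\<^sub>4}]"
      for A1 A2 B1 B2 X1 f X2 q X3 g K1 K3 L1 L3
    proof -
      have "\<not> adj u\<^sub>2 u\<^sub>1" "\<not> adj u\<^sub>2 u\<^sub>3" by (auto simp: adj_def)
      from flower_of_links[OF sgraph_axioms G_adj G.wf_digraph_axioms this that] show False using no by simp
    qed
  qed
  show False by (rule k.inconsistent)
qed

end
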